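(* Let $d\ge1$, $n\ge 1$, $v_*,v_1,\dots,v_n\in\mathbb R^d$ and $$\mathcal V=\{v_*\pm v_\ell:\ \ell=1,\dots,n\}.$$ Then: (i) If $\{v_1,\dots,v_n\}$ spans $\mathbb R^d$, then the matrix $\sum_{v\in\mathcal V}\mathbf v\otimes\mathbf v\in\mathbb R^{(d+1)\times(d+1)}$, with $\mathbf v=(1,v)$, is invertible. (ii) If the only integer-valued solution to $\alpha_1v_1+\cdots+\alpha_nv_n=0$ is $\alpha_1=\cdots=\alpha_n=0$, then with $\kappa=(2n+1)d+2$ there exists a constant $C$, depending only on $d$ and $\mathcal V$, such that for all $M\ge1$, all $\mathbf i\in\mathcal D_M$ and all $f:Y_M(\mathbf i)\to\mathbb R$, $$E_{\nu_{M,\mathbf i}}\big[(f-E_{\nu_{M,\mathbf i}}[f])^2\big]\le CM^\kappa\,\big\langle f,-(L_M^{ex,s}+L_M^{c})f\big\rangle_{\nu_{M,\mathbf i}}.$$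
   Context: For $v\in\mathcal V$ put $\mathbf v=(1,v)\in\mathbb R^{d+1}$. For an integer $M\ge1$, $\Lambda_M=\{x\in\mathbb Z^d:|x_i|\le M,\ i=1,\dots,d\}$. Configurations $\eta\in\{0,1\}^{\Lambda_M\times\mathcal V}$ have entries $\eta_x(v)$. Define $\mathbf I(\eta_x)=\sum_{v\in\mathcal V}\mathbf v\,\eta_x(v)$ and $\mathbf I_0^M(\eta)=|\Lambda_M|^{-1}\sum_{z\in\Lambda_M}\mathbf I(\eta_z)$. $\mathcal D_M$ is the set of all values of $\mathbf I_0^M$ on $\{0,1\}^{\Lambda_M\times\mathcal V}$; for $\mathbf i\in\mathcal D_M$, $Y_M(\mathbf i)=\{\eta:\mathbf I_0^M(\eta)=\mathbf i\}$, and $\nu_{M,\mathbf i}$ is the uniform probability measure on $Y_M(\mathbf i)$. $\langle f,g\rangle_\nu=E_\nu[fg]$. Let $\mathcal Q=\{q=(v,w,v',w')\in\mathcal V^4:v+w=v'+w'\}$. The operators are $$L_M^{ex,s}f(\eta)=\sum_{v\in\mathcal V}\sum_{x,y\in\Lambda_M,|x-y|=1}\eta_x(v)(1-\eta_y(v))[f(\eta^{x,y,v})-f(\eta)],$$ $$L_M^{c}f(\eta)=\sum_{q\in\mathcal Q}\sum_{x\in\Lambda_M}p(x,q,\eta)[f(\eta^{x,q})-f(\eta)],$$ where $\eta^{x,y,v}$ is $\eta$ with $\eta_x(v)$ and $\eta_y(v)$ swapped; for $q=(v,w,v',w')$, $p(x,q,\eta)=\eta_x(v)\eta_x(w)(1-\eta_x(v'))(1-\eta_x(w'))$;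 and, when $p(x,q,\eta)=1$, $\eta^{x,q}$ is $\eta$ with the occupancies at $x$ of $v,w$ set to $0$ and of $v',w'$ set to $1$ (when $p=0$ the term is $0$). *)

theory Defs
  imports "HOL-Probability.Probability"
begin

definition velocities :: "nat \<Rightarrow> real^'d \<Rightarrow> (nat \<Rightarrow> real^'d) \<Rightarrow> (real^'d) set" where
  "velocities n vstar v = (\<Union>l\<in>{1..n}. {vstar + v l, vstar - v l})"

text \<open>The vector \<open>(1, v)\<close> of \<open>\<real>\<^sup>d\<^sup>+\<^sup>1\<close>, with coordinates indexed by \<open>'d option\<close>;
  the leading coordinate is \<open>None\<close>.\<close>

definition bvec :: "real^'d \<Rightarrow> real^('d option)" where
  "bvec v = (\<chi> i. case i of None \<Rightarrow> 1 | Some j \<Rightarrow> v $ j)"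

definition tensor :: "real^'m \<Rightarrow> real^'n \<Rightarrow> real^'n^'m" where
  "tensor a b = (\<chi> i j. a $ i * b $ j)"

definition Lam :: "nat \<Rightarrow> (int^'d) set" where
  "Lam M = {x. \<forall>i. \<bar>x $ i\<bar> \<le> int M}"

text \<open>Euclidean length of a lattice vector.\<close>

definition lattice_norm :: "int^'d \<Rightarrow> real" where
  "lattice_norm x = norm ((\<chi> i. real_of_int (x $ i)) :: real^'d)"

type_synonym 'd config = "int^'d \<Rightarrow> real^'d \<Rightarrow> real"

definition configs :: "(real^'d) set \<Rightarrow> nat \<Rightarrow> 'd config set" where
  "configs V M = Lam M \<rightarrow>\<^sub>E (V \<rightarrow>\<^sub>E {0, 1})"

definition invariants :: "(real^'d) set \<Rightarrow> (real^'d \<Rightarrow> real) \<Rightarrow> real^('d option)" where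
  "invariants V \<xi> = (\<Sum>v\<in>V. \<xi> v *\<^sub>R bvec v)"

definition mean_invariants :: "(real^'d) set \<Rightarrow> nat \<Rightarrow> 'd config \<Rightarrow> real^('d option)" where
  "mean_invariants V M \<eta> =
     (1 / real (card (Lam M :: (int^'d) set))) *\<^sub>R (\<Sum>z\<in>Lam M. invariants V (\<eta> z))"

definition invariant_values :: "(real^'d) set \<Rightarrow> nat \<Rightarrow> (real^('d option)) set" where
  "invariant_values V M = mean_invariants V M ` configs V M"

definition level_set :: "(real^'d) set \<Rightarrow> nat \<Rightarrow> real^('d option) \<Rightarrow> 'd config set" where
  "level_set V M i = {\<eta> \<in> configs V M. mean_invariants V M \<eta> = i}"

definition canonical :: "(real^'d) set \<Rightarrow> nat \<Rightarrow> real^('d option) \<Rightarrow> 'd config pmf" where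
  "canonical V M i = pmf_of_set (level_set V M i)"

definition pmf_inner :: "'a pmf \<Rightarrow> ('a \<Rightarrow> real) \<Rightarrow> ('a \<Rightarrow> real) \<Rightarrow> real" where
  "pmf_inner \<nu> f g = measure_pmf.expectation \<nu> (\<lambda>\<eta>. f \<eta> * g \<eta>)"

definition exchange :: "int^'d \<Rightarrow> int^'d \<Rightarrow> real^'d \<Rightarrow> 'd config \<Rightarrow> 'd config" where
  "exchange x y v \<eta> = \<eta>(x := (\<eta> x)(v := \<eta> y v), y := (\<eta> y)(v := \<eta> x v))"

definition L_ex :: "(real^'d) set \<Rightarrow> nat \<Rightarrow> ('d config \<Rightarrow> real) \<Rightarrow> 'd config \<Rightarrow> real" where
  "L_ex V M f \<eta> =
     (\<Sum>v\<in>V. \<Sum>(x, y)\<in>{(x, y). x \<in> Lam M \<and> y \<in> Lam M \<and> lattice_norm (x - y) = 1}.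
        \<eta> x v * (1 - \<eta> y v) * (f (exchange x y v \<eta>) - f \<eta>))"

type_synonym 'd collision = "(real^'d) \<times> (real^'d) \<times> (real^'d) \<times> (real^'d)"

definition collisions :: "(real^'d) set \<Rightarrow> 'd collision set" where
  "collisions V = {(v, w, v', w'). v \<in> V \<and> w \<in> V \<and> v' \<in> V \<and> w' \<in> V \<and> v + w = v' + w'}"

definition coll_rate :: "int^'d \<Rightarrow> 'd collision \<Rightarrow> 'd config \<Rightarrow> real" where
  "coll_rate x = (\<lambda>(v, w, v', w') \<eta>. \<eta> x v * \<eta> x w * (1 - \<eta> x v') * (1 - \<eta> x w'))"

text \<open>Only meaningful when \<^term>\<open>coll_rate x q \<eta> = 1\<close>; otherwise its value is multiplied by
  \<open>0\<close> in the generator below.\<close>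

definition collide :: "int^'d \<Rightarrow> 'd collision \<Rightarrow> 'd config \<Rightarrow> 'd config" where
  "collide x = (\<lambda>(v, w, v', w') \<eta>. \<eta>(x := (\<eta> x)(v := 0, w := 0, v' := 1, w' := 1)))"

definition L_coll :: "(real^'d) set \<Rightarrow> nat \<Rightarrow> ('d config \<Rightarrow> real) \<Rightarrow> 'd config \<Rightarrow> real" where
  "L_coll V M f \<eta> =
     (\<Sum>q\<in>collisions V. \<Sum>x\<in>Lam M. coll_rate x q \<eta> * (f (collide x q \<eta>) - f \<eta>))"

text \<open>Functions on a level set are represented by total functions on configurations. An exchange
  maps each level set to itself. A collision of positive rate does so as well unless \<open>v = w\<close> or
  \<open>v' = w'\<close> (then the particle number could change); when \<open>v\<^sub>1, \<dots>, v\<^sub>n\<close> have no nontrivial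
  integer relation, these collisions have \<open>v = w = v' = w'\<close>, hence rate \<open>0\<close>. So only the values
  on the level set enter.\<close>

definition int_independent :: "nat \<Rightarrow> (nat \<Rightarrow> real^'d) \<Rightarrow> bool" where
  "int_independent n v \<longleftrightarrow>
     (\<forall>\<alpha> :: nat \<Rightarrow> int. (\<Sum>l=1..n. real_of_int (\<alpha> l) *\<^sub>R v l) = 0 \<longrightarrow> (\<forall>l\<in>{1..n}. \<alpha> l = 0))"

end

theory Submission
  imports Defs
begin

text \<open>(i) If \<open>(1, u) \<bullet> x = 0\<close> for all \<open>u \<in> V\<close>, subtracting the equations for \<open>vstar \<plusminus> v l\<close> shows that
  the spatial part of \<open>x\<close> is orthogonal to every \<open>v l\<close>.

  (ii) Integer independence forces every effective collision to replace one pair \<open>vstar \<plusminus> v l'\<close> by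
  another pair \<open>vstar \<plusminus> v l\<close>, so a level set splits into cells labelled by the numbers \<open>a l\<close> of
  particles of velocity \<open>vstar - v l\<close>, whose sum is fixed. Within a cell, averaging over the group
  of permutations of the sites of each velocity, which acts transitively, bounds the variance by
  the exclusion Dirichlet form. Neighbouring cell means are compared by gathering the four
  occupations involved in a collision at one site, colliding there, and spreading out again; since
  the site is chosen at an occupied position, this costs \<open>|\<Lambda>|\<^sup>3 M\<^sup>2\<close>. Cell sizes are log-concave in the
  label, so two cells are joined by a path along which the size stays above the minimum of its
  endpoints; there are \<open>O(|\<Lambda>|\<^sup>n\<^sup>-\<^sup>1)\<close> cells and paths of length \<open>O(|\<Lambda>|)\<close>, which gives
  \<open>|\<Lambda>|\<^sup>n\<^sup>+\<^sup>3 M\<^sup>2 \<le> C M ^ \<kappa>\<close> for \<open>n \<ge> 2\<close>; for \<open>n = 1\<close> there is a single cell.\<close>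

subsection \<open>Displacements and exchanges\<close>

text \<open>All estimates are unnormalised sums over configurations. The measure is uniform and
  every exchange is a bijection, so \<open>displacement\<close> is an L2 norm in which the costs of
  composed moves add up; squares are taken only at the end. The count of powers is tight for two
  pairs of velocities: |Lambda| cells and paths of |Lambda| steps leave only |Lambda|^3 for one step
  between neighbouring cells, whereas the sum over the four gathered sites has |Lambda|^4 terms. The
  missing factor is recovered in \<open>class_edge\<close>. There the energy is restricted to
  configurations in which one velocity has a fixed occupation at the meeting site, so that summing
  over this site yields the number of occupied (or empty) sites instead of |Lambda|, and that number
  is at most the number of admissible 4-tuples by which the estimate is divided. For a single pair
  even the improved total |Lambda|^4 would exceed the available |Lambda|^3, hence the separate case.
  The constant is fixed before n; integer independence makes the 2n velocities distinct, so n can be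
  read off from \<open>V\<close>.\<close>

definition displacement :: "('a \<Rightarrow> real) \<Rightarrow> ('a \<Rightarrow> 'a) \<Rightarrow> 'a set \<Rightarrow> real" where
  "displacement f g Z = L2_set (\<lambda>z. f (g z) - f z) Z"

lemma displacement_nonneg: "0 \<le> displacement f g Z"
  by (simp add: displacement_def L2_set_nonneg)

lemma displacement_power2: "(displacement f g Z)\<^sup>2 = (\<Sum>z\<in>Z. (f (g z) - f z)\<^sup>2)"
  by (simp add: displacement_def L2_set_def sum_nonneg)

text \<open>Minkowski's inequality. Since \<open>h\<close> permutes \<open>Z\<close>, the increments
  of \<open>f\<close> along \<open>g\<close> at the points \<open>h z\<close> are the increments at
  the points of \<open>Z\<close> in another order.\<close>

lemma displacement_comp_le:
  assumes "bij_betw h Z Z"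
  shows "displacement f (g \<circ> h) Z \<le> displacement f g Z + displacement f h Z"
proof -
  have "displacement f (g \<circ> h) Z = L2_set (\<lambda>z. (f (g (h z)) - f (h z)) + (f (h z) - f z)) Z"
    by (simp add: displacement_def)
  also have "\<dots> \<le> L2_set (\<lambda>z. f (g (h z)) - f (h z)) Z + L2_set (\<lambda>z. f (h z) - f z) Z"
    by (rule L2_set_triangle_ineq)
  also have "L2_set (\<lambda>z. f (g (h z)) - f (h z)) Z = displacement f g Z"
    using sum.reindex_bij_betw[OF assms, of "\<lambda>z. (f (g z) - f z)\<^sup>2"]
    by (simp add: displacement_def L2_set_def)
  finally show ?thesis by (simp add: displacement_def)
qed

lemma displacement_id: "displacement f (\<lambda>z. z) Z = 0"
  by (simp add: displacement_def L2_set_def)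

section \<open>Variances as sums over pairs, and averaging over a transitive family of maps\<close>

lemma sum_sum_diff_square:
  fixes f :: "'a \<Rightarrow> real"
  assumes "finite Z"
  shows "(\<Sum>z\<in>Z. \<Sum>z'\<in>Z. (f z - f z')\<^sup>2) =
    2 * real (card Z) * (\<Sum>z\<in>Z. (f z - (\<Sum>y\<in>Z. f y) / real (card Z))\<^sup>2)"
proof (cases "Z = {}")
  case False
  define N s q where "N = real (card Z)" and "s = (\<Sum>y\<in>Z. f y)" and "q = (\<Sum>y\<in>Z. (f y)\<^sup>2)"
  have N: "N > 0" using False assms by (simp add: N_def card_gt_0_iff)
  have "(\<Sum>z\<in>Z. \<Sum>z'\<in>Z. (f z - f z')\<^sup>2) = (\<Sum>z\<in>Z. N * (f z)\<^sup>2 + q - 2 * f z * s)"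
    by (simp add: power2_diff sum.distrib sum_subtractf N_def q_def s_def sum_distrib_left)
  also have "\<dots> = 2 * N * q - 2 * s\<^sup>2"
    by (simp add: sum.distrib sum_subtractf flip: N_def q_def s_def sum_distrib_left sum_distrib_right)
       (simp add: power2_eq_square)
  finally have 1: "(\<Sum>z\<in>Z. \<Sum>z'\<in>Z. (f z - f z')\<^sup>2) = 2 * N * q - 2 * s\<^sup>2" .
  have "(\<Sum>z\<in>Z. (f z - s / N)\<^sup>2) = (\<Sum>z\<in>Z. (f z)\<^sup>2 + (s / N)\<^sup>2 - 2 * f z * (s / N))"
    by (simp only: power2_diff)
  also have "\<dots> = q + N * (s / N)\<^sup>2 - 2 * s * (s / N)"
    by (simp only: sum.distrib sum_subtractf sum_constant flip: N_def q_def s_def sum_distrib_left sum_distrib_right)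
  also have "\<dots> = q - s\<^sup>2 / N" using N by (simp add: field_simps power2_eq_square)
  finally show ?thesis using N 1 unfolding N_def[symmetric] s_def[symmetric]
    by (simp add: field_simps)
qed simp

text \<open>By \<open>count\<close>, for fixed z all the sets of g with h g z = z' have the same
  size card G / card Z, so a uniformly chosen g sends z to a uniform point of \<open>Z\<close>. The
  sum over pairs is therefore \<open>card Z\<close> times the average over \<open>G\<close> of the
  squared displacements.\<close>

lemma sum_sum_diff_square_transitive_le:
  fixes f :: "'a \<Rightarrow> real"
  assumes Z: "finite Z" and G: "finite G" "G \<noteq> {}"
    and closed: "\<And>g z. g \<in> G \<Longrightarrow> z \<in> Z \<Longrightarrow> h g z \<in> Z"
    and count: "\<And>z z' z''. z \<in> Z \<Longrightarrow> z' \<in> Z \<Longrightarrow> z'' \<in> Z \<Longrightarrow>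
      card {g \<in> G. h g z = z'} = card {g \<in> G. h g z = z''}"
    and bound: "\<And>g. g \<in> G \<Longrightarrow> (\<Sum>z\<in>Z. (f (h g z) - f z)\<^sup>2) \<le> B"
  shows "(\<Sum>z\<in>Z. \<Sum>z'\<in>Z. (f z - f z')\<^sup>2) \<le> real (card Z) * B"
proof (cases "Z = {}")
  case False
  have cg: "card {g \<in> G. h g z = z'} * card Z = card G" if "z \<in> Z" "z' \<in> Z" for z z'
  proof -
    have "card G = (\<Sum>y\<in>Z. card {g \<in> G. h g z = y})"
      using sum.group[OF G(1) Z, of "\<lambda>g. h g z" "\<lambda>_. 1::nat"] closed that by force
    also have "\<dots> = (\<Sum>y\<in>Z. card {g \<in> G. h g z = z'})"
      by (rule sum.cong[OF refl]) (use count that in blast)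
    finally show ?thesis by simp
  qed
  have cZ: "real (card Z) > 0" and cG: "real (card G) > 0"
    using False Z G by (simp_all add: card_gt_0_iff)
  have "(\<Sum>g\<in>G. \<Sum>z\<in>Z. (f (h g z) - f z)\<^sup>2) = (\<Sum>z\<in>Z. \<Sum>g\<in>G. (f (h g z) - f z)\<^sup>2)"
    by (rule sum.swap)
  also have "\<dots> = (\<Sum>z\<in>Z. \<Sum>z'\<in>Z. \<Sum>g | g \<in> G \<and> h g z = z'. (f (h g z) - f z)\<^sup>2)"
    by (intro sum.cong[OF refl] sum.group[symmetric]) (use Z G closed in auto)
  also have "\<dots> = (\<Sum>z\<in>Z. \<Sum>z'\<in>Z. (real (card G) / real (card Z)) * (f z - f z')\<^sup>2)"
  proof (intro sum.cong[OF refl])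
    fix z z' assume zz: "z \<in> Z" "z' \<in> Z"
    have "(\<Sum>g | g \<in> G \<and> h g z = z'. (f (h g z) - f z)\<^sup>2) = real (card {g \<in> G. h g z = z'}) * (f z' - f z)\<^sup>2"
      by simp
    moreover have "real (card {g \<in> G. h g z = z'}) = real (card G) / real (card Z)"
      using cg[OF zz] cZ by (simp add: field_simps flip: of_nat_mult)
    ultimately show "(\<Sum>g | g \<in> G \<and> h g z = z'. (f (h g z) - f z)\<^sup>2) = (real (card G) / real (card Z)) * (f z - f z')\<^sup>2"
      by (simp add: power2_commute)
  qed
  also have "\<dots> = (real (card G) / real (card Z)) * (\<Sum>z\<in>Z. \<Sum>z'\<in>Z. (f z - f z')\<^sup>2)"
    by (simp add: sum_distrib_left)
  finally have "(real (card G) / real (card Z)) * (\<Sum>z\<in>Z. \<Sum>z'\<in>Z. (f z - f z')\<^sup>2) \<le> real (card G) * B"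
    using sum_bounded_above[of G "\<lambda>g. \<Sum>z\<in>Z. (f (h g z) - f z)\<^sup>2" B] bound by simp
  then show ?thesis using cZ cG by (simp add: field_simps)
qed simp

section \<open>The cube, and long-range exchanges as products of nearest-neighbour ones\<close>

lemma finite_box: "finite {x :: int^'d. \<forall>i. x $ i \<in> S}" and card_box: "card {x :: int^'d. \<forall>i. x $ i \<in> S} = card S ^ CARD('d)"
  if "finite S" for S
proof -
  have e: "{x :: int^'d. \<forall>i. x $ i \<in> S} = vec_lambda ` (UNIV \<rightarrow>\<^sub>E S)"
  proof (intro equalityI subsetI)
    fix x :: "int^'d" assume "x \<in> {x. \<forall>i. x $ i \<in> S}"
    then have "vec_nth x \<in> (UNIV \<rightarrow>\<^sub>E S)" by auto
    then show "x \<in> vec_lambda ` (UNIV \<rightarrow>\<^sub>E S)" by (metis image_eqI vec_nth_inverse)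
  qed auto
  show "finite {x :: int^'d. \<forall>i. x $ i \<in> S}" unfolding e using that by (intro finite_imageI finite_PiE) auto
  have "inj_on vec_lambda ((UNIV :: 'd set) \<rightarrow>\<^sub>E S)" by (auto simp: inj_on_def vec_lambda_inject)
  then show "card {x :: int^'d. \<forall>i. x $ i \<in> S} = card S ^ CARD('d)"
    unfolding e by (simp add: card_image card_PiE)
qed

lemma finite_Lam: "finite (Lam M :: (int^'d) set)" and card_Lam: "card (Lam M :: (int^'d) set) = (2 * M + 1) ^ CARD('d)"
proof -
  have e: "(Lam M :: (int^'d) set) = {x. \<forall>i. x $ i \<in> {- int M..int M}}" by (auto simp: Lam_def abs_le_iff; smt)
  show "finite (Lam M :: (int^'d) set)" unfolding e by (rule finite_box) simp
  show "card (Lam M :: (int^'d) set) = (2 * M + 1) ^ CARD('d)" unfolding e by (subst card_box) (auto simp: nat_add_distrib nat_mult_distrib)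
qed

text \<open>The values outside \<open>Lam M\<close> and \<open>V\<close> are pinned down, which
  keeps the set finite and allows equality of configurations to be checked pointwise. Every move has
  to respect these default values.\<close>

lemma configs_iff:
  "\<eta> \<in> configs V M \<longleftrightarrow> (\<forall>x\<in>Lam M. \<forall>v\<in>V. \<eta> x v = 0 \<or> \<eta> x v = 1) \<and>
    (\<forall>x\<in>Lam M. \<forall>v. v \<notin> V \<longrightarrow> \<eta> x v = undefined) \<and> (\<forall>x. x \<notin> Lam M \<longrightarrow> \<eta> x = undefined)"
  unfolding configs_def PiE_def Pi_def extensional_def by blast

lemma finite_configs: "finite V \<Longrightarrow> finite (configs V M)"
  unfolding configs_def by (intro finite_PiE finite_Lam) auto

lemma exchange_apply:
  "exchange x y v \<eta> z u = (if u = v then if z = y then \<eta> x v else if z = x then \<eta> y v else \<eta> z v else \<eta> z u)"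
  by (simp add: exchange_def)

lemma exchange_exchange: "exchange x y v (exchange x y v \<eta>) = \<eta>"
  by (intro ext) (auto simp: exchange_apply)

lemma exchange_commute: "exchange x y v = exchange y x v"
  by (intro ext) (auto simp: exchange_apply)

lemma exchange_self: "exchange x x v = (\<lambda>\<eta>. \<eta>)"
  by (intro ext) (auto simp: exchange_apply)

text \<open>Conjugation of transpositions: the occupation at x is carried to z, swapped across z and
  y, and what comes back is carried to x.\<close>

lemma exchange_triple:
  "x \<noteq> y \<Longrightarrow> z \<noteq> y \<Longrightarrow> exchange x y v = exchange x z v \<circ> exchange z y v \<circ> exchange x z v"
  by (intro ext) (auto simp: exchange_apply)

lemma bij_betw_involution:
  assumes "\<And>z. z \<in> Z \<Longrightarrow> g z \<in> Z" "\<And>z. z \<in> Z \<Longrightarrow> g (g z) = z"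
  shows "bij_betw g Z Z"
  by (rule bij_betw_byWitness[where f' = g]) (use assms in auto)

definition bonds :: "nat \<Rightarrow> ((int^'d) \<times> (int^'d)) set" where
  "bonds M = {(x, y). x \<in> Lam M \<and> y \<in> Lam M \<and> lattice_norm (x - y) = 1}"

lemma finite_bonds: "finite (bonds M)"
  by (rule finite_subset[of _ "Lam M \<times> Lam M"]) (auto simp: bonds_def finite_Lam)

text \<open>Rates are left out: exchanging equal occupations is the identity, so only effective
  exchanges contribute. The sum also makes sense for a \<open>Z\<close> that some exchanges leave,
  as happens with the restricted sets in \<open>class_edge\<close>.\<close>

definition bond_energy :: "('d config \<Rightarrow> real) \<Rightarrow> (real^'d) set \<Rightarrow> nat \<Rightarrow> 'd config set \<Rightarrow> real" where
  "bond_energy f V M Z = (\<Sum>v\<in>V. \<Sum>(x, y)\<in>bonds M. \<Sum>\<eta>\<in>Z. (f (exchange x y v \<eta>) - f \<eta>)\<^sup>2)"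

lemma bond_energy_nonneg: "0 \<le> bond_energy f V M Z"
  unfolding bond_energy_def by (intro sum_nonneg) (auto intro: sum_nonneg)

lemma displacement_bond_le:
  assumes "finite V" "v \<in> V" "(x, y) \<in> bonds M"
  shows "displacement f (exchange x y v) Z \<le> sqrt (bond_energy f V M Z)"
proof (rule real_le_rsqrt)
  have "(displacement f (exchange x y v) Z)\<^sup>2 \<le> (\<Sum>(x, y)\<in>bonds M. \<Sum>\<eta>\<in>Z. (f (exchange x y v \<eta>) - f \<eta>)\<^sup>2)"
  proof -
    let ?h = "\<lambda>(x, y). \<Sum>\<eta>\<in>Z. (f (exchange x y v \<eta>) - f \<eta>)\<^sup>2"
    have "?h (x, y) \<le> sum ?h (bonds M)"
      by (rule member_le_sum[OF assms(3)]) (auto simp: finite_bonds intro: sum_nonneg)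
    then show ?thesis by (simp add: displacement_power2)
  qed
  also have "\<dots> \<le> bond_energy f V M Z"
    unfolding bond_energy_def
    by (rule member_le_sum[OF assms(2)]) (auto simp: assms(1) intro!: sum_nonneg)
  finally show "(displacement f (exchange x y v) Z)\<^sup>2 \<le> bond_energy f V M Z" .
qed

definition l1_dist :: "int^'d \<Rightarrow> int^'d \<Rightarrow> nat" where
  "l1_dist x y = (\<Sum>i\<in>UNIV. nat \<bar>x $ i - y $ i\<bar>)"

lemma l1_dist_le:
  assumes "x \<in> Lam M" "y \<in> Lam M"
  shows "l1_dist (x :: int^'d) y \<le> 2 * M * CARD('d)"
proof -
  have "l1_dist x y \<le> (\<Sum>i\<in>(UNIV :: 'd set). 2 * M)"
    unfolding l1_dist_def
  proof (rule sum_mono)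
    fix i :: 'd
    have "\<bar>x $ i\<bar> \<le> int M" "\<bar>y $ i\<bar> \<le> int M" using assms by (auto simp: Lam_def)
    then show "nat \<bar>x $ i - y $ i\<bar> \<le> 2 * M" by linarith
  qed
  then show ?thesis by (simp add: mult.commute)
qed

lemma l1_dist_eq_0_iff: "l1_dist x y = 0 \<longleftrightarrow> x = y"
  by (auto simp: l1_dist_def vec_eq_iff)

lemma lattice_norm_axis:
  fixes x y :: "int^'d"
  assumes "\<And>j. j \<noteq> i \<Longrightarrow> x $ j = y $ j" "\<bar>x $ i - y $ i\<bar> = 1"
  shows "lattice_norm (x - y) = 1"
proof -
  have "((\<chi> j. real_of_int ((x - y) $ j)) :: real^'d) = axis i (real_of_int (x $ i - y $ i))"
    using assms(1) by (auto simp: vec_eq_iff axis_def)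
  then have "lattice_norm (x - y) = \<bar>real_of_int (x $ i - y $ i)\<bar>"
    by (simp add: lattice_norm_def norm_eq_sqrt_inner inner_axis_axis)
  also have "\<dots> = 1" by (simp only: assms(2) of_int_1 flip: of_int_abs)
  finally show ?thesis .
qed

lemma lattice_step:
  fixes x y :: "int^'d"
  assumes "x \<in> Lam M" "y \<in> Lam M" "l1_dist x y = Suc k"
  obtains z where "(x, z) \<in> bonds M" "l1_dist z y = k"
proof -
  have "x \<noteq> y" using assms(3) l1_dist_eq_0_iff[of x y] by auto
  then obtain i where i: "x $ i \<noteq> y $ i" by (auto simp: vec_eq_iff)
  \<comment> \<open>One coordinate moves by one towards y. It stays between the coordinates of x and
    y, hence in the cube.\<close>
  define z where "z = (\<chi> j. if j = i then x $ i + sgn (y $ i - x $ i) else x $ j)"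
  have z: "z $ j = x $ j" if "j \<noteq> i" for j using that by (simp add: z_def)
  have zi: "nat \<bar>x $ i - y $ i\<bar> = Suc (nat \<bar>z $ i - y $ i\<bar>)" using i by (simp add: z_def sgn_if) linarith
  have "\<bar>z $ j\<bar> \<le> int M" for j
  proof -
    have "\<bar>x $ j\<bar> \<le> int M" "\<bar>y $ j\<bar> \<le> int M" using assms by (auto simp: Lam_def)
    then show ?thesis by (cases "j = i") (use i in \<open>auto simp: z_def sgn_if\<close>)
  qed
  then have "z \<in> Lam M" by (simp add: Lam_def)
  moreover have "lattice_norm (x - z) = 1"
    by (rule lattice_norm_axis[of i]) (use z i in \<open>auto simp: z_def sgn_if\<close>)
  ultimately have b: "(x, z) \<in> bonds M" using assms by (simp add: bonds_def)
  have "Suc k = l1_dist x y" using assms by simp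
  also have "\<dots> = nat \<bar>x $ i - y $ i\<bar> + (\<Sum>j\<in>UNIV - {i}. nat \<bar>x $ j - y $ j\<bar>)"
    unfolding l1_dist_def by (rule sum.remove) auto
  also have "(\<Sum>j\<in>UNIV - {i}. nat \<bar>x $ j - y $ j\<bar>) = (\<Sum>j\<in>UNIV - {i}. nat \<bar>z $ j - y $ j\<bar>)"
    by (rule sum.cong) (auto simp: z)
  also have "nat \<bar>x $ i - y $ i\<bar> + \<dots> = Suc (nat \<bar>z $ i - y $ i\<bar> + \<dots>)" by (simp add: zi)
  also have "nat \<bar>z $ i - y $ i\<bar> + (\<Sum>j\<in>UNIV - {i}. nat \<bar>z $ j - y $ j\<bar>) = l1_dist z y"
    unfolding l1_dist_def by (rule sum.remove[symmetric]) auto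
  finally show ?thesis using b that by auto
qed

text \<open>By \<open>exchange_triple\<close> each step towards y is made and later undone, so
  distance k > 0 takes 2k - 1 bond exchanges; 2k is a bound that is also right for k = 0. The last
  step is treated apart because the conjugation requires z different from y.\<close>

lemma displacement_exchange_le_dist:
  assumes V: "finite V" "v \<in> V" and y: "y \<in> Lam M"
    and closed: "\<And>x z \<eta>. x \<in> Lam M \<Longrightarrow> z \<in> Lam M \<Longrightarrow> \<eta> \<in> Z \<Longrightarrow> exchange x z v \<eta> \<in> Z"
  shows "x \<in> Lam M \<Longrightarrow> displacement f (exchange x y v) Z \<le> 2 * real (l1_dist x y) * sqrt (bond_energy f V M Z)"
proof (induction "l1_dist x y" arbitrary: x)
  case 0
  then have "x = y" using l1_dist_eq_0_iff by metis
  then show ?case by (simp add: exchange_self displacement_id bond_energy_nonneg)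
next
  case (Suc k)
  let ?E = "sqrt (bond_energy f V M Z)"
  obtain z where z: "(x, z) \<in> bonds M" "l1_dist z y = k"
    using lattice_step[OF Suc.prems y] Suc.hyps(2) by metis
  then have zL: "z \<in> Lam M" by (auto simp: bonds_def)
  have E: "0 \<le> ?E" by (simp add: bond_energy_nonneg)
  have xz: "displacement f (exchange x z v) Z \<le> ?E" by (rule displacement_bond_le[OF V z(1)])
  show ?case
  proof (cases "z = y")
    case True
    have "?E \<le> 2 * real (l1_dist x y) * ?E"
      using mult_right_mono[OF _ E, of 1 "2 * real (l1_dist x y)"] Suc.hyps(2) by simp
    with True xz show ?thesis by simp
  next
    case False
    have "x \<noteq> y" using Suc.hyps(2) l1_dist_eq_0_iff[of x y] by auto
    then have "exchange x y v = exchange x z v \<circ> (exchange z y v \<circ> exchange x z v)"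
      using exchange_triple[of x y z v] False by (simp add: o_assoc)
    have bij: "bij_betw (exchange x' z' v) Z Z" if "x' \<in> Lam M" "z' \<in> Lam M" for x' z'
      by (rule bij_betw_involution) (use that closed exchange_exchange in auto)
    have "displacement f (exchange x y v) Z = displacement f (exchange x z v \<circ> (exchange z y v \<circ> exchange x z v)) Z"
      by (simp only: \<open>exchange x y v = _\<close>)
    also have "\<dots> \<le> displacement f (exchange x z v) Z + displacement f (exchange z y v \<circ> exchange x z v) Z"
      by (intro displacement_comp_le bij_betw_trans[OF bij bij] Suc.prems zL y)
    also have "\<dots> \<le> ?E + (displacement f (exchange z y v) Z + displacement f (exchange x z v) Z)"
      by (intro add_mono xz displacement_comp_le bij Suc.prems zL)
    also have "\<dots> \<le> ?E + (2 * real (l1_dist z y) * ?E + ?E)"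
      using Suc.hyps(1)[of z] z(2) zL xz by simp
    also have "\<dots> = 2 * real (l1_dist x y) * ?E"
      using z(2) Suc.hyps(2)[symmetric] by (simp add: algebra_simps)
    finally show ?thesis .
  qed
qed

text \<open>Each of the d coordinates differs by at most 2M, and each unit of distance costs
  2.\<close>

lemma displacement_exchange_le:
  fixes Z :: "('d::finite) config set"
  assumes "finite V" "v \<in> V" "x \<in> Lam M" "y \<in> Lam M"
    and "\<And>x z \<eta>. x \<in> Lam M \<Longrightarrow> z \<in> Lam M \<Longrightarrow> \<eta> \<in> Z \<Longrightarrow> exchange x z v \<eta> \<in> Z"
  shows "displacement f (exchange x y v) Z \<le> 4 * real M * real CARD('d) * sqrt (bond_energy f V M Z)"
proof -
  have "displacement f (exchange x y v) Z \<le> 2 * real (l1_dist x y) * sqrt (bond_energy f V M Z)"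
    by (rule displacement_exchange_le_dist) (use assms in auto)
  also have "\<dots> \<le> 2 * real (2 * M * CARD('d)) * sqrt (bond_energy f V M Z)"
    by (intro mult_right_mono mult_left_mono of_nat_mono l1_dist_le assms) (auto simp: bond_energy_nonneg)
  finally show ?thesis by simp
qed

subsection \<open>Variance within an occupation class\<close>

text \<open>A permutation of site-velocity pairs that keeps the velocity encodes one permutation of
  the sites for every velocity, so a single \<open>permutes\<close> covers the product group.
  Reading the configuration at the image site makes this a right action.\<close>

definition permute_config :: "((int^'d) \<times> (real^'d) \<Rightarrow> (int^'d) \<times> (real^'d)) \<Rightarrow> 'd config \<Rightarrow> 'd config" where
  "permute_config p \<eta> = (\<lambda>x v. \<eta> (fst (p (x, v))) v)"

lemma permute_config_comp:
  "(\<And>z. snd (q z) = snd z) \<Longrightarrow> permute_config (p \<circ> q) \<eta> = permute_config q (permute_config p \<eta>)"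
  unfolding permute_config_def by (intro ext) (metis comp_apply prod.collapse snd_conv)

lemma permute_config_transpose: "permute_config (Transposition.transpose (x, v) (y, v)) = exchange x y v"
  by (intro ext) (auto simp: permute_config_def exchange_apply Transposition.transpose_def)

definition occupation :: "nat \<Rightarrow> real^'d \<Rightarrow> 'd config \<Rightarrow> nat" where
  "occupation M v \<eta> = card {x \<in> Lam M. \<eta> x v = 1}"

definition occupation_class :: "(real^'d) set \<Rightarrow> nat \<Rightarrow> (real^'d \<Rightarrow> nat) \<Rightarrow> 'd config set" where
  "occupation_class V M N = {\<eta> \<in> configs V M. \<forall>v\<in>V. occupation M v \<eta> = N v}"

lemma finite_occupation_class: "finite V \<Longrightarrow> finite (occupation_class V M N)"
  by (simp add: occupation_class_def finite_configs)

lemma permute_config_mem_class: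
  fixes V :: "(real^'d) set"
  assumes p: "p permutes Lam M \<times> V" "\<And>z. snd (p z) = snd z" and \<eta>: "\<eta> \<in> occupation_class V M N"
  shows "permute_config p \<eta> \<in> occupation_class V M N"
proof -
  have out: "fst (p (x, v)) = x" if "x \<notin> Lam M \<or> v \<notin> V" for x v
    using permutes_not_in[OF p(1), of "(x, v)"] that by auto
  have inn: "fst (p (x, v)) \<in> Lam M" if "x \<in> Lam M" "v \<in> V" for x v
    using permutes_in_image[OF p(1), of "(x, v)"] that by (metis mem_Times_iff fst_conv snd_conv)
  have c: "\<eta> \<in> configs V M" using \<eta> by (simp add: occupation_class_def)
  have "permute_config p \<eta> \<in> configs V M"
    unfolding configs_iff permute_config_def
  proof (intro conjI ballI allI impI)
    fix x :: "int^'d" and v assume "x \<in> Lam M" "v \<in> V"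
    then show "\<eta> (fst (p (x, v))) v = 0 \<or> \<eta> (fst (p (x, v))) v = 1"
      using inn c by (simp add: configs_iff)
  next
    fix x :: "int^'d" and v assume "x \<in> Lam M" "v \<notin> V"
    then show "\<eta> (fst (p (x, v))) v = undefined" using out c by (simp add: configs_iff)
  next
    fix x :: "int^'d" assume "x \<notin> Lam M"
    then show "(\<lambda>v. \<eta> (fst (p (x, v))) v) = undefined" using out c by (simp add: configs_iff)
  qed
  moreover have "occupation M v (permute_config p \<eta>) = occupation M v \<eta>" if v: "v \<in> V" for v
  proof -
    let ?g = "\<lambda>x. fst (p (x, v))"
    have inj: "inj ?g"
    proof (rule injI)
      fix x y assume "?g x = ?g y"
      then have "p (x, v) = p (y, v)" using p(2) by (metis prod.expand snd_conv)
      then show "x = y" using permutes_inj[OF p(1)] by (auto dest: injD)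
    qed
    have sub: "?g ` Lam M \<subseteq> Lam M" using inn v by auto
    have img: "?g ` Lam M = Lam M"
      by (rule endo_inj_surj[OF finite_Lam sub]) (rule inj_on_subset[OF inj], simp)
    have "bij_betw ?g {x \<in> Lam M. \<eta> (?g x) v = 1} {x \<in> Lam M. \<eta> x v = 1}"
      unfolding bij_betw_def
    proof (intro conjI equalityI subsetI)
      fix y assume y: "y \<in> {x \<in> Lam M. \<eta> x v = 1}"
      then obtain x where "x \<in> Lam M" "y = ?g x" using img by (metis (no_types, lifting) imageE mem_Collect_eq)
      with y show "y \<in> ?g ` {x \<in> Lam M. \<eta> (?g x) v = 1}" by blast
    qed (use inn v in \<open>auto intro: inj_on_subset[OF inj]\<close>)
    from bij_betw_same_card[OF this] show ?thesis unfolding occupation_def permute_config_def .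
  qed
  ultimately show ?thesis using \<eta> by (simp add: occupation_class_def)
qed

lemma exchange_mem_class:
  assumes "x \<in> Lam M" "y \<in> Lam M" "v \<in> V" "\<eta> \<in> occupation_class V M N"
  shows "exchange x y v \<eta> \<in> occupation_class V M N"
  unfolding permute_config_transpose[symmetric]
  by (rule permute_config_mem_class[OF _ _ assms(4)])
     (use assms in \<open>auto simp: Transposition.transpose_def intro!: permutes_swap_id\<close>)

text \<open>A permutation of \<open>S\<close> is a product of at most \<open>card S\<close>
  transpositions, obtained by fixing one point after another. As velocities are kept, every
  transposition is an exchange of two sites for one velocity.\<close>

lemma displacement_permute_le:
  fixes S :: "((int^'d::finite) \<times> (real^'d)) set"
  assumes V: "finite V"
    and closed: "\<And>x z v \<eta>. v \<in> V \<Longrightarrow> x \<in> Lam M \<Longrightarrow> z \<in> Lam M \<Longrightarrow> \<eta> \<in> Z \<Longrightarrow> exchange x z v \<eta> \<in> Z"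
    and "finite S" "S \<subseteq> Lam M \<times> V" "p permutes S" "\<And>z. snd (p z) = snd z"
  shows "displacement f (permute_config p) Z \<le> real (card S) * (4 * real M * real CARD('d) * sqrt (bond_energy f V M Z))"
  using assms(3-)
proof (induction S arbitrary: p rule: finite_induct)
  case empty
  then have "permute_config p = (\<lambda>\<eta>. \<eta>)" by (auto simp: permute_config_def)
  then show ?case by (simp add: displacement_id)
next
  case (insert a S)
  let ?B = "4 * real M * real CARD('d) * sqrt (bond_energy f V M Z)"
  obtain x v where a: "a = (x, v)" by force
  obtain y where pa: "p a = (y, v)" using insert.prems(3)[of a] a by (cases "p a") auto
  have xv: "x \<in> Lam M" "v \<in> V" using insert.prems(1) a by auto
  have "p a \<in> insert a S" using permutes_in_image[OF insert.prems(2), of a] by simp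
  then have y: "y \<in> Lam M" using insert.prems(1) pa by auto
  let ?t = "Transposition.transpose (x, v) (y, v)"
  \<comment> \<open>The transposition returns \<open>p a\<close> to \<open>a\<close>, so
    \<open>q\<close> fixes \<open>a\<close> and permutes only the remaining points.\<close>
  define q where "q = ?t \<circ> p"
  have q: "q permutes S" using permutes_insert_lemma[OF insert.prems(2)] a pa by (simp add: q_def)
  have tsnd: "snd (?t z) = snd z" for z by (simp add: Transposition.transpose_def)
  have qsnd: "snd (q z) = snd z" for z unfolding q_def by (simp add: tsnd insert.prems(3))
  have p: "p = ?t \<circ> q" by (simp add: q_def o_assoc)
  have "permute_config p = permute_config q \<circ> exchange x y v"
    by (rule ext) (simp add: p permute_config_comp qsnd permute_config_transpose)
  moreover have "bij_betw (exchange x y v) Z Z"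
    by (rule bij_betw_involution) (use closed xv y exchange_exchange in auto)
  ultimately have "displacement f (permute_config p) Z \<le>
      displacement f (permute_config q) Z + displacement f (exchange x y v) Z"
    using displacement_comp_le by metis
  also have "\<dots> \<le> real (card S) * ?B + ?B"
    by (intro add_mono insert.IH q qsnd displacement_exchange_le V xv y closed) (use insert.prems in auto)
  also have "\<dots> = real (card (insert a S)) * ?B"
    using insert.hyps by (simp add: algebra_simps)
  finally show ?case .
qed

text \<open>\<open>S\<close> and \<open>S'\<close> have equal size, hence so do their complements in
  \<open>L\<close>; two bijections are glued.\<close>

lemma permutes_extending_bij:
  assumes "finite L" "S \<subseteq> L" "S' \<subseteq> L" "card S = card S'"
  obtains p where "p permutes L" "\<And>x. x \<in> L \<Longrightarrow> p x \<in> S \<longleftrightarrow> x \<in> S'"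
proof -
  have fin: "finite S" "finite S'" using assms finite_subset by auto
  obtain g where g: "bij_betw g S' S" using finite_same_card_bij[OF fin(2,1)] assms(4) by metis
  have "card (L - S') = card (L - S)" using assms fin by (simp add: card_Diff_subset)
  then obtain h where h: "bij_betw h (L - S') (L - S)"
    using finite_same_card_bij[of "L - S'" "L - S"] assms(1) by blast
  define p where "p = (\<lambda>x. if x \<in> S' then g x else if x \<in> L then h x else x)"
  have "bij_betw p S' S" using g by (rule bij_betw_cong[THEN iffD1, rotated]) (simp add: p_def)
  moreover have "bij_betw p (L - S') (L - S)" using h by (rule bij_betw_cong[THEN iffD1, rotated]) (simp add: p_def)
  ultimately have "bij_betw p (S' \<union> (L - S')) (S \<union> (L - S))" by (rule bij_betw_combine) auto
  moreover have "S' \<union> (L - S') = L" "S \<union> (L - S) = L" using assms by auto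
  ultimately have "p permutes L" by (intro bij_imp_permutes) (use assms in \<open>auto simp: p_def\<close>)
  moreover have "p x \<in> S \<longleftrightarrow> x \<in> S'" if "x \<in> L" for x
    using that g h by (auto simp: p_def bij_betw_def)
  ultimately show ?thesis using that by blast
qed

lemma permute_config_transitive:
  assumes \<eta>: "\<eta> \<in> occupation_class V M N" and \<eta>': "\<eta>' \<in> occupation_class V M N"
  obtains p where "p permutes Lam M \<times> V" "\<And>z. snd (p z) = snd z" "permute_config p \<eta> = \<eta>'"
proof -
  let ?S = "\<lambda>\<eta> v. {x \<in> Lam M. \<eta> x v = 1}"
  have "\<exists>p. p permutes Lam M \<and> (\<forall>x\<in>Lam M. p x \<in> ?S \<eta> v \<longleftrightarrow> x \<in> ?S \<eta>' v)" if "v \<in> V" for v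
  proof -
    have "card (?S \<eta> v) = card (?S \<eta>' v)"
      using \<eta> \<eta>' that by (simp add: occupation_class_def occupation_def)
    then obtain p where "p permutes Lam M" "\<And>x. x \<in> Lam M \<Longrightarrow> p x \<in> ?S \<eta> v \<longleftrightarrow> x \<in> ?S \<eta>' v"
      by (rule permutes_extending_bij[OF finite_Lam, rotated 2]) auto
    then show ?thesis by blast
  qed
  then obtain P where P: "\<And>v. v \<in> V \<Longrightarrow> P v permutes Lam M"
    "\<And>v x. v \<in> V \<Longrightarrow> x \<in> Lam M \<Longrightarrow> P v x \<in> ?S \<eta> v \<longleftrightarrow> x \<in> ?S \<eta>' v"
    using bchoice[of V "\<lambda>v p. p permutes Lam M \<and> (\<forall>x\<in>Lam M. p x \<in> ?S \<eta> v \<longleftrightarrow> x \<in> ?S \<eta>' v)"] by blast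
  define p where "p = (\<lambda>(x, v). if v \<in> V then (P v x, v) else (x, v))"
  have psnd: "snd (p z) = snd z" for z by (auto simp: p_def split: prod.splits)
  have "bij_betw p (Lam M \<times> V) (Lam M \<times> V)"
    by (rule bij_betw_byWitness[where f' = "\<lambda>(x, v). if v \<in> V then (inv (P v) x, v) else (x, v)"])
       (auto simp: p_def permutes_inverses[OF P(1)] permutes_in_image[OF P(1)] permutes_in_image[OF permutes_inv[OF P(1)]])
  then have "p permutes Lam M \<times> V"
  proof (rule bij_imp_permutes)
    show "p z = z" if "z \<notin> Lam M \<times> V" for z
      using that permutes_not_in[OF P(1), of "snd z" "fst z"] by (cases z) (auto simp: p_def)
  qed
  moreover have "permute_config p \<eta> = \<eta>'"
  proof (intro ext)
    fix x v
    have cc: "\<eta> \<in> configs V M" "\<eta>' \<in> configs V M" using \<eta> \<eta>' by (auto simp: occupation_class_def)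
    show "permute_config p \<eta> x v = \<eta>' x v"
    proof (cases "x \<in> Lam M \<and> v \<in> V")
      case True
      then have "P v x \<in> Lam M" using permutes_in_image[OF P(1)] by auto
      with True P(2)[of v x] cc show ?thesis
        by (simp add: permute_config_def p_def configs_iff) metis
    next
      case False
      then show ?thesis using cc permutes_not_in[OF P(1), of v x]
        by (cases "v \<in> V"; cases "x \<in> Lam M") (auto simp: permute_config_def p_def configs_iff)
    qed
  qed
  ultimately show ?thesis using that psnd by blast
qed

lemma occupation_class_variance:
  fixes V :: "(real^'d) set" and M :: nat and N :: "real^'d \<Rightarrow> nat"
  assumes V: "finite V"
  defines "Z \<equiv> occupation_class V M N"
  shows "(\<Sum>\<eta>\<in>Z. \<Sum>\<eta>'\<in>Z. (f \<eta> - f \<eta>')\<^sup>2) \<le>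
    real (card Z) * ((real (card (Lam M :: (int^'d) set) * card V) * (4 * real M * real CARD('d)))\<^sup>2 * bond_energy f V M Z)"
proof -
  let ?S = "(Lam M :: (int^'d) set) \<times> V"
  define G where "G = {p. p permutes ?S \<and> (\<forall>z. snd (p z) = snd z)}"
  have fS: "finite ?S" using V finite_Lam by auto
  have G1: "finite G" by (rule finite_subset[OF _ finite_permutations[OF fS]]) (auto simp: G_def)
  have idG: "id \<in> G" by (simp add: G_def permutes_id)
  have comp: "p \<circ> q \<in> G" if "p \<in> G" "q \<in> G" for p q
    using that permutes_compose[of q ?S p] by (simp add: G_def del: split_paired_All)
  \<comment> \<open>Right composition with a \<open>q\<close> that carries the first target to the
    second embeds one fibre into the other. Exchanging the targets gives equality.\<close>
  have count: "card {p \<in> G. permute_config p \<eta> = \<eta>'} \<le> card {p \<in> G. permute_config p \<eta> = \<eta>''}"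
    if "\<eta>' \<in> Z" "\<eta>'' \<in> Z" for \<eta> \<eta>' \<eta>''
  proof (rule permute_config_transitive)
    show "\<eta>' \<in> occupation_class V M N" "\<eta>'' \<in> occupation_class V M N" using that by (simp_all add: Z_def)
    fix q assume q: "q permutes ?S" "\<And>z. snd (q z) = snd z" "permute_config q \<eta>' = \<eta>''"
    have qG: "q \<in> G" unfolding G_def mem_Collect_eq using q(1,2) by blast
    show "card {p \<in> G. permute_config p \<eta> = \<eta>'} \<le> card {p \<in> G. permute_config p \<eta> = \<eta>''}"
    proof (rule card_inj_on_le[where f = "\<lambda>p. p \<circ> q"])
      show "inj_on (\<lambda>p. p \<circ> q) {p \<in> G. permute_config p \<eta> = \<eta>'}"
      proof (rule inj_onI)
        fix p p' assume "p \<circ> q = p' \<circ> q"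
        then have "p \<circ> (q \<circ> inv q) = p' \<circ> (q \<circ> inv q)" by (metis o_assoc)
        then show "p = p'" by (simp add: permutes_inv_o[OF q(1)])
      qed
      show "(\<lambda>p. p \<circ> q) ` {p \<in> G. permute_config p \<eta> = \<eta>'} \<subseteq> {p \<in> G. permute_config p \<eta> = \<eta>''}"
      proof (rule image_subsetI)
        fix p assume "p \<in> {p \<in> G. permute_config p \<eta> = \<eta>'}"
        then have p: "p \<in> G" "permute_config p \<eta> = \<eta>'" by auto
        have "permute_config (p \<circ> q) \<eta> = \<eta>''"
          unfolding permute_config_comp[OF q(2)] p(2) by (rule q(3))
        then show "p \<circ> q \<in> {p \<in> G. permute_config p \<eta> = \<eta>''}"
          using comp[OF p(1) qG] by blast
      qed
      show "finite {p \<in> G. permute_config p \<eta> = \<eta>''}" using G1 by simp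
    qed
  qed
  show ?thesis
  proof (rule sum_sum_diff_square_transitive_le[where G = G and h = permute_config])
    show "finite Z" unfolding Z_def by (rule finite_occupation_class[OF V])
    show "finite G" by fact
    show "G \<noteq> {}" using idG by auto
    show "permute_config p \<eta> \<in> Z" if "p \<in> G" "\<eta> \<in> Z" for p \<eta>
      unfolding Z_def by (rule permute_config_mem_class) (use that in \<open>auto simp: G_def Z_def\<close>)
    show "card {p \<in> G. permute_config p \<eta> = \<eta>'} = card {p \<in> G. permute_config p \<eta> = \<eta>''}"
      if "\<eta> \<in> Z" "\<eta>' \<in> Z" "\<eta>'' \<in> Z" for \<eta> \<eta>' \<eta>''
      using that by (intro antisym count)
    fix p assume p: "p \<in> G"
    have "displacement f (permute_config p) Z \<le>
        real (card ?S) * (4 * real M * real CARD('d) * sqrt (bond_energy f V M Z))"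
    proof (rule displacement_permute_le[OF V _ fS subset_refl])
      show "exchange x z v \<eta> \<in> Z" if "v \<in> V" "x \<in> Lam M" "z \<in> Lam M" "\<eta> \<in> Z" for x z v \<eta>
        using that unfolding Z_def by (intro exchange_mem_class)
    qed (use p in \<open>simp_all add: G_def del: split_paired_All\<close>)
    then have "(displacement f (permute_config p) Z)\<^sup>2 \<le>
        (real (card ?S) * (4 * real M * real CARD('d) * sqrt (bond_energy f V M Z)))\<^sup>2"
      by (intro power_mono displacement_nonneg)
    then show "(\<Sum>\<eta>\<in>Z. (f (permute_config p \<eta>) - f \<eta>)\<^sup>2) \<le>
        (real (card (Lam M :: (int^'d) set) * card V) * (4 * real M * real CARD('d)))\<^sup>2 * bond_energy f V M Z"
      by (simp add: displacement_power2 power_mult_distrib bond_energy_nonneg card_cartesian_product)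
  qed
qed

subsection \<open>Collisions\<close>

lemma collide_apply:
  "collide x (v, w, v', w') \<eta> z u =
    (if z = x then if u = v' \<or> u = w' then 1 else if u = v \<or> u = w then 0 else \<eta> x u else \<eta> z u)"
  by (simp add: collide_def)

lemma coll_rate_cases:
  assumes "\<eta> \<in> configs V M" "x \<in> Lam M" "v \<in> V" "w \<in> V" "v' \<in> V" "w' \<in> V"
  shows "coll_rate x (v, w, v', w') \<eta> =
    (if \<eta> x v = 1 \<and> \<eta> x w = 1 \<and> \<eta> x v' = 0 \<and> \<eta> x w' = 0 then 1 else 0)"
  using assms by (auto simp: coll_rate_def configs_iff)

lemma collide_mem_configs:
  fixes \<eta> :: "('d::finite) config"
  assumes "\<eta> \<in> configs V M" "x \<in> Lam M" "v \<in> V" "w \<in> V" "v' \<in> V" "w' \<in> V"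
  shows "collide x (v, w, v', w') \<eta> \<in> configs V M"
  unfolding configs_iff
proof (intro conjI ballI allI impI)
  fix z :: "int^'d" assume "z \<notin> Lam M"
  then show "collide x (v, w, v', w') \<eta> z = undefined"
    using assms by (auto simp: collide_def configs_iff)
qed (use assms in \<open>auto simp: collide_apply configs_iff\<close>)

text \<open>Detailed balance: where its rate is 1, a collision is inverted by the reverse collision,
  which then also has rate 1. Allowing \<open>Z\<close> and \<open>Z'\<close> to differ covers both
  two neighbouring occupation classes and a single level set.\<close>

lemma sum_collision_reverse:
  fixes h :: "('d::finite) config \<Rightarrow> 'd config \<Rightarrow> real"
  assumes x: "x \<in> Lam M" and V: "v \<in> V" "w \<in> V" "v' \<in> V" "w' \<in> V"
    and fin: "finite Z" "finite Z'" and conf: "Z \<subseteq> configs V M" "Z' \<subseteq> configs V M"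
    and fwd: "\<And>\<eta>. \<eta> \<in> Z \<Longrightarrow> coll_rate x (v, w, v', w') \<eta> = 1 \<Longrightarrow> collide x (v, w, v', w') \<eta> \<in> Z'"
    and bwd: "\<And>\<eta>. \<eta> \<in> Z' \<Longrightarrow> coll_rate x (v', w', v, w) \<eta> = 1 \<Longrightarrow> collide x (v', w', v, w) \<eta> \<in> Z"
  shows "(\<Sum>\<eta>\<in>Z. coll_rate x (v, w, v', w') \<eta> * h \<eta> (collide x (v, w, v', w') \<eta>)) =
         (\<Sum>\<eta>\<in>Z'. coll_rate x (v', w', v, w) \<eta> * h (collide x (v', w', v, w) \<eta>) \<eta>)"
proof -
  have rate: "coll_rate x (a, b, a', b') \<eta> = (if \<eta> x a = 1 \<and> \<eta> x b = 1 \<and> \<eta> x a' = 0 \<and> \<eta> x b' = 0 then 1 else 0)"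
    if "\<eta> \<in> Z \<union> Z'" "a \<in> V" "b \<in> V" "a' \<in> V" "b' \<in> V" for a b a' b' \<eta>
    by (rule coll_rate_cases[of _ V M]) (use that x conf in auto)
  have inv: "collide x (a', b', a, b) (collide x (a, b, a', b') \<eta>) = \<eta>"
    "coll_rate x (a', b', a, b) (collide x (a, b, a', b') \<eta>) = 1"
    if "\<eta> x a = 1 \<and> \<eta> x b = 1 \<and> \<eta> x a' = 0 \<and> \<eta> x b' = 0" for a b a' b' and \<eta> :: "'d config"
  proof -
    show "collide x (a', b', a, b) (collide x (a, b, a', b') \<eta>) = \<eta>"
      using that by (intro ext) (auto simp: collide_apply)
    show "coll_rate x (a', b', a, b) (collide x (a, b, a', b') \<eta>) = 1"
      using that by (auto simp: coll_rate_def collide_apply)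
  qed
  have "(\<Sum>\<eta>\<in>Z. coll_rate x (v, w, v', w') \<eta> * h \<eta> (collide x (v, w, v', w') \<eta>)) =
      (\<Sum>\<eta>\<in>{\<eta>\<in>Z. coll_rate x (v, w, v', w') \<eta> = 1}. h \<eta> (collide x (v, w, v', w') \<eta>))"
    by (rule sum.mono_neutral_cong_right) (use fin rate V in auto)
  also have "\<dots> = (\<Sum>\<eta>\<in>{\<eta>\<in>Z'. coll_rate x (v', w', v, w) \<eta> = 1}. h (collide x (v', w', v, w) \<eta>) \<eta>)"
  proof (rule sum.reindex_bij_witness[where j = "collide x (v, w, v', w')" and i = "collide x (v', w', v, w)"])
    fix \<eta> assume \<eta>: "\<eta> \<in> {\<eta>\<in>Z. coll_rate x (v, w, v', w') \<eta> = 1}"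
    then have p: "\<eta> x v = 1 \<and> \<eta> x w = 1 \<and> \<eta> x v' = 0 \<and> \<eta> x w' = 0"
      using rate[of \<eta> v w v' w'] V by (auto split: if_splits)
    show i: "collide x (v', w', v, w) (collide x (v, w, v', w') \<eta>) = \<eta>" by (rule inv(1)[where a = v and b = w and a' = v' and b' = w' and \<eta> = \<eta>, OF p])
    show "collide x (v, w, v', w') \<eta> \<in> {\<eta>\<in>Z'. coll_rate x (v', w', v, w) \<eta> = 1}"
      using inv(2)[where a = v and b = w and a' = v' and b' = w' and \<eta> = \<eta>, OF p] fwd \<eta> by simp
    show "h (collide x (v', w', v, w) (collide x (v, w, v', w') \<eta>)) (collide x (v, w, v', w') \<eta>) =
        h \<eta> (collide x (v, w, v', w') \<eta>)" by (simp add: i)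
  next
    fix \<eta> assume \<eta>: "\<eta> \<in> {\<eta>\<in>Z'. coll_rate x (v', w', v, w) \<eta> = 1}"
    then have p: "\<eta> x v' = 1 \<and> \<eta> x w' = 1 \<and> \<eta> x v = 0 \<and> \<eta> x w = 0"
      using rate[of \<eta> v' w' v w] V by (auto split: if_splits)
    show "collide x (v, w, v', w') (collide x (v', w', v, w) \<eta>) = \<eta>" by (rule inv(1)[where a = v' and b = w' and a' = v and b' = w and \<eta> = \<eta>, OF p])
    show "collide x (v', w', v, w) \<eta> \<in> {\<eta>\<in>Z. coll_rate x (v, w, v', w') \<eta> = 1}"
      using inv(2)[where a = v' and b = w' and a' = v and b' = w and \<eta> = \<eta>, OF p] bwd \<eta> by simp
  qed
  also have "\<dots> = (\<Sum>\<eta>\<in>Z'. coll_rate x (v', w', v, w) \<eta> * h (collide x (v', w', v, w) \<eta>) \<eta>)"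
    by (rule sum.mono_neutral_cong_left) (use fin rate V in auto)
  finally show ?thesis .
qed

text \<open>Distinctness within each pair makes every affected count change by exactly one. The
  second claim shows that the natural subtraction in the first is not truncated.\<close>

lemma occupation_collide:
  fixes \<eta> :: "('d::finite) config"
  assumes x: "x \<in> Lam M" and dist: "v \<noteq> w" "v' \<noteq> w'"
    and p: "\<eta> x v = 1" "\<eta> x w = 1" "\<eta> x v' = 0" "\<eta> x w' = 0"
  shows "occupation M u (collide x (v, w, v', w') \<eta>) =
    (if u = v \<or> u = w then occupation M u \<eta> - 1
     else if u = v' \<or> u = w' then occupation M u \<eta> + 1 else occupation M u \<eta>)"
    and "u = v \<or> u = w \<Longrightarrow> 1 \<le> occupation M u \<eta>"
proof -
  let ?S = "{z \<in> Lam M. \<eta> z u = 1}"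
  have fin: "finite ?S" by (simp add: finite_Lam)
  have neq: "v \<noteq> v'" "v \<noteq> w'" "w \<noteq> v'" "w \<noteq> w'" using p by auto
  show "1 \<le> occupation M u \<eta>" if "u = v \<or> u = w"
  proof -
    have "x \<in> ?S" using that p x by auto
    then have "0 < card ?S" using fin card_gt_0_iff by blast
    then show ?thesis by (simp add: occupation_def)
  qed
  consider "u = v \<or> u = w" | "u = v' \<or> u = w'" | "u \<notin> {v, w, v', w'}" by auto
  then show "occupation M u (collide x (v, w, v', w') \<eta>) =
    (if u = v \<or> u = w then occupation M u \<eta> - 1
     else if u = v' \<or> u = w' then occupation M u \<eta> + 1 else occupation M u \<eta>)"
  proof cases
    case 1
    then have "{z \<in> Lam M. collide x (v, w, v', w') \<eta> z u = 1} = ?S - {x}" "x \<in> ?S"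
      using p x neq by (auto simp: collide_apply)
    then show ?thesis using 1 fin by (simp add: occupation_def)
  next
    case 2
    then have "{z \<in> Lam M. collide x (v, w, v', w') \<eta> z u = 1} = insert x ?S" "x \<notin> ?S"
      using p x neq by (auto simp: collide_apply)
    then show ?thesis using 2 fin neq by (auto simp: occupation_def)
  next
    case 3
    then have "{z \<in> Lam M. collide x (v, w, v', w') \<eta> z u = 1} = ?S"
      using p x neq by (auto simp: collide_apply)
    then show ?thesis using 3 by (simp add: occupation_def)
  qed
qed

lemma sum_occupation:
  fixes \<eta> :: "('d::finite) config"
  assumes "\<eta> \<in> occupation_class V M N" "v \<in> V"
  shows "(\<Sum>x\<in>Lam M. \<eta> x v) = real (N v)"
    and "(\<Sum>x\<in>Lam M. 1 - \<eta> x v) = real (card (Lam M :: (int^'d) set)) - real (N v)"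
    and "card {x \<in> Lam M. \<eta> x v = 1} = N v"
    and "real (card {x \<in> Lam M. \<eta> x v = 0}) = real (card (Lam M :: (int^'d) set)) - real (N v)"
proof -
  have c: "\<eta> \<in> configs V M" and n: "card {x \<in> Lam M. \<eta> x v = 1} = N v"
    using assms by (auto simp: occupation_class_def occupation_def)
  show "card {x \<in> Lam M. \<eta> x v = 1} = N v" by fact
  have "(\<Sum>x\<in>Lam M. \<eta> x v) = (\<Sum>x\<in>{x \<in> Lam M. \<eta> x v = 1}. 1)"
    by (rule sum.mono_neutral_cong_right) (use c assms(2) finite_Lam in \<open>auto simp: configs_iff\<close>)
  then show s: "(\<Sum>x\<in>Lam M. \<eta> x v) = real (N v)" using n by simp
  show s': "(\<Sum>x\<in>Lam M. 1 - \<eta> x v) = real (card (Lam M :: (int^'d) set)) - real (N v)"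
    by (simp add: sum_subtractf s)
  have "(\<Sum>x\<in>Lam M. 1 - \<eta> x v) = (\<Sum>x\<in>{x \<in> Lam M. \<eta> x v = 0}. 1)"
    by (rule sum.mono_neutral_cong_right) (use c assms(2) finite_Lam in \<open>auto simp: configs_iff\<close>)
  then show "real (card {x \<in> Lam M. \<eta> x v = 0}) = real (card (Lam M :: (int^'d) set)) - real (N v)"
    using s' by simp
qed

text \<open>Double counting: each configuration appears once for every x with P, that is m times. In
  \<open>class_edge\<close> this produces a number of occupied or empty sites in place of
  |Lambda|.\<close>

lemma sum_bond_energy_filter:
  assumes "finite X" "finite Z" "\<And>\<eta>. \<eta> \<in> Z \<Longrightarrow> real (card {x \<in> X. P x \<eta>}) = m"
  shows "(\<Sum>x\<in>X. bond_energy f V M {\<eta> \<in> Z. P x \<eta>}) = m * bond_energy f V M Z"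
proof -
  have a: "(\<Sum>x\<in>X. \<Sum>\<eta>\<in>{\<eta> \<in> Z. P x \<eta>}. h \<eta>) = m * (\<Sum>\<eta>\<in>Z. h \<eta>)" for h :: "_ \<Rightarrow> real"
  proof -
    have "(\<Sum>x\<in>X. \<Sum>\<eta>\<in>{\<eta> \<in> Z. P x \<eta>}. h \<eta>) = (\<Sum>\<eta>\<in>Z. \<Sum>x\<in>{x \<in> X. P x \<eta>}. h \<eta>)"
      by (rule sum.swap_restrict[OF assms(1,2)])
    also have "\<dots> = (\<Sum>\<eta>\<in>Z. m * h \<eta>)" by (rule sum.cong) (simp_all add: assms(3))
    finally show ?thesis by (simp add: sum_distrib_left)
  qed
  have "(\<Sum>x\<in>X. bond_energy f V M {\<eta> \<in> Z. P x \<eta>}) =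
    (\<Sum>v\<in>V. \<Sum>b\<in>bonds M. \<Sum>x\<in>X. \<Sum>\<eta>\<in>{\<eta> \<in> Z. P x \<eta>}. (f (exchange (fst b) (snd b) v \<eta>) - f \<eta>)\<^sup>2)"
    unfolding bond_energy_def split_beta
    by (subst sum.swap) (intro sum.cong refl sum.swap)
  then show ?thesis by (simp add: a bond_energy_def split_beta sum_distrib_left)
qed

lemma sum_weighted_square_le:
  fixes r d :: "'a \<Rightarrow> real"
  assumes "\<And>i. i \<in> I \<Longrightarrow> 0 \<le> r i"
  shows "(\<Sum>i\<in>I. r i * d i)\<^sup>2 \<le> (\<Sum>i\<in>I. r i) * (\<Sum>i\<in>I. r i * (d i)\<^sup>2)"
proof -
  have "(\<Sum>i\<in>I. sqrt (r i) * (sqrt (r i) * d i))\<^sup>2 \<le> (\<Sum>i\<in>I. (sqrt (r i))\<^sup>2) * (\<Sum>i\<in>I. (sqrt (r i) * d i)\<^sup>2)"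
    by (rule Cauchy_Schwarz_ineq_sum)
  moreover have "(\<Sum>i\<in>I. sqrt (r i) * (sqrt (r i) * d i)) = (\<Sum>i\<in>I. r i * d i)"
    by (rule sum.cong) (simp_all add: assms flip: mult.assoc)
  moreover have "(\<Sum>i\<in>I. (sqrt (r i))\<^sup>2) = (\<Sum>i\<in>I. r i)"
    by (rule sum.cong) (simp_all add: assms)
  moreover have "(\<Sum>i\<in>I. (sqrt (r i) * d i)\<^sup>2) = (\<Sum>i\<in>I. r i * (d i)\<^sup>2)"
    by (rule sum.cong) (simp_all add: assms power_mult_distrib)
  ultimately show ?thesis by simp
qed

lemma sum_product4:
  fixes a :: "'a \<Rightarrow> real"
  shows "(\<Sum>(x, y1, y2, y3)\<in>S1 \<times> S2 \<times> S3 \<times> S4. a x * b y1 * c y2 * e y3) =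
    sum a S1 * sum b S2 * sum c S3 * sum e S4"
proof -
  have "(\<Sum>(x, y1, y2, y3)\<in>S1 \<times> S2 \<times> S3 \<times> S4. a x * b y1 * c y2 * e y3) =
      (\<Sum>x\<in>S1. \<Sum>y1\<in>S2. \<Sum>y2\<in>S3. \<Sum>y3\<in>S4. a x * b y1 * c y2 * e y3)"
    by (simp add: sum.cartesian_product split_def)
  also have "\<dots> = sum a S1 * sum b S2 * sum c S3 * sum e S4"
    by (simp flip: sum_distrib_left sum_distrib_right)
  finally show ?thesis .
qed

lemma square_sum3_le: "(a + b + c)\<^sup>2 \<le> 3 * (a\<^sup>2 + b\<^sup>2 + c\<^sup>2)" for a b c :: real
  using sum_squares_ge_zero[of "a - b" "b - c"] zero_le_square[of "a - c"]
  by (simp add: power2_eq_square algebra_simps)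

text \<open>Brings the occupations of three velocities from \<open>y1\<close>, \<open>y2\<close>,
  \<open>y3\<close> to the meeting site x. The fourth velocity of the collision stays put, because x
  itself is chosen according to its occupation.\<close>

definition gather :: "real^'d \<Rightarrow> real^'d \<Rightarrow> real^'d \<Rightarrow> (int^'d) \<times> (int^'d) \<times> (int^'d) \<times> (int^'d) \<Rightarrow> 'd config \<Rightarrow> 'd config" where
  "gather u v w = (\<lambda>(x, y1, y2, y3). exchange x y1 u \<circ> (exchange x y2 v \<circ> exchange x y3 w))"

lemma gather_apply:
  assumes "distinct [a, u, v, w]"
  shows "gather u v w (x, y1, y2, y3) \<eta> x a = \<eta> x a"
    "gather u v w (x, y1, y2, y3) \<eta> y1 u = \<eta> x u"
    "gather u v w (x, y1, y2, y3) \<eta> y2 v = \<eta> x v"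
    "gather u v w (x, y1, y2, y3) \<eta> y3 w = \<eta> x w"
  using assms by (auto simp: gather_def exchange_apply)

text \<open>Closure is asked only for exchanges of the three gathered velocities. So
  \<open>Z\<close> may be cut out of a class by the occupation of the fourth velocity at one site, a
  condition that exchanges of that velocity would destroy.\<close>

context
  fixes V :: "(real^'d) set" and M :: nat and Z :: "'d config set" and u v w :: "real^'d"
  assumes V: "finite V" "u \<in> V" "v \<in> V" "w \<in> V"
    and closed: "\<And>x z s \<eta>. s \<in> {u, v, w} \<Longrightarrow> x \<in> Lam M \<Longrightarrow> z \<in> Lam M \<Longrightarrow> \<eta> \<in> Z \<Longrightarrow> exchange x z s \<eta> \<in> Z"
begin

lemma bij_betw_exchange:
  assumes "s \<in> {u, v, w}" "x \<in> Lam M" "z \<in> Lam M"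
  shows "bij_betw (exchange x z s) Z Z"
  by (rule bij_betw_involution) (use assms closed exchange_exchange in auto)

lemma bij_betw_gather:
  assumes "t \<in> Lam M \<times> Lam M \<times> Lam M \<times> Lam M"
  shows "bij_betw (gather u v w t) Z Z"
  using assms unfolding gather_def
  by (auto intro!: bij_betw_trans[of _ Z Z] bij_betw_exchange)

text \<open>Three exchanges at 4Md each give the constant 12.\<close>

lemma gather_displacement:
  assumes "t \<in> Lam M \<times> Lam M \<times> Lam M \<times> Lam M"
  shows "(\<Sum>\<eta>\<in>Z. (f (gather u v w t \<eta>) - f \<eta>)\<^sup>2) \<le> (12 * real M * real CARD('d))\<^sup>2 * bond_energy f V M Z"
proof -
  obtain x y1 y2 y3 where t: "t = (x, y1, y2, y3)" by (cases t)
  let ?B = "4 * real M * real CARD('d) * sqrt (bond_energy f V M Z)"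
  have L: "x \<in> Lam M" "y1 \<in> Lam M" "y2 \<in> Lam M" "y3 \<in> Lam M" using assms t by auto
  have le: "displacement f (exchange x y s) Z \<le> ?B" if "s \<in> {u, v, w}" "y \<in> Lam M" for y s
    by (rule displacement_exchange_le) (use that V L closed in auto)
  have "displacement f (gather u v w t) Z \<le>
      displacement f (exchange x y1 u) Z + displacement f (exchange x y2 v \<circ> exchange x y3 w) Z"
    unfolding t gather_def split_conv
    by (intro displacement_comp_le bij_betw_trans[OF bij_betw_exchange bij_betw_exchange]) (use L in auto)
  also have "displacement f (exchange x y2 v \<circ> exchange x y3 w) Z \<le>
      displacement f (exchange x y2 v) Z + displacement f (exchange x y3 w) Z"
    by (intro displacement_comp_le bij_betw_exchange) (use L in auto)
  finally have "displacement f (gather u v w t) Z \<le> ?B + (?B + ?B)"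
    using le[of u y1] le[of v y2] le[of w y3] L by simp
  then have "(displacement f (gather u v w t) Z)\<^sup>2 \<le> (3 * ?B)\<^sup>2"
    by (intro power_mono displacement_nonneg) simp
  then show ?thesis
    by (simp add: displacement_power2 power_mult_distrib bond_energy_nonneg)
qed

end

definition coll_energy :: "(('d::finite) config \<Rightarrow> real) \<Rightarrow> nat \<Rightarrow> 'd collision \<Rightarrow> 'd config set \<Rightarrow> real" where
  "coll_energy f M q Z = (\<Sum>x\<in>Lam M. \<Sum>\<eta>\<in>Z. coll_rate x q \<eta> * (f (collide x q \<eta>) - f \<eta>)\<^sup>2)"

text \<open>For each configuration of \<open>Y\<close>, \<open>n\<close> counts the 4-tuples of
  sites with v present at the first, w at the second, v' absent at the third and w' at the fourth;
  \<open>n'\<close> counts the reversed pattern in \<open>Y'\<close>. Gathering at the first site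
  and colliding matches the tuple-configuration pairs of both sides, so both totals equal the same
  \<open>R\<close>. The difference of the means thus becomes an average over these pairs of
  increments of \<open>f\<close>, to which Cauchy-Schwarz applies.\<close>

lemma class_edge:
  fixes V :: "(real^'d) set" and M :: nat and N :: "real^'d \<Rightarrow> nat" and f :: "'d config \<Rightarrow> real"
    and v w v' w' :: "real^'d"
  defines "l \<equiv> card (Lam M :: (int^'d) set)"
  defines "Y \<equiv> occupation_class V M N"
  defines "Y' \<equiv> occupation_class V M
    (\<lambda>u. if u = v \<or> u = w then N u - 1 else if u = v' \<or> u = w' then N u + 1 else N u)"
  defines "n \<equiv> real (N v) * real (N w) * (real l - real (N v')) * (real l - real (N w'))"
  defines "n' \<equiv> (real l - real (N v) + 1) * (real l - real (N w) + 1) * (real (N v') + 1) * (real (N w') + 1)"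
  assumes V: "finite V" "v \<in> V" "w \<in> V" "v' \<in> V" "w' \<in> V" and dist: "distinct [v, w, v', w']"
    and ne: "Y \<noteq> {}"
    and pos: "1 \<le> N v" "1 \<le> N w" "N v' < l" "N w' < l"
  shows "n * real (card Y) = n' * real (card Y')" (is ?count)
    and "min (real (card Y)) (real (card Y')) * ((\<Sum>\<eta>\<in>Y. f \<eta>) / real (card Y) - (\<Sum>\<eta>\<in>Y'. f \<eta>) / real (card Y'))\<^sup>2
      \<le> 3 * real l ^ 3 * ((12 * real M * real CARD('d))\<^sup>2 * (bond_energy f V M Y + bond_energy f V M Y')
          + coll_energy f M (v, w, v', w') Y)" (is ?ineq)
proof -
  define N' where "N' = (\<lambda>u. if u = v \<or> u = w then N u - 1 else if u = v' \<or> u = w' then N u + 1 else N u)"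
  have Y': "Y' = occupation_class V M N'" by (simp add: Y'_def N'_def)
  have N'_eq: "real (N' v) = real (N v) - 1" "real (N' w) = real (N w) - 1"
    "real (N' v') = real (N v') + 1" "real (N' w') = real (N w') + 1"
    using dist pos by (auto simp: N'_def)
  let ?q = "(v, w, v', w')" and ?q' = "(v', w', v, w)"
  define T where "T = (Lam M :: (int^'d) set) \<times> (Lam M :: (int^'d) set) \<times> (Lam M :: (int^'d) set) \<times> (Lam M :: (int^'d) set)"
  define g where "g = gather w v' w'"
  have fin: "finite Y" "finite Y'" by (simp_all add: Y_def Y' finite_occupation_class V)
  have conf: "Y \<subseteq> configs V M" "Y' \<subseteq> configs V M" by (auto simp: Y_def Y' occupation_class_def)
  have rate01: "coll_rate x (a, b, c, e) \<eta> = (if \<eta> x a = 1 \<and> \<eta> x b = 1 \<and> \<eta> x c = 0 \<and> \<eta> x e = 0 then 1 else 0)"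
    if "\<eta> \<in> Y \<union> Y'" "x \<in> Lam M" "a \<in> V" "b \<in> V" "c \<in> V" "e \<in> V" for x a b c e \<eta>
    by (rule coll_rate_cases[of _ V M]) (use that conf in auto)
  have fwd: "collide x ?q \<eta> \<in> Y'" if "x \<in> Lam M" "\<eta> \<in> Y" "coll_rate x ?q \<eta> = 1" for x \<eta>
  proof -
    have p: "\<eta> x v = 1" "\<eta> x w = 1" "\<eta> x v' = 0" "\<eta> x w' = 0"
      using rate01[of \<eta> x v w v' w'] V that by (auto split: if_splits)
    show ?thesis unfolding Y' occupation_class_def
      using that collide_mem_configs[of \<eta> V M x v w v' w'] V conf dist
        occupation_collide(1)[of x M v w v' w' \<eta>, OF that(1) _ _ p]
      by (auto simp: N'_def Y_def occupation_class_def)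
  qed
  have bwd: "collide x ?q' \<eta> \<in> Y" if "x \<in> Lam M" "\<eta> \<in> Y'" "coll_rate x ?q' \<eta> = 1" for x \<eta>
  proof -
    have p: "\<eta> x v' = 1" "\<eta> x w' = 1" "\<eta> x v = 0" "\<eta> x w = 0"
      using rate01[of \<eta> x v' w' v w] V that by (auto split: if_splits)
    show ?thesis unfolding Y_def occupation_class_def
      using that collide_mem_configs[of \<eta> V M x v' w' v w] V conf dist pos
        occupation_collide(1)[of x M v' w' v w \<eta>, OF that(1) _ _ p]
      by (auto simp: N'_def Y' occupation_class_def)
  qed
  have rev: "(\<Sum>\<eta>\<in>Y. coll_rate x ?q \<eta> * h \<eta> (collide x ?q \<eta>)) =
      (\<Sum>\<eta>\<in>Y'. coll_rate x ?q' \<eta> * h (collide x ?q' \<eta>) \<eta>)"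
    if "x \<in> Lam M" for x and h :: "'d config \<Rightarrow> 'd config \<Rightarrow> real"
    by (rule sum_collision_reverse[OF that V(2-5) fin conf]) (use fwd bwd that in auto)

  have dist': "distinct [v, w, v', w']" "distinct [w, v', w']" using dist by auto
  have bij: "bij_betw (g t) (occupation_class V M K) (occupation_class V M K)" if "t \<in> T" for t K
    unfolding g_def by (rule bij_betw_gather[OF V(1,3,4,5) _ that[unfolded T_def]]) (use V in \<open>auto intro: exchange_mem_class\<close>)

  \<comment> \<open>After the substitution by the bijection \<open>g t\<close>, the sites
    \<open>y1\<close>, \<open>y2\<close>, \<open>y3\<close> carry what x carried, so the pattern at
    four sites turns into the collision rate at x. From here on the summation variable is the
    gathered configuration and \<open>g t\<close> spreads it out.\<close>
  have key1: "n * (\<Sum>\<eta>\<in>Y. h \<eta>) = (\<Sum>t\<in>T. \<Sum>\<eta>\<in>Y. coll_rate (fst t) ?q \<eta> * h (g t \<eta>))" for h :: "'d config \<Rightarrow> real"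
  proof -
    let ?\<omega> = "\<lambda>\<eta>. \<lambda>(x, y1, y2, y3). \<eta> x v * \<eta> y1 w * (1 - \<eta> y2 v') * (1 - \<eta> y3 w')"
    have "(\<Sum>t\<in>T. ?\<omega> \<eta> t) = n" if "\<eta> \<in> Y" for \<eta>
      unfolding T_def sum_product4 n_def l_def using sum_occupation[of \<eta> V M N] that V by (simp add: Y_def)
    then have "n * (\<Sum>\<eta>\<in>Y. h \<eta>) = (\<Sum>\<eta>\<in>Y. \<Sum>t\<in>T. ?\<omega> \<eta> t * h \<eta>)"
      by (simp add: sum_distrib_left flip: sum_distrib_right)
    also have "\<dots> = (\<Sum>t\<in>T. \<Sum>\<eta>\<in>Y. ?\<omega> \<eta> t * h \<eta>)" by (rule sum.swap)
    also have "\<dots> = (\<Sum>t\<in>T. \<Sum>\<eta>\<in>Y. ?\<omega> (g t \<eta>) t * h (g t \<eta>))"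
      by (intro sum.cong refl sum.reindex_bij_betw[symmetric]) (use bij in \<open>auto simp: Y_def\<close>)
    also have "\<dots> = (\<Sum>t\<in>T. \<Sum>\<eta>\<in>Y. coll_rate (fst t) ?q \<eta> * h (g t \<eta>))"
      by (intro sum.cong refl) (auto simp: g_def gather_apply[OF dist] coll_rate_def)
    finally show ?thesis .
  qed
  have key2: "n' * (\<Sum>\<eta>\<in>Y'. h \<eta>) = (\<Sum>t\<in>T. \<Sum>\<eta>\<in>Y'. coll_rate (fst t) ?q' \<eta> * h (g t \<eta>))" for h :: "'d config \<Rightarrow> real"
  proof -
    let ?\<omega> = "\<lambda>\<eta>. \<lambda>(x, y1, y2, y3). (1 - \<eta> x v) * (1 - \<eta> y1 w) * \<eta> y2 v' * \<eta> y3 w'"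
    have "(\<Sum>t\<in>T. ?\<omega> \<eta> t) = n'" if "\<eta> \<in> Y'" for \<eta>
      unfolding T_def sum_product4[of "\<lambda>x. 1 - \<eta> x v" "\<lambda>y1. 1 - \<eta> y1 w"] n'_def l_def
      using sum_occupation[of \<eta> V M N'] that V by (simp add: Y' N'_eq diff_diff_eq2 diff_add_eq)
    then have "n' * (\<Sum>\<eta>\<in>Y'. h \<eta>) = (\<Sum>\<eta>\<in>Y'. \<Sum>t\<in>T. ?\<omega> \<eta> t * h \<eta>)"
      by (simp add: sum_distrib_left flip: sum_distrib_right)
    also have "\<dots> = (\<Sum>t\<in>T. \<Sum>\<eta>\<in>Y'. ?\<omega> \<eta> t * h \<eta>)" by (rule sum.swap)
    also have "\<dots> = (\<Sum>t\<in>T. \<Sum>\<eta>\<in>Y'. ?\<omega> (g t \<eta>) t * h (g t \<eta>))"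
      by (intro sum.cong refl sum.reindex_bij_betw[symmetric]) (use bij in \<open>auto simp: Y'\<close>)
    also have "\<dots> = (\<Sum>t\<in>T. \<Sum>\<eta>\<in>Y'. coll_rate (fst t) ?q' \<eta> * h (g t \<eta>))"
      by (intro sum.cong refl) (auto simp: g_def gather_apply[OF dist] coll_rate_def)
    finally show ?thesis .
  qed
  \<comment> \<open>Reversing the collision moves this sum to \<open>Y\<close>, so both means are
    now sums over the same pairs with the same weights.\<close>
  have key3: "n' * (\<Sum>\<eta>\<in>Y'. h \<eta>) = (\<Sum>t\<in>T. \<Sum>\<eta>\<in>Y. coll_rate (fst t) ?q \<eta> * h (g t (collide (fst t) ?q \<eta>)))"
    for h :: "'d config \<Rightarrow> real"
    unfolding key2 by (intro sum.cong refl rev[symmetric]) (auto simp: T_def)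

  define R where "R = (\<Sum>t\<in>T. \<Sum>\<eta>\<in>Y. coll_rate (fst t) ?q \<eta>)"
  have R1: "R = n * real (card Y)" using key1[of "\<lambda>_. 1"] by (simp add: R_def)
  have R2: "R = n' * real (card Y')" using key3[of "\<lambda>_. 1"] by (simp add: R_def)
  show ?count using R1 R2 by simp

  have cY: "real (card Y) > 0" using ne fin by (simp add: card_gt_0_iff)
  have NL: "N s \<le> l" if "s \<in> V" for s
  proof -
    obtain \<eta> where "\<eta> \<in> Y" using ne by blast
    then have "N s = card {x \<in> Lam M. \<eta> x s = 1}" using sum_occupation(3)[of \<eta> V M N s] that by (simp add: Y_def)
    also have "\<dots> \<le> l" unfolding l_def by (rule card_mono[OF finite_Lam]) auto
    finally show ?thesis .
  qed
  \<comment> \<open>The other three factors of \<open>n\<close> are at least 1. This bound and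
    \<open>nv'\<close> later absorb the site counts in \<open>S1\<close> and
    \<open>S3\<close>.\<close>
  have nv: "real (N v) \<le> n"
  proof -
    have "real (N v) * 1 \<le> real (N v) * (real (N w) * (real l - real (N v')) * (real l - real (N w')))"
      by (intro mult_left_mono mult_ge1_I) (use pos in auto)
    then show ?thesis by (simp add: n_def mult.assoc)
  qed
  have nv': "real l - real (N v) + 1 \<le> n'"
  proof -
    have "(real l - real (N v) + 1) * 1 \<le> (real l - real (N v) + 1) * ((real l - real (N w) + 1) * (real (N v') + 1) * (real (N w') + 1))"
      by (intro mult_left_mono mult_ge1_I) (use NL[of v] NL[of w] V in auto)
    then show ?thesis by (simp add: n'_def mult.assoc)
  qed
  have n0: "n > 0" using nv pos by simp
  have R0: "R > 0" using R1 n0 cY by simp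
  have n'0: "n' \<ge> 0" using nv' NL[of v] V by simp
  with R2 R0 have n'1: "n' > 0" and cY': "real (card Y') > 0" by (auto simp: zero_less_mult_iff)
  let ?F = "(\<Sum>\<eta>\<in>Y. f \<eta>) / real (card Y)" and ?F' = "(\<Sum>\<eta>\<in>Y'. f \<eta>) / real (card Y')"
  let ?c = "\<lambda>t \<eta>. collide (fst t) ?q \<eta>"
  let ?\<tau> = "(12 * real M * real CARD('d))\<^sup>2"
  have rate0: "0 \<le> coll_rate (fst t) ?q \<eta>" if "t \<in> T" "\<eta> \<in> Y" for t \<eta>
    using rate01[of \<eta> "fst t" v w v' w'] V that by (auto simp: T_def)

  have RF: "R * (?F - ?F') = (\<Sum>t\<in>T. \<Sum>\<eta>\<in>Y. coll_rate (fst t) ?q \<eta> * (f (g t \<eta>) - f (g t (?c t \<eta>))))"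
  proof -
    have "R * (?F - ?F') = n * (\<Sum>\<eta>\<in>Y. f \<eta>) - n' * (\<Sum>\<eta>\<in>Y'. f \<eta>)"
    proof -
      have "R * ?F = n * (\<Sum>\<eta>\<in>Y. f \<eta>)" using cY by (simp add: R1)
      moreover have "R * ?F' = n' * (\<Sum>\<eta>\<in>Y'. f \<eta>)" using cY' by (simp add: R2)
      ultimately show ?thesis by (simp add: right_diff_distrib)
    qed
    then show ?thesis unfolding key1 key3 by (simp add: sum_subtractf right_diff_distrib)
  qed
  \<comment> \<open>The increment splits into spreading inside \<open>Y\<close>, the collision
    itself, and spreading inside \<open>Y'\<close>.\<close>
  define S1 where "S1 = (\<Sum>t\<in>T. \<Sum>\<eta>\<in>Y. coll_rate (fst t) ?q \<eta> * (f (g t \<eta>) - f \<eta>)\<^sup>2)"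
  define S2 where "S2 = (\<Sum>t\<in>T. \<Sum>\<eta>\<in>Y. coll_rate (fst t) ?q \<eta> * (f \<eta> - f (?c t \<eta>))\<^sup>2)"
  define S3 where "S3 = (\<Sum>t\<in>T. \<Sum>\<eta>\<in>Y. coll_rate (fst t) ?q \<eta> * (f (?c t \<eta>) - f (g t (?c t \<eta>)))\<^sup>2)"
  have "(R * (?F - ?F'))\<^sup>2 \<le> R * (\<Sum>t\<in>T. \<Sum>\<eta>\<in>Y. coll_rate (fst t) ?q \<eta> * (f (g t \<eta>) - f (g t (?c t \<eta>)))\<^sup>2)"
    unfolding RF unfolding R_def sum.cartesian_product split_def
    by (rule sum_weighted_square_le) (use rate0 in auto)
  also have "\<dots> \<le> R * (\<Sum>t\<in>T. \<Sum>\<eta>\<in>Y. coll_rate (fst t) ?q \<eta> *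
      (3 * ((f (g t \<eta>) - f \<eta>)\<^sup>2 + (f \<eta> - f (?c t \<eta>))\<^sup>2 + (f (?c t \<eta>) - f (g t (?c t \<eta>)))\<^sup>2)))"
  proof (intro mult_left_mono sum_mono)
    fix t \<eta>
    show "(f (g t \<eta>) - f (g t (?c t \<eta>)))\<^sup>2 \<le>
        3 * ((f (g t \<eta>) - f \<eta>)\<^sup>2 + (f \<eta> - f (?c t \<eta>))\<^sup>2 + (f (?c t \<eta>) - f (g t (?c t \<eta>)))\<^sup>2)"
      using square_sum3_le[of "f (g t \<eta>) - f \<eta>" "f \<eta> - f (?c t \<eta>)" "f (?c t \<eta>) - f (g t (?c t \<eta>))"] by simp
  qed (use rate0 R0 in auto)
  also have "\<dots> = R * (3 * (S1 + S2 + S3))"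
    by (simp add: S1_def S2_def S3_def sum.distrib sum_distrib_left algebra_simps)
  finally have "R * (R * (?F - ?F')\<^sup>2) \<le> R * (3 * (S1 + S2 + S3))"
    by (simp add: power2_eq_square algebra_simps)
  then have main: "R * (?F - ?F')\<^sup>2 \<le> 3 * (S1 + S2 + S3)" using R0 by simp

  \<comment> \<open>Only the meeting site matters; the other three are free, which is the whole
    origin of |Lambda|^3.\<close>
  have tbound: "(\<Sum>t\<in>T. h (fst t)) = real l ^ 3 * (\<Sum>x\<in>Lam M. h x)" for h :: "int^'d \<Rightarrow> real"
    using sum_product4[where a = h and b = "\<lambda>_. 1" and c = "\<lambda>_. 1" and e = "\<lambda>_. 1"
        and ?S1.0 = "Lam M" and ?S2.0 = "Lam M :: (int^'d) set" and ?S3.0 = "Lam M :: (int^'d) set" and ?S4.0 = "Lam M :: (int^'d) set"]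
    by (simp add: T_def l_def split_def power3_eq_cube mult.commute mult.left_commute)

  \<comment> \<open>The rate is weakened to the single condition that v is present at x. The moves
    in \<open>g t\<close> do not touch v, so they preserve this condition, and summing over x costs
    only \<open>N v\<close>.\<close>
  have S1: "S1 \<le> real l ^ 3 * (?\<tau> * (real (N v) * bond_energy f V M Y))"
  proof -
    have "S1 \<le> (\<Sum>t\<in>T. ?\<tau> * bond_energy f V M {\<eta> \<in> Y. \<eta> (fst t) v = 1})"
      unfolding S1_def
    proof (rule sum_mono)
      fix t assume t: "t \<in> T"
      have "(\<Sum>\<eta>\<in>Y. coll_rate (fst t) ?q \<eta> * (f (g t \<eta>) - f \<eta>)\<^sup>2) \<le> (\<Sum>\<eta>\<in>Y. if \<eta> (fst t) v = 1 then (f (g t \<eta>) - f \<eta>)\<^sup>2 else 0)"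
        using rate01[of _ "fst t" v w v' w'] t V by (intro sum_mono) (auto simp: T_def)
      also have "\<dots> = (\<Sum>\<eta>\<in>{\<eta> \<in> Y. \<eta> (fst t) v = 1}. (f (g t \<eta>) - f \<eta>)\<^sup>2)"
        using fin by (simp add: sum.inter_filter)
      also have "\<dots> \<le> ?\<tau> * bond_energy f V M {\<eta> \<in> Y. \<eta> (fst t) v = 1}"
        unfolding g_def
        by (rule gather_displacement[OF V(1,3,4,5) _ t[unfolded T_def]])
           (use V dist in \<open>auto simp: Y_def exchange_apply intro: exchange_mem_class\<close>)
      finally show "(\<Sum>\<eta>\<in>Y. coll_rate (fst t) ?q \<eta> * (f (g t \<eta>) - f \<eta>)\<^sup>2) \<le> ?\<tau> * bond_energy f V M {\<eta> \<in> Y. \<eta> (fst t) v = 1}" .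
    qed
    also have "\<dots> = real l ^ 3 * (?\<tau> * (\<Sum>x\<in>Lam M. bond_energy f V M {\<eta> \<in> Y. \<eta> x v = 1}))"
      by (subst tbound) (simp add: sum_distrib_left)
    also have "(\<Sum>x\<in>Lam M. bond_energy f V M {\<eta> \<in> Y. \<eta> x v = 1}) = real (N v) * bond_energy f V M Y"
      by (rule sum_bond_energy_filter[OF finite_Lam fin(1)]) (use sum_occupation(3)[of _ V M N v] V in \<open>auto simp: Y_def\<close>)
    finally show ?thesis .
  qed
  have S2: "S2 = real l ^ 3 * coll_energy f M ?q Y"
    unfolding S2_def coll_energy_def tbound[symmetric] by (intro sum.cong refl) (simp add: power2_commute)
  \<comment> \<open>After reversal the same argument applies in \<open>Y'\<close>, with v absent at
    x; there are |Lambda| - N v + 1 such sites.\<close>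
  have S3: "S3 \<le> real l ^ 3 * (?\<tau> * ((real l - real (N v) + 1) * bond_energy f V M Y'))"
  proof -
    have "S3 = (\<Sum>t\<in>T. \<Sum>\<eta>\<in>Y'. coll_rate (fst t) ?q' \<eta> * (f \<eta> - f (g t \<eta>))\<^sup>2)"
      unfolding S3_def by (intro sum.cong refl rev) (auto simp: T_def)
    also have "\<dots> \<le> (\<Sum>t\<in>T. ?\<tau> * bond_energy f V M {\<eta> \<in> Y'. \<eta> (fst t) v = 0})"
    proof (rule sum_mono)
      fix t assume t: "t \<in> T"
      have "(\<Sum>\<eta>\<in>Y'. coll_rate (fst t) ?q' \<eta> * (f \<eta> - f (g t \<eta>))\<^sup>2) \<le> (\<Sum>\<eta>\<in>Y'. if \<eta> (fst t) v = 0 then (f (g t \<eta>) - f \<eta>)\<^sup>2 else 0)"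
        using rate01[of _ "fst t" v' w' v w] t V by (intro sum_mono) (auto simp: T_def power2_commute)
      also have "\<dots> = (\<Sum>\<eta>\<in>{\<eta> \<in> Y'. \<eta> (fst t) v = 0}. (f (g t \<eta>) - f \<eta>)\<^sup>2)"
        using fin by (simp add: sum.inter_filter)
      also have "\<dots> \<le> ?\<tau> * bond_energy f V M {\<eta> \<in> Y'. \<eta> (fst t) v = 0}"
        unfolding g_def
        by (rule gather_displacement[OF V(1,3,4,5) _ t[unfolded T_def]])
           (use V dist in \<open>auto simp: Y' exchange_apply intro: exchange_mem_class\<close>)
      finally show "(\<Sum>\<eta>\<in>Y'. coll_rate (fst t) ?q' \<eta> * (f \<eta> - f (g t \<eta>))\<^sup>2) \<le> ?\<tau> * bond_energy f V M {\<eta> \<in> Y'. \<eta> (fst t) v = 0}" .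
    qed
    also have "\<dots> = real l ^ 3 * (?\<tau> * (\<Sum>x\<in>Lam M. bond_energy f V M {\<eta> \<in> Y'. \<eta> x v = 0}))"
      by (subst tbound) (simp add: sum_distrib_left)
    also have "(\<Sum>x\<in>Lam M. bond_energy f V M {\<eta> \<in> Y'. \<eta> x v = 0}) = (real l - real (N v) + 1) * bond_energy f V M Y'"
      by (rule sum_bond_energy_filter[OF finite_Lam fin(2)])
         (use sum_occupation(4)[of _ V M N' v] V in \<open>auto simp: Y' N'_eq l_def\<close>)
    finally show ?thesis .
  qed

  let ?E = "bond_energy f V M Y" and ?E' = "bond_energy f V M Y'" and ?K = "coll_energy f M ?q Y"
  let ?m = "max n n'" and ?\<mu> = "min (real (card Y)) (real (card Y'))"
  have E0: "0 \<le> ?E" "0 \<le> ?E'" by (simp_all add: bond_energy_nonneg)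
  have K0: "0 \<le> ?K" unfolding coll_energy_def
    by (intro sum_nonneg mult_nonneg_nonneg) (use rate01[of _ _ v w v' w'] V in auto)
  have m1: "1 \<le> ?m" using nv pos by linarith
  \<comment> \<open>\<open>R\<close> is both \<open>n\<close> times \<open>card Y\<close> and
    \<open>n'\<close> times \<open>card Y'\<close>. Pairing the larger factor with its own class
    gives the bound, and dividing by \<open>?m\<close> at the end cancels the site counts.\<close>
  have "?\<mu> * ?m \<le> R"
  proof (cases "n \<le> n'")
    case True
    then show ?thesis unfolding R2 using n'0 by (simp add: max_def mult.commute mult_left_mono)
  next
    case False
    then show ?thesis unfolding R1 using n0 by (simp add: max_def mult.commute mult_left_mono)
  qed
  then have "?\<mu> * ?m * (?F - ?F')\<^sup>2 \<le> R * (?F - ?F')\<^sup>2"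
    by (rule mult_right_mono) simp
  then have "?m * (?\<mu> * (?F - ?F')\<^sup>2) \<le> R * (?F - ?F')\<^sup>2"
    by (simp only: mult.assoc mult.left_commute)
  also have "\<dots> \<le> 3 * (S1 + S2 + S3)" by (rule main)
  also have "\<dots> \<le> 3 * (real l ^ 3 * (?\<tau> * (?m * ?E)) + real l ^ 3 * (?m * ?K) + real l ^ 3 * (?\<tau> * (?m * ?E')))"
  proof -
    have "S1 \<le> real l ^ 3 * (?\<tau> * (?m * ?E))"
      by (rule order_trans[OF S1]) (intro mult_left_mono mult_right_mono E0, use nv in auto)
    moreover have "S2 \<le> real l ^ 3 * (?m * ?K)"
      unfolding S2 using mult_right_mono[OF m1 K0] by (intro mult_left_mono) auto
    moreover have "S3 \<le> real l ^ 3 * (?\<tau> * (?m * ?E'))"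
      by (rule order_trans[OF S3]) (intro mult_left_mono mult_right_mono E0, use nv' in auto)
    ultimately show ?thesis by simp
  qed
  also have "\<dots> = ?m * (3 * real l ^ 3 * (?\<tau> * (?E + ?E') + ?K))"
    by (simp add: algebra_simps)
  finally show ?ineq by (rule mult_left_le_imp_le) (use m1 in linarith)
qed

subsection \<open>Paths between cells and Dirichlet forms\<close>

text \<open>Prepends one edge to a path of k edges: (x + y)^2 <= (k + 1) (x^2 + y^2 / k), so the
  factor grows linearly in the length although the path is built edge by edge.\<close>

lemma square_add_weighted_le:
  fixes x y :: real
  assumes m: "0 \<le> m" "m * x\<^sup>2 \<le> g" "m * y\<^sup>2 \<le> real k * s" and s: "0 \<le> s"
  shows "m * (x + y)\<^sup>2 \<le> real (Suc k) * (g + s)"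
proof (cases "k = 0")
  case True
  then have "m * y\<^sup>2 \<le> 0" using m by simp
  then have "m * y\<^sup>2 = 0" using m(1) by (intro antisym) auto
  then have "m = 0 \<or> y = 0" by simp
  then show ?thesis using m s True by auto
next
  case False
  have "2 * x * y \<le> real k * x\<^sup>2 + y\<^sup>2 / real k"
  proof -
    have "0 \<le> (real k * x - y)\<^sup>2 / real k" by simp
    also have "\<dots> = real k * x\<^sup>2 + y\<^sup>2 / real k - 2 * x * y"
      using False by (simp add: field_simps power2_eq_square)
    finally show ?thesis by simp
  qed
  then have "(x + y)\<^sup>2 \<le> (real k + 1) * (x\<^sup>2 + y\<^sup>2 / real k)"
    using False by (simp add: power2_sum field_simps)
  then have "m * (x + y)\<^sup>2 \<le> m * ((real k + 1) * (x\<^sup>2 + y\<^sup>2 / real k))"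
    by (rule mult_left_mono) (rule m)
  also have "\<dots> = (real k + 1) * (m * x\<^sup>2 + (m * y\<^sup>2) / real k)" by (simp add: algebra_simps)
  also have "\<dots> \<le> (real k + 1) * (g + s)"
    using m False by (intro mult_left_mono add_mono) (auto simp: field_simps)
  finally show ?thesis by (simp add: add.commute)
qed

text \<open>The effect on labels of a collision that destroys the pair with index l' and creates the
  pair with index l.\<close>

definition shift :: "nat \<Rightarrow> nat \<Rightarrow> (nat \<Rightarrow> int) \<Rightarrow> (nat \<Rightarrow> int)" where
  "shift l l' a = a(l := a l + 1, l' := a l' - 1)"

text \<open>In the application \<open>K\<close> is the set of labels, \<open>w\<close> the cell
  size, \<open>F\<close> the cell mean, and \<open>G a\<close> a bound valid for all edges leaving
  \<open>a\<close>. Charging edges to vertices lets the cost of a path be compared with a sum over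
  \<open>K\<close>.\<close>

context
  fixes K :: "(nat \<Rightarrow> int) set" and J :: "nat set" and w F G :: "(nat \<Rightarrow> int) \<Rightarrow> real" and s :: int
  assumes fin: "finite K" "finite J"
    and supp: "\<And>a j. a \<in> K \<Longrightarrow> j \<notin> J \<Longrightarrow> a j = 0"
    and total: "\<And>a. a \<in> K \<Longrightarrow> sum a J = s"
    and step: "\<And>a a' l l'. a \<in> K \<Longrightarrow> a' \<in> K \<Longrightarrow> l \<in> J \<Longrightarrow> l' \<in> J \<Longrightarrow> a l < a' l \<Longrightarrow> a' l' < a l' \<Longrightarrow>
      shift l l' a \<in> K \<and> w a \<le> w (shift l l' a) \<or> shift l' l a' \<in> K \<and> w a' \<le> w (shift l' l a')"
    and edge: "\<And>a l l'. a \<in> K \<Longrightarrow> l \<in> J \<Longrightarrow> l' \<in> J \<Longrightarrow> l \<noteq> l' \<Longrightarrow> shift l l' a \<in> K \<Longrightarrow>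
      min (w a) (w (shift l l' a)) * (F a - F (shift l l' a))\<^sup>2 \<le> G a"
    and G: "\<And>a. a \<in> K \<Longrightarrow> 0 \<le> G a" and w: "\<And>a. a \<in> K \<Longrightarrow> 0 \<le> w a"
begin

text \<open>The minimum of the weights along the path between \<open>a\<close> and \<open>a'\<close> is attained at an
  endpoint: by \<open>step\<close> one of the two endpoints can always be moved towards the other without
  decreasing its weight. The path stays in the box spanned by \<open>a\<close> and \<open>a'\<close> and visits each point
  once.\<close>

lemma path_le:
  assumes "a \<in> K" "a' \<in> K" "(\<Sum>j\<in>J. \<bar>a j - a' j\<bar>) \<le> 2 * int k" "0 \<le> m" "m \<le> w a" "m \<le> w a'"
  shows "m * (F a - F a')\<^sup>2 \<le> real k * (\<Sum>b\<in>{b \<in> K. \<forall>j. min (a j) (a' j) \<le> b j \<and> b j \<le> max (a j) (a' j)}. G b)"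
  using assms
proof (induction k arbitrary: a a')
  case 0
  then have "(\<Sum>j\<in>J. \<bar>a j - a' j\<bar>) = 0" by (intro antisym sum_nonneg) auto
  then have "a = a'"
    using sum_nonneg_eq_0_iff[of J "\<lambda>j. \<bar>a j - a' j\<bar>"] fin supp[OF 0(1)] supp[OF 0(2)]
    by (intro ext) force
  then show ?case by simp
next
  case (Suc k)
  let ?box = "\<lambda>a a'. {b \<in> K. \<forall>j. min (a j) (a' j) \<le> b j \<and> b j \<le> max (a j) (a' j)}"
  have Gb: "0 \<le> (\<Sum>b\<in>?box a a'. G b)" for a a' by (rule sum_nonneg) (use G in auto)
  have shrink: "m * (F a - F a')\<^sup>2 \<le> real (Suc k) * (\<Sum>b\<in>?box a a'. G b)"
    if a: "a \<in> K" "a' \<in> K" "shift l l' a \<in> K" "m \<le> w a" "m \<le> w a'" "m \<le> w (shift l l' a)"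
      and l: "l \<in> J" "l' \<in> J" "a l < a' l" "a' l' < a l'"
      and d: "(\<Sum>j\<in>J. \<bar>a j - a' j\<bar>) \<le> 2 * int (Suc k)" for a a' l l'
  proof -
    define c where "c = shift l l' a"
    have ll: "l \<noteq> l'" using l by auto
    \<comment> \<open>A shift reduces two coordinate differences by one each, so the budget 2k
      allows k moves.\<close>
    have "(\<Sum>j\<in>J. \<bar>c j - a' j\<bar>) + 2 = (\<Sum>j\<in>J. \<bar>c j - a' j\<bar> + (if j = l then 1 else 0) + (if j = l' then 1 else 0))"
      using fin l by (simp add: sum.distrib)
    also have "\<dots> = (\<Sum>j\<in>J. \<bar>a j - a' j\<bar>)"
      by (rule sum.cong) (use l ll in \<open>auto simp: c_def shift_def\<close>)
    finally have "(\<Sum>j\<in>J. \<bar>c j - a' j\<bar>) \<le> 2 * int k" using d by simp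
    then have ih: "m * (F c - F a')\<^sup>2 \<le> real k * (\<Sum>b\<in>?box c a'. G b)"
      using Suc.IH[of c a'] a Suc.prems(4) by (simp add: c_def)
    have "m * (F a - F c)\<^sup>2 \<le> min (w a) (w c) * (F a - F c)\<^sup>2"
      using a by (intro mult_right_mono) (auto simp: c_def)
    also have "\<dots> \<le> G a" unfolding c_def using edge[OF a(1) l(1,2) ll a(3)] .
    finally have e: "m * (F a - F c)\<^sup>2 \<le> G a" .
    have "m * ((F a - F c) + (F c - F a'))\<^sup>2 \<le> real (Suc k) * (G a + (\<Sum>b\<in>?box c a'. G b))"
      by (rule square_add_weighted_le[OF Suc.prems(4) e ih Gb])
    also have "G a + (\<Sum>b\<in>?box c a'. G b) = (\<Sum>b\<in>insert a (?box c a'). G b)"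
    proof -
      \<comment> \<open>At coordinate l both \<open>c\<close> and \<open>a'\<close> lie strictly
        above \<open>a\<close>, so \<open>a\<close> is not charged again later.\<close>
      have "a \<notin> ?box c a'"
      proof
        assume "a \<in> ?box c a'"
        then have "min (c l) (a' l) \<le> a l" by blast
        then show False using l ll by (simp add: c_def shift_def)
      qed
      then show ?thesis using fin by simp
    qed
    also have "\<dots> \<le> (\<Sum>b\<in>?box a a'. G b)"
    proof (rule sum_mono2)
      have c_between: "min (a j) (a' j) \<le> c j \<and> c j \<le> max (a j) (a' j)" for j
        using l ll by (auto simp: c_def shift_def)
      show "insert a (?box c a') \<subseteq> ?box a a'"
      proof (rule subsetI)
        fix b assume b: "b \<in> insert a (?box c a')"
        show "b \<in> ?box a a'"
        proof (cases "b = a")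
          case False
          then have "b \<in> ?box c a'" using b by auto
          moreover have "min (a j) (a' j) \<le> b j \<and> b j \<le> max (a j) (a' j)"
            if "min (c j) (a' j) \<le> b j \<and> b j \<le> max (c j) (a' j)" for j
            using that c_between[of j] by linarith
          ultimately show ?thesis by blast
        qed (use a in auto)
      qed
    qed (use fin G in auto)
    finally show ?thesis by (simp add: mult_left_mono)
  qed
  show ?case
  proof (cases "a = a'")
    case True
    then show ?thesis using Gb[of a' a'] by simp
  next
    case False
    \<comment> \<open>Equal totals force distinct labels to differ in both directions, which
      supplies l and l'.\<close>
    have tot: "(\<Sum>j\<in>J. a j - a' j) = 0" using total Suc.prems by (simp add: sum_subtractf)
    obtain j where j: "a j \<noteq> a' j" using False by auto
    then have jJ: "j \<in> J" using supp Suc.prems by metis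
    have "\<exists>l\<in>J. a l < a' l"
    proof (rule ccontr)
      assume "\<not> ?thesis"
      then have "\<forall>j\<in>J. a j - a' j = 0"
        using tot sum_nonneg_eq_0_iff[of J "\<lambda>j. a j - a' j"] fin by force
      then show False using j jJ by simp
    qed
    moreover have "\<exists>l\<in>J. a' l < a l"
    proof (rule ccontr)
      assume "\<not> ?thesis"
      moreover have "(\<Sum>j\<in>J. a' j - a j) = 0" using tot by (simp add: sum_subtractf)
      ultimately have "\<forall>j\<in>J. a' j - a j = 0"
        using sum_nonneg_eq_0_iff[of J "\<lambda>j. a' j - a j"] fin by force
      then show False using j jJ by simp
    qed
    ultimately obtain l l' where l: "l \<in> J" "l' \<in> J" "a l < a' l" "a' l' < a l'" by blast
    from step[OF Suc.prems(1,2) l] show ?thesis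
    proof
      assume "shift l l' a \<in> K \<and> w a \<le> w (shift l l' a)"
      then show ?thesis using shrink[OF Suc.prems(1,2) _ Suc.prems(5,6) _ l Suc.prems(3)] Suc.prems(5) by simp
    next
      assume *: "shift l' l a' \<in> K \<and> w a' \<le> w (shift l' l a')"
      have "m * (F a' - F a)\<^sup>2 \<le> real (Suc k) * (\<Sum>b\<in>?box a' a. G b)"
        by (rule shrink[OF Suc.prems(2,1) _ Suc.prems(6,5) _ l(2,1,4,3)])
           (use * Suc.prems in \<open>auto simp: abs_minus_commute\<close>)
      then show ?thesis by (simp add: power2_commute min.commute max.commute)
    qed
  qed
qed

text \<open>The product of two weights is their maximum times their minimum. The minimum is what
  \<open>path_le\<close> can carry along the path; the maximum is at most the sum, which leaves
  \<open>card K\<close> times the total weight.\<close>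

lemma weighted_variance_le:
  assumes "\<And>a a'. a \<in> K \<Longrightarrow> a' \<in> K \<Longrightarrow> (\<Sum>j\<in>J. \<bar>a j - a' j\<bar>) \<le> 2 * int k"
  shows "(\<Sum>a\<in>K. \<Sum>a'\<in>K. w a * w a' * (F a - F a')\<^sup>2) \<le> 2 * real (card K) * (\<Sum>a\<in>K. w a) * (real k * (\<Sum>a\<in>K. G a))"
proof -
  let ?S = "real k * (\<Sum>a\<in>K. G a)"
  have "(\<Sum>a\<in>K. \<Sum>a'\<in>K. w a * w a' * (F a - F a')\<^sup>2) \<le> (\<Sum>a\<in>K. \<Sum>a'\<in>K. (w a + w a') * ?S)"
  proof (intro sum_mono)
    fix a a' assume a: "a \<in> K" "a' \<in> K"
    have "w a * w a' = max (w a) (w a') * min (w a) (w a')" by (simp add: max_def min_def)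
    then have "w a * w a' * (F a - F a')\<^sup>2 = max (w a) (w a') * (min (w a) (w a') * (F a - F a')\<^sup>2)" by simp
    also have "\<dots> \<le> (w a + w a') * ?S"
    proof (rule mult_mono)
      show "max (w a) (w a') \<le> w a + w a'" using w a by (auto simp: max_def)
      have "min (w a) (w a') * (F a - F a')\<^sup>2 \<le>
          real k * (\<Sum>b\<in>{b \<in> K. \<forall>j. min (a j) (a' j) \<le> b j \<and> b j \<le> max (a j) (a' j)}. G b)"
        by (rule path_le[OF a assms[OF a]]) (use w a in auto)
      also have "\<dots> \<le> ?S"
        by (intro mult_left_mono sum_mono2) (use fin G in auto)
      finally show "min (w a) (w a') * (F a - F a')\<^sup>2 \<le> ?S" .
    qed (use w a in auto)
    finally show "w a * w a' * (F a - F a')\<^sup>2 \<le> (w a + w a') * ?S" .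
  qed
  also have "\<dots> = (\<Sum>a\<in>K. \<Sum>a'\<in>K. w a + w a') * ?S" by (simp only: sum_distrib_right)
  also have "(\<Sum>a\<in>K. \<Sum>a'\<in>K. w a + w a') = 2 * real (card K) * (\<Sum>a\<in>K. w a)"
    by (simp add: sum.distrib flip: sum_distrib_left)
  finally show ?thesis .
qed

end

text \<open>A crude law of total variance: the difference is routed through the two cell means, the
  square of three summands costs 3, and the two within-cell terms coincide by symmetry.\<close>

lemma sum_sum_diff_square_partition_le:
  fixes f :: "'a \<Rightarrow> real" and c :: "'a \<Rightarrow> 'b"
  assumes Y: "finite Y"
  defines "C \<equiv> \<lambda>b. {y \<in> Y. c y = b}"
  defines "F \<equiv> \<lambda>b. (\<Sum>y\<in>C b. f y) / real (card (C b))"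
  shows "(\<Sum>y\<in>Y. \<Sum>y'\<in>Y. (f y - f y')\<^sup>2) \<le>
    6 * real (card Y) * (\<Sum>b\<in>c ` Y. \<Sum>y\<in>C b. (f y - F b)\<^sup>2)
    + 3 * (\<Sum>b\<in>c ` Y. \<Sum>b'\<in>c ` Y. real (card (C b)) * real (card (C b')) * (F b - F b')\<^sup>2)"
proof -
  have group: "(\<Sum>y\<in>Y. h y) = (\<Sum>b\<in>c ` Y. \<Sum>y\<in>C b. h y)" for h :: "'a \<Rightarrow> real"
    unfolding C_def by (rule sum.group[symmetric]) (use Y in auto)
  have cC: "c y = b" if "y \<in> C b" for y b using that by (simp add: C_def)
  have "(\<Sum>y\<in>Y. \<Sum>y'\<in>Y. (f y - f y')\<^sup>2) \<le>
      (\<Sum>y\<in>Y. \<Sum>y'\<in>Y. 3 * ((f y - F (c y))\<^sup>2 + (F (c y) - F (c y'))\<^sup>2 + (f y' - F (c y'))\<^sup>2))"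
  proof (intro sum_mono)
    fix y y'
    show "(f y - f y')\<^sup>2 \<le> 3 * ((f y - F (c y))\<^sup>2 + (F (c y) - F (c y'))\<^sup>2 + (f y' - F (c y'))\<^sup>2)"
      using square_sum3_le[of "f y - F (c y)" "F (c y) - F (c y')" "F (c y') - f y'"]
      by (simp add: power2_commute[of "f y'"])
  qed
  also have "\<dots> = 6 * real (card Y) * (\<Sum>y\<in>Y. (f y - F (c y))\<^sup>2) + 3 * (\<Sum>y\<in>Y. \<Sum>y'\<in>Y. (F (c y) - F (c y'))\<^sup>2)"
    by (simp add: sum.distrib flip: sum_distrib_left)
  also have "(\<Sum>y\<in>Y. (f y - F (c y))\<^sup>2) = (\<Sum>b\<in>c ` Y. \<Sum>y\<in>C b. (f y - F b)\<^sup>2)"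
    unfolding group by (intro sum.cong refl) (simp add: cC)
  also have "(\<Sum>y\<in>Y. \<Sum>y'\<in>Y. (F (c y) - F (c y'))\<^sup>2) =
      (\<Sum>b\<in>c ` Y. \<Sum>y\<in>C b. \<Sum>b'\<in>c ` Y. \<Sum>y'\<in>C b'. (F b - F b')\<^sup>2)"
    unfolding group by (intro sum.cong refl) (simp add: cC)
  also have "\<dots> = (\<Sum>b\<in>c ` Y. \<Sum>b'\<in>c ` Y. real (card (C b)) * real (card (C b')) * (F b - F b')\<^sup>2)"
    by (simp add: sum_distrib_left mult.assoc)
  finally show ?thesis .
qed

section \<open>Reversibility and the two Dirichlet forms\<close>

lemma bonds_commute: "(x, y) \<in> bonds M \<longleftrightarrow> (y, x) \<in> bonds M"
proof -
  have "(\<chi> i. real_of_int ((y - x) $ i)) = - (\<chi> i. real_of_int ((x - y) $ i))"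
    by (simp add: vec_eq_iff)
  then have "lattice_norm (x - y) = lattice_norm (y - x)" by (simp add: lattice_norm_def)
  then show ?thesis by (auto simp: bonds_def)
qed

text \<open>One factor 2 is the symmetrisation by reversibility. The other arises because
  \<open>bonds\<close> contains both orders of a bond: their rates add up to 1 when the occupations
  differ, and otherwise the exchange is the identity.\<close>

lemma exchange_dirichlet_form:
  fixes Y :: "('d::finite) config set"
  assumes Y: "finite Y" "Y \<subseteq> configs V M"
    and closed: "\<And>x y v \<eta>. v \<in> V \<Longrightarrow> x \<in> Lam M \<Longrightarrow> y \<in> Lam M \<Longrightarrow> \<eta> \<in> Y \<Longrightarrow> exchange x y v \<eta> \<in> Y"
  shows "4 * (\<Sum>\<eta>\<in>Y. f \<eta> * - L_ex V M f \<eta>) = bond_energy f V M Y"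
proof -
  let ?c = "\<lambda>\<eta> v x y. \<eta> x v * (1 - \<eta> y v)" and ?g = "\<lambda>x y v \<eta>. exchange x y v \<eta>"
  have sym: "(\<Sum>(x, y)\<in>bonds M. h x y) = (\<Sum>(x, y)\<in>bonds M. h y x)" for h :: "int^'d \<Rightarrow> int^'d \<Rightarrow> real"
    by (rule sum.reindex_bij_witness[where i = prod.swap and j = prod.swap]) (auto simp: bonds_commute)
  have v: "4 * (\<Sum>(x, y)\<in>bonds M. \<Sum>\<eta>\<in>Y. f \<eta> * (?c \<eta> v x y * (f \<eta> - f (?g x y v \<eta>)))) =
    (\<Sum>(x, y)\<in>bonds M. \<Sum>\<eta>\<in>Y. (f (?g x y v \<eta>) - f \<eta>)\<^sup>2)" if v: "v \<in> V" for v
  proof -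
    define P where "P = (\<lambda>x y. \<Sum>\<eta>\<in>Y. f \<eta> * (?c \<eta> v x y * (f \<eta> - f (?g x y v \<eta>))))"
    define S where "S = (\<lambda>x y. \<Sum>\<eta>\<in>Y. ?c \<eta> v x y * (f \<eta> - f (?g x y v \<eta>))\<^sup>2)"
    \<comment> \<open>Substituting the exchanged configuration interchanges x and y in the
      rate.\<close>
    have Q: "P x y = (\<Sum>\<eta>\<in>Y. f (?g x y v \<eta>) * (?c \<eta> v y x * (f (?g x y v \<eta>) - f \<eta>)))"
      if "x \<in> Lam M" "y \<in> Lam M" for x y
    proof -
      have "bij_betw (?g x y v) Y Y"
        by (rule bij_betw_involution) (use closed that v exchange_exchange in auto)
      then have "P x y = (\<Sum>\<eta>\<in>Y. f (?g x y v \<eta>) * (?c (?g x y v \<eta>) v x y * (f (?g x y v \<eta>) - f (?g x y v (?g x y v \<eta>)))))"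
        unfolding P_def by (rule sum.reindex_bij_betw[symmetric])
      also have "\<dots> = (\<Sum>\<eta>\<in>Y. f (?g x y v \<eta>) * (?c \<eta> v y x * (f (?g x y v \<eta>) - f \<eta>)))"
        unfolding exchange_exchange by (intro sum.cong refl) (simp add: exchange_apply)
      finally show ?thesis .
    qed
    have PS: "P x y + P y x = S y x" if "x \<in> Lam M" "y \<in> Lam M" for x y
      unfolding Q[OF that] unfolding P_def S_def exchange_commute[of y x]
      by (simp add: sum.distrib[symmetric] power2_eq_square algebra_simps)
    have "2 * (\<Sum>(x, y)\<in>bonds M. P x y) = (\<Sum>(x, y)\<in>bonds M. P x y + P y x)"
      using sym[of P] by (simp add: sum.distrib split_def)
    also have "\<dots> = (\<Sum>(x, y)\<in>bonds M. S y x)"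
      by (intro sum.cong refl) (auto simp: PS bonds_def)
    finally have 2: "2 * (\<Sum>(x, y)\<in>bonds M. P x y) = (\<Sum>(x, y)\<in>bonds M. S y x)" .
    have "4 * (\<Sum>(x, y)\<in>bonds M. P x y) = (\<Sum>(x, y)\<in>bonds M. S x y) + (\<Sum>(x, y)\<in>bonds M. S y x)"
      using 2 sym[of S] by simp
    also have "\<dots> = (\<Sum>(x, y)\<in>bonds M. S x y + S y x)" by (simp add: sum.distrib split_def)
    also have "\<dots> = (\<Sum>(x, y)\<in>bonds M. \<Sum>\<eta>\<in>Y. (f (?g x y v \<eta>) - f \<eta>)\<^sup>2)"
    proof (intro sum.cong refl, clarify)
      fix x y :: "int^'d" assume b: "(x, y) \<in> bonds M"
      have "(?c \<eta> v x y + ?c \<eta> v y x) * (f \<eta> - f (?g x y v \<eta>))\<^sup>2 = (f (?g x y v \<eta>) - f \<eta>)\<^sup>2" if "\<eta> \<in> Y" for \<eta>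
      proof (cases "\<eta> x v = \<eta> y v")
        case True
        then have "?g x y v \<eta> = \<eta>" by (intro ext) (auto simp: exchange_apply)
        then show ?thesis by simp
      next
        case False
        moreover have "\<eta> x v = 0 \<or> \<eta> x v = 1" "\<eta> y v = 0 \<or> \<eta> y v = 1"
          using that Y(2) b v by (auto simp: bonds_def configs_iff subset_iff)
        ultimately show ?thesis by (auto simp: power2_commute)
      qed
      then show "S x y + S y x = (\<Sum>\<eta>\<in>Y. (f (?g x y v \<eta>) - f \<eta>)\<^sup>2)"
        unfolding S_def exchange_commute[of y x] sum.distrib[symmetric] distrib_right[symmetric] by simp
    qed
    finally show ?thesis by (simp add: P_def)
  qed
  have "(\<Sum>\<eta>\<in>Y. f \<eta> * - L_ex V M f \<eta>) =
      (\<Sum>\<eta>\<in>Y. \<Sum>v\<in>V. \<Sum>b\<in>bonds M. f \<eta> * (?c \<eta> v (fst b) (snd b) * (f \<eta> - f (?g (fst b) (snd b) v \<eta>))))"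
  proof (rule sum.cong[OF refl])
    fix \<eta>
    have "- L_ex V M f \<eta> = (\<Sum>v\<in>V. \<Sum>b\<in>bonds M. ?c \<eta> v (fst b) (snd b) * (f \<eta> - f (?g (fst b) (snd b) v \<eta>)))"
      unfolding L_ex_def bonds_def sum_negf[symmetric] split_def
      by (intro sum.cong refl) (simp add: algebra_simps)
    then show "f \<eta> * - L_ex V M f \<eta> = (\<Sum>v\<in>V. \<Sum>b\<in>bonds M. f \<eta> * (?c \<eta> v (fst b) (snd b) * (f \<eta> - f (?g (fst b) (snd b) v \<eta>))))"
      by (simp only: sum_distrib_left)
  qed
  also have "\<dots> = (\<Sum>v\<in>V. \<Sum>b\<in>bonds M. \<Sum>\<eta>\<in>Y. f \<eta> * (?c \<eta> v (fst b) (snd b) * (f \<eta> - f (?g (fst b) (snd b) v \<eta>))))"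
    by (subst sum.swap) (intro sum.cong refl sum.swap)
  also have "4 * \<dots> = bond_energy f V M Y"
    unfolding bond_energy_def sum_distrib_left[of 4 _ V] using v by (simp add: split_def)
  finally show ?thesis .
qed

text \<open>A collision and its reverse both belong to \<open>collisions V\<close> and carry the two
  halves of the square. The rate has to stay in \<open>coll_energy\<close>, as
  \<open>collide\<close> has a meaning only where it is 1.\<close>

lemma collision_dirichlet_form:
  fixes Y :: "('d::finite) config set"
  assumes V: "finite V" and Y: "finite Y" "Y \<subseteq> configs V M"
    and closed: "\<And>q x \<eta>. q \<in> collisions V \<Longrightarrow> x \<in> Lam M \<Longrightarrow> \<eta> \<in> Y \<Longrightarrow> coll_rate x q \<eta> = 1 \<Longrightarrow> collide x q \<eta> \<in> Y"
  shows "2 * (\<Sum>\<eta>\<in>Y. f \<eta> * - L_coll V M f \<eta>) = (\<Sum>q\<in>collisions V. coll_energy f M q Y)"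
proof -
  let ?r = "\<lambda>q. case q of (v, w, v', w') \<Rightarrow> (v', w', v, w)"
  define P where "P = (\<lambda>q. \<Sum>x\<in>Lam M. \<Sum>\<eta>\<in>Y. coll_rate x q \<eta> * (f \<eta> * (f \<eta> - f (collide x q \<eta>))))"
  define Q where "Q = (\<lambda>q. \<Sum>x\<in>Lam M. \<Sum>\<eta>\<in>Y. coll_rate x q \<eta> * (f (collide x q \<eta>) * (f (collide x q \<eta>) - f \<eta>)))"
  have rC: "?r q \<in> collisions V" if "q \<in> collisions V" for q using that by (auto simp: collisions_def)
  have PQ: "P q = Q (?r q)" if q: "q \<in> collisions V" for q
  proof -
    obtain v w v' w' where q': "q = (v, w, v', w')" by (cases q)
    have V4: "v \<in> V" "w \<in> V" "v' \<in> V" "w' \<in> V" using q q' by (auto simp: collisions_def)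
    show ?thesis unfolding P_def Q_def q' split_conv
    proof (rule sum.cong[OF refl])
      fix x :: "int^'d" assume x: "x \<in> Lam M"
      show "(\<Sum>\<eta>\<in>Y. coll_rate x (v, w, v', w') \<eta> * (f \<eta> * (f \<eta> - f (collide x (v, w, v', w') \<eta>)))) =
        (\<Sum>\<eta>\<in>Y. coll_rate x (v', w', v, w) \<eta> * (f (collide x (v', w', v, w) \<eta>) * (f (collide x (v', w', v, w) \<eta>) - f \<eta>)))"
        by (rule sum_collision_reverse[where h = "\<lambda>\<eta> \<zeta>. f \<eta> * (f \<eta> - f \<zeta>)", OF x V4 Y(1,1,2,2)])
           (use closed q rC[OF q] q' x in auto)
    qed
  qed
  have "(\<Sum>q\<in>collisions V. P q) = (\<Sum>q\<in>collisions V. Q q)"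
    by (rule sum.reindex_bij_witness[where i = ?r and j = ?r]) (use rC PQ in auto)
  then have "2 * (\<Sum>q\<in>collisions V. P q) = (\<Sum>q\<in>collisions V. P q + Q q)" by (simp add: sum.distrib)
  also have "\<dots> = (\<Sum>q\<in>collisions V. coll_energy f M q Y)"
    unfolding P_def Q_def coll_energy_def sum.distrib[symmetric]
    by (intro sum.cong refl) (simp add: power2_eq_square algebra_simps)
  also have "(\<Sum>q\<in>collisions V. P q) = (\<Sum>\<eta>\<in>Y. f \<eta> * - L_coll V M f \<eta>)"
  proof -
    have "(\<Sum>\<eta>\<in>Y. f \<eta> * - L_coll V M f \<eta>) =
        (\<Sum>\<eta>\<in>Y. \<Sum>q\<in>collisions V. \<Sum>x\<in>Lam M. coll_rate x q \<eta> * (f \<eta> * (f \<eta> - f (collide x q \<eta>))))"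
      unfolding L_coll_def sum_negf[symmetric] sum_distrib_left
      by (intro sum.cong refl) (simp add: algebra_simps)
    also have "\<dots> = (\<Sum>q\<in>collisions V. P q)"
      unfolding P_def by (subst sum.swap) (intro sum.cong refl sum.swap)
    finally show ?thesis by simp
  qed
  finally show ?thesis .
qed

subsection \<open>Velocities without integer relations\<close>

text \<open>With the configuration as outermost index, additivity over a partition is plain grouping
  of a sum.\<close>

lemma bond_energy_alt:
  "bond_energy f V M Z = (\<Sum>\<eta>\<in>Z. \<Sum>v\<in>V. \<Sum>(x, y)\<in>bonds M. (f (exchange x y v \<eta>) - f \<eta>)\<^sup>2)"
  unfolding bond_energy_def split_def
  by (subst (2) sum.swap) (intro sum.cong refl sum.swap)

lemma coll_energy_alt:
  "coll_energy f M q Z = (\<Sum>\<eta>\<in>Z. \<Sum>x\<in>Lam M. coll_rate x q \<eta> * (f (collide x q \<eta>) - f \<eta>)\<^sup>2)"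
  unfolding coll_energy_def by (rule sum.swap)

lemma sum_bond_energy_partition:
  "finite Y \<Longrightarrow> (\<Sum>b\<in>c ` Y. bond_energy f V M {\<eta> \<in> Y. c \<eta> = b}) = bond_energy f V M Y"
  unfolding bond_energy_alt by (rule sum.group) auto

lemma sum_coll_energy_partition:
  "finite Y \<Longrightarrow> (\<Sum>b\<in>c ` Y. coll_energy f M q {\<eta> \<in> Y. c \<eta> = b}) = coll_energy f M q Y"
  unfolding coll_energy_alt by (rule sum.group) auto

lemma coll_energy_nonneg:
  assumes "Z \<subseteq> configs V M" "q \<in> collisions V"
  shows "0 \<le> coll_energy f M q Z"
proof -
  obtain v w v' w' where q: "q = (v, w, v', w')" by (cases q)
  then have "v \<in> V" "w \<in> V" "v' \<in> V" "w' \<in> V" using assms by (auto simp: collisions_def)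
  then show ?thesis unfolding coll_energy_def q
    using coll_rate_cases[of _ V M _ v w v' w'] assms
    by (intro sum_nonneg mult_nonneg_nonneg) (auto simp: subset_iff)
qed

lemma finite_collisions: "finite V \<Longrightarrow> finite (collisions V)"
  by (rule finite_subset[of _ "V \<times> V \<times> V \<times> V"]) (auto simp: collisions_def)

lemma mean_invariants_occupation:
  fixes V :: "(real^'d) set"
  assumes "finite V" "\<eta> \<in> configs V M"
  shows "mean_invariants V M \<eta> =
    (1 / real (card (Lam M :: (int^'d) set))) *\<^sub>R (\<Sum>u\<in>V. real (occupation M u \<eta>) *\<^sub>R bvec u)"
proof -
  have "(\<Sum>z\<in>Lam M. invariants V (\<eta> z)) = (\<Sum>u\<in>V. (\<Sum>z\<in>Lam M. \<eta> z u) *\<^sub>R bvec u)"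
    unfolding invariants_def scaleR_left.sum by (rule sum.swap)
  also have "\<dots> = (\<Sum>u\<in>V. real (occupation M u \<eta>) *\<^sub>R bvec u)"
    by (intro sum.cong refl) (use sum_occupation(1)[of \<eta> V M "\<lambda>u. occupation M u \<eta>"] assms in \<open>simp add: occupation_class_def\<close>)
  finally show ?thesis by (simp add: mean_invariants_def)
qed

text \<open>\<open>bvec\<close> holds number and momentum together, so conservation is one vector
  equation. Real-valued counts avoid truncated subtraction.\<close>

lemma sum_bvec_collision:
  fixes V :: "(real^'d) set"
  assumes V: "finite V" "v \<in> V" "w \<in> V" "v' \<in> V" "w' \<in> V" and mom: "v + w = v' + w'"
    and N: "\<And>u. u \<in> V \<Longrightarrow> N' u = N u - (if u = v then 1 else 0) - (if u = w then 1 else 0)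
      + (if u = v' then 1 else 0) + (if u = w' then (1::real) else 0)"
  shows "(\<Sum>u\<in>V. N' u *\<^sub>R bvec u) = (\<Sum>u\<in>V. N u *\<^sub>R bvec u)"
proof -
  have d: "(\<Sum>u\<in>V. (if u = a then 1 else 0 :: real) *\<^sub>R bvec u) = bvec a" if "a \<in> V" for a
    using V(1) that by (simp add: if_distrib[of "\<lambda>c. c *\<^sub>R _"] cong: if_cong)
  have b: "bvec v + bvec w = bvec v' + bvec w'"
    using mom by (auto simp: vec_eq_iff bvec_def split: option.splits)
  have "(\<Sum>u\<in>V. N' u *\<^sub>R bvec u) = (\<Sum>u\<in>V. N u *\<^sub>R bvec u - (if u = v then 1 else 0 :: real) *\<^sub>R bvec u - (if u = w then 1 else 0 :: real) *\<^sub>R bvec u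
      + (if u = v' then 1 else 0 :: real) *\<^sub>R bvec u + (if u = w' then 1 else 0 :: real) *\<^sub>R bvec u)"
    by (intro sum.cong refl) (simp only: N scaleR_left_diff_distrib scaleR_left_distrib)
  also have "\<dots> = (\<Sum>u\<in>V. N u *\<^sub>R bvec u) - bvec v - bvec w + bvec v' + bvec w'"
    by (simp only: sum.distrib sum_subtractf d V)
  also have "\<dots> = (\<Sum>u\<in>V. N u *\<^sub>R bvec u) - (bvec v + bvec w) + (bvec v' + bvec w')"
    by simp
  finally show ?thesis by (simp add: b)
qed

lemma occupation_class_cong:
  "(\<And>u. u \<in> V \<Longrightarrow> N u = N' u) \<Longrightarrow> occupation_class V M N = occupation_class V M N'"
  by (auto simp: occupation_class_def)

locale paired_velocities =
  fixes n :: nat and vstar :: "real^'d" and v :: "nat \<Rightarrow> real^'d" and V :: "(real^'d) set"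
  assumes n: "n \<ge> 1" and V_def: "V = velocities n vstar v" and indep: "int_independent n v"
begin

definition up :: "nat \<Rightarrow> real^'d" where "up l = vstar + v l"
definition dn :: "nat \<Rightarrow> real^'d" where "dn l = vstar - v l"

lemma V_eq: "V = up ` {1..n} \<union> dn ` {1..n}"
  by (auto simp: V_def velocities_def up_def dn_def)

lemma finite_V: "finite V" by (simp add: V_eq)

lemma up_mem: "l \<in> {1..n} \<Longrightarrow> up l \<in> V" and dn_mem: "l \<in> {1..n} \<Longrightarrow> dn l \<in> V"
  by (auto simp: V_eq)

lemma int_combination_zero:
  "(\<Sum>l=1..n. real_of_int (\<alpha> l) *\<^sub>R v l) = 0 \<Longrightarrow> l \<in> {1..n} \<Longrightarrow> \<alpha> l = 0"
  using indep unfolding int_independent_def by blast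

lemma V_cases:
  assumes "u \<in> V"
  obtains \<sigma> :: int and l where "\<sigma> = 1 \<or> \<sigma> = -1" "l \<in> {1..n}" "u = vstar + real_of_int \<sigma> *\<^sub>R v l"
proof -
  from assms consider l where "l \<in> {1..n}" "u = up l" | l where "l \<in> {1..n}" "u = dn l" by (auto simp: V_eq)
  then show ?thesis
  proof cases
    case 1 then show ?thesis using that[of 1 l] by (simp add: up_def)
  next
    case 2 then show ?thesis using that[of "-1" l] by (simp add: dn_def)
  qed
qed

lemma sum_single:
  "l \<in> {1..n} \<Longrightarrow> (\<Sum>j=1..n. real_of_int (if j = l then c else 0) *\<^sub>R v j) = real_of_int c *\<^sub>R v l"
  by (simp add: if_distrib[of "\<lambda>c. real_of_int c *\<^sub>R _"] cong: if_cong)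

text \<open>In an integer relation with two entries of size one, these cancel only if index and sign
  agree. This makes the 2n velocities distinct.\<close>

lemma signed_inj:
  assumes s: "\<sigma> = 1 \<or> \<sigma> = -1" "\<tau> = 1 \<or> \<tau> = (-1::int)" and l: "l \<in> {1..n}" "k \<in> {1..n}"
    and eq: "real_of_int \<sigma> *\<^sub>R v l = real_of_int \<tau> *\<^sub>R v k"
  shows "l = k \<and> \<sigma> = \<tau>"
proof -
  define \<alpha> where "\<alpha> = (\<lambda>j. (if j = l then \<sigma> else 0) - (if j = k then \<tau> else 0))"
  have "(\<Sum>j=1..n. real_of_int (\<alpha> j) *\<^sub>R v j) = 0"
    unfolding \<alpha>_def of_int_diff scaleR_left_diff_distrib sum_subtractf
    by (simp only: sum_single l eq) simp
  from int_combination_zero[OF this l(1)] show ?thesis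
    using s by (auto simp: \<alpha>_def split: if_splits)
qed

text \<open>An entry of size 2 can be cancelled only by both unit entries together. Hence no
  collision of positive rate repeats a velocity on either side, where \<open>collide\<close> might
  break the conservation laws.\<close>

lemma double_velocity:
  assumes "u \<in> V" "a \<in> V" "b \<in> V" "u + u = a + b"
  shows "a = u" "b = u"
proof -
  obtain \<sigma> l where u: "\<sigma> = 1 \<or> \<sigma> = -1" "l \<in> {1..n}" "u = vstar + real_of_int \<sigma> *\<^sub>R v l" using V_cases assms(1) by metis
  obtain \<tau> k where a: "\<tau> = 1 \<or> \<tau> = -1" "k \<in> {1..n}" "a = vstar + real_of_int \<tau> *\<^sub>R v k" using V_cases assms(2) by metis
  obtain \<rho> m where b: "\<rho> = 1 \<or> \<rho> = -1" "m \<in> {1..n}" "b = vstar + real_of_int \<rho> *\<^sub>R v m" using V_cases assms(3) by metis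
  have *: "x + x - y - z = (s + x + (s + x)) - (s + y + (s + z))" for s x y z :: "'c::ab_group_add"
    by (simp add: algebra_simps)
  define \<alpha> where "\<alpha> = (\<lambda>j. (if j = l then 2 * \<sigma> else 0) - (if j = k then \<tau> else 0) - (if j = m then \<rho> else 0))"
  have "(\<Sum>j=1..n. real_of_int (\<alpha> j) *\<^sub>R v j) = real_of_int (2 * \<sigma>) *\<^sub>R v l - real_of_int \<tau> *\<^sub>R v k - real_of_int \<rho> *\<^sub>R v m"
    unfolding \<alpha>_def of_int_diff scaleR_left_diff_distrib sum_subtractf
    by (simp only: sum_single u a b)
  also have "\<dots> = real_of_int \<sigma> *\<^sub>R v l + real_of_int \<sigma> *\<^sub>R v l - real_of_int \<tau> *\<^sub>R v k - real_of_int \<rho> *\<^sub>R v m"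
    by (simp flip: scaleR_left_distrib)
  also have "\<dots> = (u + u) - (a + b)"
    unfolding u(3) a(3) b(3) by (rule *)
  finally have "(\<Sum>j=1..n. real_of_int (\<alpha> j) *\<^sub>R v j) = 0" using assms(4) by simp
  from int_combination_zero[OF this u(2)] have "k = l \<and> \<tau> = \<sigma> \<and> m = l \<and> \<rho> = \<sigma>"
    using u(1) a(1) b(1) by (auto simp: \<alpha>_def split: if_splits)
  then show "a = u" "b = u" using u a b by auto
qed

lemma up_eq_iff: "l \<in> {1..n} \<Longrightarrow> k \<in> {1..n} \<Longrightarrow> up l = up k \<longleftrightarrow> l = k"
  using signed_inj[of 1 1 l k] by (auto simp: up_def)

lemma dn_eq_iff: "l \<in> {1..n} \<Longrightarrow> k \<in> {1..n} \<Longrightarrow> dn l = dn k \<longleftrightarrow> l = k"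
  using signed_inj[of 1 1 l k] by (auto simp: dn_def)

lemma up_neq_dn: "l \<in> {1..n} \<Longrightarrow> k \<in> {1..n} \<Longrightarrow> up l \<noteq> dn k"
  using signed_inj[of 1 "-1" l k] by (auto simp: up_def dn_def diff_conv_add_uminus simp del: add_uminus_conv_diff)

lemma inj_up: "inj_on up {1..n}" and inj_dn: "inj_on dn {1..n}"
  by (auto intro!: inj_onI simp: up_eq_iff dn_eq_iff)

lemma up_dn_disjoint: "up ` {1..n} \<inter> dn ` {1..n} = {}"
  using up_neq_dn by auto

lemma card_V: "card V = 2 * n"
  unfolding V_eq by (subst card_Un_disjoint[OF _ _ up_dn_disjoint]) (simp_all add: card_image inj_up inj_dn del: One_nat_def)

lemma sum_V: "(\<Sum>u\<in>V. h u) = (\<Sum>l=1..n. h (up l) + h (dn l))" for h :: "real^'d \<Rightarrow> 'c::comm_monoid_add"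
  unfolding V_eq
  by (subst sum.union_disjoint[OF _ _ up_dn_disjoint]) (simp_all add: sum.reindex inj_up inj_dn sum.distrib del: One_nat_def)

text \<open>Let \<open>e\<close> be the difference of the occupation numbers. Momentum minus mass
  times \<open>vstar\<close> is the combination of the vectors v l with integer coefficients e (up
  l) - e (dn l), so independence makes each of them vanish; conservation of mass then yields the
  total.\<close>

lemma conserved:
  assumes \<eta>: "\<eta> \<in> level_set V M i" "\<eta>' \<in> level_set V M i"
  shows "l \<in> {1..n} \<Longrightarrow> int (occupation M (up l) \<eta>) - int (occupation M (dn l) \<eta>) =
      int (occupation M (up l) \<eta>') - int (occupation M (dn l) \<eta>')"
    and "(\<Sum>l=1..n. int (occupation M (dn l) \<eta>)) = (\<Sum>l=1..n. int (occupation M (dn l) \<eta>'))"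
proof -
  define e where "e = (\<lambda>u. int (occupation M u \<eta>) - int (occupation M u \<eta>'))"
  have L: "real (card (Lam M :: (int^'d) set)) \<noteq> 0" by (simp add: card_Lam)
  have "(\<Sum>u\<in>V. real (occupation M u \<eta>) *\<^sub>R bvec u) = (\<Sum>u\<in>V. real (occupation M u \<eta>') *\<^sub>R bvec u)"
    using \<eta> L mean_invariants_occupation[OF finite_V, of \<eta> M] mean_invariants_occupation[OF finite_V, of \<eta>' M]
    by (simp add: level_set_def)
  then have z: "(\<Sum>u\<in>V. real_of_int (e u) *\<^sub>R bvec u) = 0"
    by (simp add: e_def scaleR_left_diff_distrib sum_subtractf)
  have "(\<Sum>u\<in>V. real_of_int (e u)) = 0"
    using arg_cong[OF z, of "\<lambda>x. x $ None"] by (simp add: bvec_def)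
  then have e0: "(\<Sum>u\<in>V. e u) = 0" by (simp flip: of_int_sum)
  have ev: "(\<Sum>u\<in>V. real_of_int (e u) *\<^sub>R u) = 0"
    unfolding vec_eq_iff
  proof
    fix j show "(\<Sum>u\<in>V. real_of_int (e u) *\<^sub>R u) $ j = 0 $ j"
      using arg_cong[OF z, of "\<lambda>x. x $ Some j"] by (simp add: bvec_def)
  qed
  have "(\<Sum>u\<in>V. real_of_int (e u) *\<^sub>R u) = (\<Sum>u\<in>V. real_of_int (e u) *\<^sub>R (u - vstar)) + (\<Sum>u\<in>V. real_of_int (e u)) *\<^sub>R vstar"
    by (simp add: scaleR_right_diff_distrib sum_subtractf scaleR_left.sum)
  then have "(\<Sum>u\<in>V. real_of_int (e u) *\<^sub>R (u - vstar)) = 0" using ev e0 by (simp flip: of_int_sum)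
  then have "(\<Sum>l=1..n. real_of_int (e (up l) - e (dn l)) *\<^sub>R v l) = 0"
    unfolding sum_V by (simp add: up_def dn_def scaleR_left_diff_distrib)
  then have d: "e (up l) = e (dn l)" if "l \<in> {1..n}" for l
    using int_combination_zero[of "\<lambda>l. e (up l) - e (dn l)", OF _ that] by simp
  then show "l \<in> {1..n} \<Longrightarrow> int (occupation M (up l) \<eta>) - int (occupation M (dn l) \<eta>) =
      int (occupation M (up l) \<eta>') - int (occupation M (dn l) \<eta>')"
    unfolding e_def by fastforce
  have "(\<Sum>l=1..n. 2 * e (dn l)) = 0" using e0 d unfolding sum_V by simp
  then have "(\<Sum>l=1..n. e (dn l)) = 0" by (simp flip: sum_distrib_left)
  then show "(\<Sum>l=1..n. int (occupation M (dn l) \<eta>)) = (\<Sum>l=1..n. int (occupation M (dn l) \<eta>'))"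
    by (simp add: e_def sum_subtractf)
qed

lemma level_setI:
  assumes "\<eta> \<in> level_set V M i" "\<eta>' \<in> configs V M"
    and "(\<Sum>u\<in>V. real (occupation M u \<eta>') *\<^sub>R bvec u) = (\<Sum>u\<in>V. real (occupation M u \<eta>) *\<^sub>R bvec u)"
  shows "\<eta>' \<in> level_set V M i"
proof -
  have "\<eta> \<in> configs V M" using assms by (simp add: level_set_def)
  then have "mean_invariants V M \<eta>' = mean_invariants V M \<eta>"
    by (simp only: mean_invariants_occupation[OF finite_V] assms(2,3))
  then show ?thesis using assms by (simp add: level_set_def)
qed

lemma occupation_class_subset_level_set:
  assumes "\<eta> \<in> level_set V M i"
  shows "occupation_class V M (\<lambda>u. occupation M u \<eta>) \<subseteq> level_set V M i"
proof
  fix \<eta>' assume "\<eta>' \<in> occupation_class V M (\<lambda>u. occupation M u \<eta>)"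
  then show "\<eta>' \<in> level_set V M i"
    by (intro level_setI[OF assms]) (auto simp: occupation_class_def)
qed

lemma exchange_mem_level_set:
  assumes "u \<in> V" "x \<in> Lam M" "y \<in> Lam M" "\<eta> \<in> level_set V M i"
  shows "exchange x y u \<eta> \<in> level_set V M i"
proof -
  have "\<eta> \<in> occupation_class V M (\<lambda>u. occupation M u \<eta>)"
    using assms by (simp add: occupation_class_def level_set_def)
  then show ?thesis
    using exchange_mem_class assms occupation_class_subset_level_set by blast
qed

lemma collide_mem_level_set:
  assumes q: "q \<in> collisions V" and x: "x \<in> Lam M" and \<eta>: "\<eta> \<in> level_set V M i" and r: "coll_rate x q \<eta> = 1"
  shows "collide x q \<eta> \<in> level_set V M i"
proof -
  obtain a b c e where qq: "q = (a, b, c, e)" by (cases q)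
  have m: "a \<in> V" "b \<in> V" "c \<in> V" "e \<in> V" "a + b = c + e" using q qq by (auto simp: collisions_def)
  have conf: "\<eta> \<in> configs V M" using \<eta> by (simp add: level_set_def)
  have p: "\<eta> x a = 1" "\<eta> x b = 1" "\<eta> x c = 0" "\<eta> x e = 0"
    using r coll_rate_cases[OF conf x m(1-4)] by (auto simp: qq split: if_splits)
  have ab: "a \<noteq> b"
  proof
    assume "a = b"
    then have "c = a" using double_velocity(1)[of a c e] m by simp
    then show False using p by simp
  qed
  have ce: "c \<noteq> e"
  proof
    assume "c = e"
    then have "a = c" using double_velocity(1)[of c a b] m by simp
    then show False using p by simp
  qed
  have neq: "a \<noteq> c" "a \<noteq> e" "b \<noteq> c" "b \<noteq> e" using p by auto
  show ?thesis unfolding qq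
  proof (rule level_setI[OF \<eta>])
    show "collide x (a, b, c, e) \<eta> \<in> configs V M" by (rule collide_mem_configs[OF conf x m(1-4)])
    show "(\<Sum>u\<in>V. real (occupation M u (collide x (a, b, c, e) \<eta>)) *\<^sub>R bvec u) = (\<Sum>u\<in>V. real (occupation M u \<eta>) *\<^sub>R bvec u)"
    proof (rule sum_bvec_collision[OF finite_V m])
      fix u
      show "real (occupation M u (collide x (a, b, c, e) \<eta>)) =
        real (occupation M u \<eta>) - (if u = a then 1 else 0) - (if u = b then 1 else 0) + (if u = c then 1 else 0) + (if u = e then 1 else 0)"
        using occupation_collide(1)[OF x ab ce, of \<eta> u, OF p] occupation_collide(2)[OF x ab ce, of \<eta> u, OF p] ab ce neq
        by auto
    qed
  qed
qed

end

lemma inj_shift: "inj (shift l l')"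
proof (rule injI)
  fix a b assume e: "shift l l' a = shift l l' b"
  show "a = b"
  proof
    fix j show "a j = b j" using fun_cong[OF e, of j] by (auto simp: shift_def split: if_splits)
  qed
qed

context paired_velocities
begin

text \<open>On a level set the occupation numbers of the velocities \<open>vstar - v l\<close> determine those of
  \<open>vstar + v l\<close>, so they label the classes of equal occupation numbers.\<close>

definition label :: "nat \<Rightarrow> 'd config \<Rightarrow> nat \<Rightarrow> int" where
  "label M \<eta> = (\<lambda>l. if l \<in> {1..n} then int (occupation M (dn l) \<eta>) else 0)"

end

section \<open>The cells of a level set, their sizes and their means\<close>

locale velocity_level_set = paired_velocities n vstar v V
  for n :: nat and vstar :: "real^'d" and v :: "nat \<Rightarrow> real^'d" and V :: "(real^'d) set" +
  fixes M :: nat and i :: "real^('d option)" and Y :: "'d config set" and volume :: nat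
  assumes Y_def: "Y = level_set V M i" and volume_def: "volume = card (Lam M :: (int^'d) set)"
begin

lemma finite_Y: "finite Y" and Y_configs: "Y \<subseteq> configs V M"
  by (auto simp: Y_def level_set_def finite_configs finite_V)

abbreviation cell :: "(nat \<Rightarrow> int) \<Rightarrow> 'd config set" where
  "cell a \<equiv> {\<eta> \<in> Y. label M \<eta> = a}"

lemma occupation_le: "occupation M u \<eta> \<le> volume" for \<eta> :: "'d config"
  unfolding occupation_def volume_def by (rule card_mono[OF finite_Lam]) auto

lemma cell_eq_class:
  assumes "\<eta> \<in> Y"
  shows "cell (label M \<eta>) = occupation_class V M (\<lambda>u. occupation M u \<eta>)"
proof (intro equalityI subsetI)
  fix \<zeta> assume "\<zeta> \<in> cell (label M \<eta>)"
  then have \<zeta>: "\<zeta> \<in> Y" and lab: "label M \<zeta> = label M \<eta>" by auto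
  have d: "occupation M (dn l) \<zeta> = occupation M (dn l) \<eta>" if "l \<in> {1..n}" for l
    using fun_cong[OF lab, of l] that by (simp add: label_def)
  have "occupation M (up l) \<zeta> = occupation M (up l) \<eta>" if "l \<in> {1..n}" for l
    using conserved(1)[of \<zeta> M i \<eta> l] \<zeta> assms d that by (simp add: Y_def)
  with d have "occupation M u \<zeta> = occupation M u \<eta>" if "u \<in> V" for u using that by (auto simp: V_eq)
  then show "\<zeta> \<in> occupation_class V M (\<lambda>u. occupation M u \<eta>)"
    using \<zeta> Y_configs by (auto simp: occupation_class_def)
next
  fix \<zeta> assume \<zeta>: "\<zeta> \<in> occupation_class V M (\<lambda>u. occupation M u \<eta>)"
  then have "label M \<zeta> = label M \<eta>" by (auto simp: label_def occupation_class_def dn_mem)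
  with \<zeta> show "\<zeta> \<in> cell (label M \<eta>)"
    using occupation_class_subset_level_set[of \<eta> M i] assms by (auto simp: Y_def)
qed

text \<open>Summing over all collisions makes the bound independent of the one that realises the
  shift.\<close>

definition edge_bound :: "('d config \<Rightarrow> real) \<Rightarrow> 'd config set \<Rightarrow> 'd config set \<Rightarrow> real" where
  "edge_bound f Z Z' = 3 * real volume ^ 3 * ((12 * real M * real CARD('d))\<^sup>2 * (bond_energy f V M Z + bond_energy f V M Z')
      + (\<Sum>q\<in>collisions V. coll_energy f M q Z))"

definition cell_mean :: "('d config \<Rightarrow> real) \<Rightarrow> (nat \<Rightarrow> int) \<Rightarrow> real" where
  "cell_mean f a = (\<Sum>\<eta>\<in>cell a. f \<eta>) / real (card (cell a))"

lemma shift_cell: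
  fixes f :: "'d config \<Rightarrow> real"
  assumes \<eta>: "\<eta> \<in> Y" and l: "l \<in> {1..n}" "l' \<in> {1..n}" "l \<noteq> l'"
  defines "N \<equiv> \<lambda>u. occupation M u \<eta>" and "a \<equiv> label M \<eta>"
  assumes pos: "1 \<le> N (up l')" "1 \<le> N (dn l')" "N (up l) < volume" "N (dn l) < volume"
  shows "shift l l' a \<in> label M ` Y"
    and "real (N (up l')) * real (N (dn l')) * (real volume - real (N (up l))) * (real volume - real (N (dn l))) * real (card (cell a))
      = (real volume - real (N (up l')) + 1) * (real volume - real (N (dn l')) + 1) * (real (N (up l)) + 1) * (real (N (dn l)) + 1)
        * real (card (cell (shift l l' a)))"
    and "min (real (card (cell a))) (real (card (cell (shift l l' a)))) * (cell_mean f a - cell_mean f (shift l l' a))\<^sup>2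
      \<le> edge_bound f (cell a) (cell (shift l l' a))"
proof -
  let ?v = "up l'" and ?w = "dn l'" and ?v' = "up l" and ?w' = "dn l"
  define N' where "N' = (\<lambda>u. if u = ?v \<or> u = ?w then N u - 1 else if u = ?v' \<or> u = ?w' then N u + 1 else N u)"
  have V4: "?v \<in> V" "?w \<in> V" "?v' \<in> V" "?w' \<in> V" using l by (simp_all add: up_mem dn_mem)
  have dist: "distinct [?v, ?w, ?v', ?w']"
    using l by (auto simp: up_eq_iff dn_eq_iff up_neq_dn up_neq_dn[symmetric])
  have q: "(?v, ?w, ?v', ?w') \<in> collisions V" using V4 by (simp add: collisions_def up_def dn_def)
  have Z: "cell a = occupation_class V M N" unfolding a_def N_def by (rule cell_eq_class[OF \<eta>])
  have ne: "occupation_class V M N \<noteq> {}" using \<eta> unfolding Z[symmetric] a_def by auto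
  note ce = class_edge(1)[where V = V and v = ?v and w = ?w and v' = ?v' and w' = ?w' and M = M and N = N,
      folded N'_def volume_def, OF finite_V V4 dist ne pos]
    class_edge(2)[where V = V and v = ?v and w = ?w and v' = ?v' and w' = ?w' and M = M and N = N and f = f,
      folded N'_def volume_def, OF finite_V V4 dist ne pos]
  \<comment> \<open>The target class cannot be empty: the counting identity would equate a positive
    number with 0.\<close>
  have "card (occupation_class V M N') \<noteq> 0"
  proof
    assume "card (occupation_class V M N') = 0"
    then have "real (N ?v) * real (N ?w) * (real volume - real (N ?v')) * (real volume - real (N ?w')) * real (card (occupation_class V M N)) = 0"
      using ce(1) by simp
    moreover have "card (occupation_class V M N) \<noteq> 0" using ne finite_occupation_class[OF finite_V] by simp
    ultimately show False using pos by auto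
  qed
  then obtain \<zeta> where \<zeta>: "\<zeta> \<in> occupation_class V M N'" by fastforce
  then have Nz: "occupation M u \<zeta> = N' u" if "u \<in> V" for u using that by (simp add: occupation_class_def)
  have "\<zeta> \<in> level_set V M i"
  proof (rule level_setI[of \<eta>])
    show "\<eta> \<in> level_set V M i" using \<eta> by (simp add: Y_def)
    show "\<zeta> \<in> configs V M" using \<zeta> by (simp add: occupation_class_def)
    show "(\<Sum>u\<in>V. real (occupation M u \<zeta>) *\<^sub>R bvec u) = (\<Sum>u\<in>V. real (occupation M u \<eta>) *\<^sub>R bvec u)"
    proof (rule sum_bvec_collision[OF finite_V V4])
      show "?v + ?w = ?v' + ?w'" by (simp add: up_def dn_def)
      show "real (occupation M u \<zeta>) = real (occupation M u \<eta>) - (if u = ?v then 1 else 0) - (if u = ?w then 1 else 0)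
          + (if u = ?v' then 1 else 0) + (if u = ?w' then 1 else 0)" if "u \<in> V" for u
        unfolding Nz[OF that] N'_def using dist pos by (auto simp: N_def)
    qed
  qed
  then have \<zeta>Y: "\<zeta> \<in> Y" by (simp add: Y_def)
  have lab: "label M \<zeta> = shift l l' a"
  proof
    fix j
    show "label M \<zeta> j = shift l l' a j"
    proof (cases "j \<in> {1..n}")
      case True
      then have "dn j \<noteq> up l" "dn j \<noteq> up l'" "dn j = dn l \<longleftrightarrow> j = l" "dn j = dn l' \<longleftrightarrow> j = l'"
        using l up_neq_dn dn_eq_iff by metis+
      then show ?thesis using True l pos Nz[OF dn_mem[OF True]]
        by (auto simp: label_def shift_def a_def N'_def N_def)
    next
      case False
      then have "j \<noteq> l" "j \<noteq> l'" using l by auto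
      with False show ?thesis by (auto simp: label_def shift_def a_def)
    qed
  qed
  show "shift l l' a \<in> label M ` Y" using \<zeta>Y lab by force
  have "cell (shift l l' a) = occupation_class V M (\<lambda>u. occupation M u \<zeta>)"
    using cell_eq_class[OF \<zeta>Y] lab by simp
  also have "\<dots> = occupation_class V M N'" by (rule occupation_class_cong) (rule Nz)
  finally have Z': "cell (shift l l' a) = occupation_class V M N'" .
  show "real (N ?v) * real (N ?w) * (real volume - real (N ?v')) * (real volume - real (N ?w')) * real (card (cell a))
      = (real volume - real (N ?v) + 1) * (real volume - real (N ?w) + 1) * (real (N ?v') + 1) * (real (N ?w') + 1)
        * real (card (cell (shift l l' a)))"
    unfolding Z Z' by (rule ce(1))
  have "min (real (card (cell a))) (real (card (cell (shift l l' a)))) * (cell_mean f a - cell_mean f (shift l l' a))\<^sup>2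
      \<le> 3 * real volume ^ 3 * ((12 * real M * real CARD('d))\<^sup>2 * (bond_energy f V M (cell a) + bond_energy f V M (cell (shift l l' a)))
        + coll_energy f M (?v, ?w, ?v', ?w') (cell a))"
    unfolding cell_mean_def Z Z' by (rule ce(2))
  also have "\<dots> \<le> edge_bound f (cell a) (cell (shift l l' a))"
    unfolding edge_bound_def
    by (intro mult_left_mono add_left_mono member_le_sum[OF q] coll_energy_nonneg[of _ V] finite_collisions finite_V)
       (use Y_configs in auto)
  finally show "min (real (card (cell a))) (real (card (cell (shift l l' a)))) * (cell_mean f a - cell_mean f (shift l l' a))\<^sup>2
      \<le> edge_bound f (cell a) (cell (shift l l' a))" .
qed

lemma occupation_less:
  assumes "\<eta> \<in> Y" "\<zeta> \<in> Y" "l \<in> {1..n}" "label M \<eta> l < label M \<zeta> l"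
  shows "occupation M (up l) \<eta> < occupation M (up l) \<zeta>" "occupation M (dn l) \<eta> < occupation M (dn l) \<zeta>"
  using conserved(1)[of \<eta> M i \<zeta> l] assms by (auto simp: Y_def label_def)

text \<open>A strict inequality between occupations leaves a vacancy on the smaller side and a
  particle on the larger one. These are the hypotheses \<open>pos\<close> of
  \<open>shift_cell\<close>.\<close>

lemma occupation_between:
  assumes "\<eta> \<in> Y" "\<zeta> \<in> Y" "l \<in> {1..n}" "label M \<eta> l < label M \<zeta> l"
  shows "occupation M (up l) \<eta> < volume" "occupation M (dn l) \<eta> < volume"
    "1 \<le> occupation M (up l) \<zeta>" "1 \<le> occupation M (dn l) \<zeta>"
  using occupation_less[OF assms] occupation_le[of "up l" \<zeta>] occupation_le[of "dn l" \<zeta>] by linarith+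

text \<open>Discrete log-concavity of the cell sizes, read off from the ratios in \<open>shift_cell\<close>.\<close>

lemma shift_towards:
  assumes a: "a \<in> label M ` Y" "b \<in> label M ` Y" and l: "l \<in> {1..n}" "l' \<in> {1..n}" "a l < b l" "b l' < a l'"
  shows "shift l l' a \<in> label M ` Y \<and> real (card (cell a)) \<le> real (card (cell (shift l l' a))) \<or>
    shift l' l b \<in> label M ` Y \<and> real (card (cell b)) \<le> real (card (cell (shift l' l b)))"
proof (rule ccontr)
  assume neg: "\<not> ?thesis"
  obtain \<eta> where \<eta>: "\<eta> \<in> Y" "a = label M \<eta>" using a by auto
  obtain \<zeta> where \<zeta>: "\<zeta> \<in> Y" "b = label M \<zeta>" using a by auto
  have ll: "l \<noteq> l'" using l by auto
  let ?o = "\<lambda>u. real (occupation M u \<eta>)" and ?p = "\<lambda>u. real (occupation M u \<zeta>)" and ?L = "real volume"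
  have le: "occupation M u \<eta> \<le> volume" "occupation M u \<zeta> \<le> volume" for u by (simp_all add: occupation_le)
  note bl = occupation_between[OF \<eta>(1) \<zeta>(1) l(1) l(3)[unfolded \<eta> \<zeta>]]
  note bl' = occupation_between[OF \<zeta>(1) \<eta>(1) l(2) l(4)[unfolded \<eta> \<zeta>]]
  note ol = occupation_less[OF \<eta>(1) \<zeta>(1) l(1) l(3)[unfolded \<eta> \<zeta>]]
  note ol' = occupation_less[OF \<zeta>(1) \<eta>(1) l(2) l(4)[unfolded \<eta> \<zeta>]]
  note sa = shift_cell(1,2)[OF \<eta>(1) l(1,2) ll bl'(3,4) bl(1,2), folded \<eta>(2)]
  note sb = shift_cell(1,2)[OF \<zeta>(1) l(2,1) ll[symmetric] bl(3,4) bl'(1,2), folded \<zeta>(2)]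
  \<comment> \<open>Turns a strict decrease of the cell size into an inequality between the two
    products of the size ratio.\<close>
  have gt: "x < y" if "x * c = y * d" "d < c" "0 < x" "0 \<le> d" for x y c d :: real
  proof (rule ccontr)
    assume "\<not> x < y"
    then have "y * d \<le> x * d" using that by (intro mult_right_mono) auto
    also have "\<dots> < x * c" using that by (intro mult_strict_left_mono) auto
    finally show False using that by simp
  qed
  have 1: "?o (up l') * ?o (dn l') * (?L - ?o (up l)) * (?L - ?o (dn l)) <
      (?L - ?o (up l') + 1) * (?L - ?o (dn l') + 1) * (?o (up l) + 1) * (?o (dn l) + 1)"
    by (rule gt[OF sa(2)]) (use neg sa(1) bl bl' in auto)
  have 2: "?p (up l) * ?p (dn l) * (?L - ?p (up l')) * (?L - ?p (dn l')) <
      (?L - ?p (up l) + 1) * (?L - ?p (dn l) + 1) * (?p (up l') + 1) * (?p (dn l') + 1)"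
    by (rule gt[OF sb(2)]) (use neg sb(1) bl bl' in auto)
  \<comment> \<open>Occupations are integers, so \<open>ol\<close> and \<open>ol'\<close> leave room
    for the summands 1. The right side of each of \<open>1\<close> and \<open>2\<close> is then at
    most the left side of the other, which closes a cycle of strict inequalities.\<close>
  have "(?L - ?o (up l') + 1) * (?L - ?o (dn l') + 1) * (?o (up l) + 1) * (?o (dn l) + 1) \<le>
      (?L - ?p (up l')) * (?L - ?p (dn l')) * ?p (up l) * ?p (dn l)"
    using ol ol' le by (intro mult_mono mult_nonneg_nonneg) auto
  moreover have "(?L - ?p (up l) + 1) * (?L - ?p (dn l) + 1) * (?p (up l') + 1) * (?p (dn l') + 1) \<le>
      (?L - ?o (up l)) * (?L - ?o (dn l)) * ?o (up l') * ?o (dn l')"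
    using ol ol' le by (intro mult_mono mult_nonneg_nonneg) auto
  ultimately show False using 1 2 by (simp only: mult.commute mult.left_commute mult.assoc)
qed

lemma label_total:
  assumes "a \<in> label M ` Y" "b \<in> label M ` Y"
  shows "sum a {1..n} = sum b {1..n}"
proof -
  obtain \<eta> \<zeta> where *: "\<eta> \<in> Y" "\<zeta> \<in> Y" "a = label M \<eta>" "b = label M \<zeta>" using assms by auto
  have "sum (label M \<xi>) {1..n} = (\<Sum>l=1..n. int (occupation M (dn l) \<xi>))" for \<xi>
    by (rule sum.cong) (auto simp: label_def)
  then show ?thesis using conserved(2)[of \<eta> M i \<zeta>] * by (simp add: Y_def)
qed

text \<open>The entries of a label have a prescribed sum, so the last one is determined by the
  others. For n = 1 at most one cell remains.\<close>

lemma card_labels_le: "real (card (label M ` Y)) \<le> (real volume + 1) ^ (n - 1)"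
proof -
  let ?r = "\<lambda>a. restrict a {1..n - 1}"
  have "card (label M ` Y) \<le> card ({1..n - 1} \<rightarrow>\<^sub>E {0..int volume})"
  proof (rule card_inj_on_le[where f = ?r])
    show "inj_on ?r (label M ` Y)"
    proof (rule inj_onI)
      fix a b assume ab: "a \<in> label M ` Y" "b \<in> label M ` Y" "?r a = ?r b"
      have e: "a j = b j" if "j \<in> {1..n - 1}" for j using fun_cong[OF ab(3), of j] that by simp
      have "(\<Sum>l=1..n. a l) = (\<Sum>l=1..n. b l)" by (rule label_total[OF ab(1,2)])
      moreover have "{1..n} = insert n {1..n - 1}" using n by auto
      ultimately have "a n = b n" using e n by simp
      show "a = b"
      proof
        fix j
        consider "j \<in> {1..n - 1}" | "j = n" | "j \<notin> {1..n}" by force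
        then show "a j = b j"
        proof cases
          case 3 then show ?thesis using ab(1,2) by (auto simp: label_def)
        qed (use e \<open>a n = b n\<close> in auto)
      qed
    qed
    show "?r ` label M ` Y \<subseteq> {1..n - 1} \<rightarrow>\<^sub>E {0..int volume}"
      by (auto simp: label_def occupation_le)
  qed (auto intro: finite_PiE)
  also have "\<dots> = (volume + 1) ^ (n - 1)" by (simp add: card_PiE nat_add_distrib)
  finally have "real (card (label M ` Y)) \<le> real ((volume + 1) ^ (n - 1))" by (rule of_nat_mono)
  then show ?thesis by (simp add: add.commute)
qed

lemma label_dist_le:
  assumes "a \<in> label M ` Y" "b \<in> label M ` Y"
  shows "(\<Sum>j=1..n. \<bar>a j - b j\<bar>) \<le> 2 * int (n * volume)"
proof -
  have "0 \<le> a j \<and> a j \<le> int volume" "0 \<le> b j \<and> b j \<le> int volume" for j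
    using assms by (auto simp: label_def occupation_le)
  then have "\<bar>a j - b j\<bar> \<le> int volume" for j by (smt (verit))
  then have "(\<Sum>j=1..n. \<bar>a j - b j\<bar>) \<le> (\<Sum>j=1..n. int volume)" by (intro sum_mono)
  also have "\<dots> \<le> 2 * int (n * volume)" by simp
  finally show ?thesis .
qed

text \<open>An edge involves the energies of both its cells, while the path argument charges the
  starting cell alone. Therefore \<open>G\<close> also collects, in \<open>N\<close>, the energies
  of all cells one shift away; this is where 1 + n^2 comes from.\<close>

lemma between_cells_le:
  fixes f :: "'d config \<Rightarrow> real"
  defines "K \<equiv> label M ` Y"
  shows "(\<Sum>a\<in>K. \<Sum>b\<in>K. real (card (cell a)) * real (card (cell b)) * (cell_mean f a - cell_mean f b)\<^sup>2) \<le>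
    2 * (real volume + 1) ^ (n - 1) * real (card Y) * (real (n * volume) *
      (3 * real volume ^ 3 * ((12 * real M * real CARD('d))\<^sup>2 * ((1 + (real n)\<^sup>2) * bond_energy f V M Y)
        + (\<Sum>q\<in>collisions V. coll_energy f M q Y))))"
proof -
  let ?I = "{1..n}" and ?\<tau> = "(12 * real M * real CARD('d))\<^sup>2"
  let ?P = "{1..n} \<times> {1..n}"
  let ?E = "\<lambda>a. bond_energy f V M (cell a)" and ?C = "\<lambda>a. \<Sum>q\<in>collisions V. coll_energy f M q (cell a)"
  define N where "N = (\<lambda>a. \<Sum>p\<in>?P. if shift (fst p) (snd p) a \<in> K then ?E (shift (fst p) (snd p) a) else 0)"
  define G where "G = (\<lambda>a. 3 * real volume ^ 3 * (?\<tau> * (?E a + N a) + ?C a))"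
  have finK: "finite K" by (simp add: K_def finite_Y)
  have E0: "0 \<le> ?E a" for a by (rule bond_energy_nonneg)
  have C0: "0 \<le> ?C a" for a
    by (intro sum_nonneg coll_energy_nonneg[of _ V]) (use Y_configs in auto)
  have N0: "0 \<le> N a" for a unfolding N_def by (intro sum_nonneg) (simp add: E0)
  obtain s where s: "\<And>a. a \<in> K \<Longrightarrow> sum a ?I = s"
    using label_total unfolding K_def by (cases "Y = {}") blast+
  have "(\<Sum>a\<in>K. \<Sum>b\<in>K. real (card (cell a)) * real (card (cell b)) * (cell_mean f a - cell_mean f b)\<^sup>2) \<le>
      2 * real (card K) * (\<Sum>a\<in>K. real (card (cell a))) * (real (n * volume) * (\<Sum>a\<in>K. G a))"
  proof (rule weighted_variance_le[where J = ?I])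
    show "finite K" by fact
    show "finite ?I" by simp
    show "a j = 0" if "a \<in> K" "j \<notin> ?I" for a j using that by (auto simp: K_def label_def)
    show "sum a ?I = s" if "a \<in> K" for a by (rule s[OF that])
    show "shift l l' a \<in> K \<and> real (card (cell a)) \<le> real (card (cell (shift l l' a))) \<or>
        shift l' l a' \<in> K \<and> real (card (cell a')) \<le> real (card (cell (shift l' l a')))"
      if "a \<in> K" "a' \<in> K" "l \<in> ?I" "l' \<in> ?I" "a l < a' l" "a' l' < a l'" for a a' l l'
      using that unfolding K_def by (rule shift_towards)
    show "(\<Sum>j\<in>?I. \<bar>a j - a' j\<bar>) \<le> 2 * int (n * volume)" if "a \<in> K" "a' \<in> K" for a a'
      using that unfolding K_def by (rule label_dist_le)
    show "0 \<le> G a" for a unfolding G_def using E0[of a] N0[of a] C0[of a] by simp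
    show "min (real (card (cell a))) (real (card (cell (shift l l' a)))) * (cell_mean f a - cell_mean f (shift l l' a))\<^sup>2 \<le> G a"
      if a: "a \<in> K" and l: "l \<in> ?I" "l' \<in> ?I" "l \<noteq> l'" and s: "shift l l' a \<in> K" for a l l'
    proof -
      obtain \<eta> where \<eta>: "\<eta> \<in> Y" "a = label M \<eta>" using a by (auto simp: K_def)
      obtain \<zeta> where \<zeta>: "\<zeta> \<in> Y" "shift l l' a = label M \<zeta>" using s by (auto simp: K_def)
      have lt: "label M \<eta> l < label M \<zeta> l" "label M \<zeta> l' < label M \<eta> l'"
        using l(3) unfolding \<eta>(2)[symmetric] \<zeta>(2)[symmetric] by (simp_all add: shift_def)
      have "min (real (card (cell a))) (real (card (cell (shift l l' a)))) * (cell_mean f a - cell_mean f (shift l l' a))\<^sup>2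
          \<le> edge_bound f (cell a) (cell (shift l l' a))"
        unfolding \<eta>(2)
        by (rule shift_cell(3)[OF \<eta>(1) l occupation_between(3,4)[OF \<zeta>(1) \<eta>(1) l(2) lt(2)] occupation_between(1,2)[OF \<eta>(1) \<zeta>(1) l(1) lt(1)]])
      also have "\<dots> \<le> G a"
      proof -
        have "?E (shift l l' a) \<le> N a"
          unfolding N_def
          using member_le_sum[of "(l, l')" ?P "\<lambda>p. if shift (fst p) (snd p) a \<in> K then ?E (shift (fst p) (snd p) a) else 0"] l s E0
          by simp
        then show ?thesis unfolding edge_bound_def G_def by (intro mult_left_mono add_mono) auto
      qed
      finally show ?thesis .
    qed
  qed simp
  also have "(\<Sum>a\<in>K. real (card (cell a))) = real (card Y)"
    unfolding K_def using sum.group[OF finite_Y _ subset_refl, of "label M" "\<lambda>_. 1::real"] finite_Y by simp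
  also have "2 * real (card K) * real (card Y) * (real (n * volume) * (\<Sum>a\<in>K. G a)) \<le>
      2 * (real volume + 1) ^ (n - 1) * real (card Y) * (real (n * volume) *
      (3 * real volume ^ 3 * (?\<tau> * ((1 + (real n)\<^sup>2) * bond_energy f V M Y) + (\<Sum>q\<in>collisions V. coll_energy f M q Y))))"
  proof -
    have EK: "(\<Sum>a\<in>K. ?E a) = bond_energy f V M Y" unfolding K_def by (rule sum_bond_energy_partition[OF finite_Y])
    have "(\<Sum>a\<in>K. N a) = (\<Sum>p\<in>?P. \<Sum>a\<in>K. if shift (fst p) (snd p) a \<in> K then ?E (shift (fst p) (snd p) a) else 0)"
      unfolding N_def by (rule sum.swap)
    also have "\<dots> \<le> (\<Sum>p\<in>?P. bond_energy f V M Y)"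
    proof (rule sum_mono)
      fix p
      let ?s = "shift (fst p) (snd p)"
      have "(\<Sum>a\<in>K. if ?s a \<in> K then ?E (?s a) else 0) = (\<Sum>a\<in>{a \<in> K. ?s a \<in> K}. ?E (?s a))"
        using finK by (simp add: sum.inter_filter)
      \<comment> \<open>The shift is injective, so each cell is the target of at most one other for
        a given pair of indices.\<close>
      also have "\<dots> = (\<Sum>b\<in>?s ` {a \<in> K. ?s a \<in> K}. ?E b)"
        by (rule sum.reindex_cong[symmetric, of ?s]) (auto intro: inj_on_subset[OF inj_shift])
      also have "\<dots> \<le> (\<Sum>b\<in>K. ?E b)" by (rule sum_mono2) (use finK E0 in auto)
      finally show "(\<Sum>a\<in>K. if ?s a \<in> K then ?E (?s a) else 0) \<le> bond_energy f V M Y" by (simp add: EK)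
    qed
    finally have NK: "(\<Sum>a\<in>K. N a) \<le> (real n)\<^sup>2 * bond_energy f V M Y"
      by (simp add: power2_eq_square)
    have CK: "(\<Sum>a\<in>K. ?C a) = (\<Sum>q\<in>collisions V. coll_energy f M q Y)"
      unfolding K_def by (subst sum.swap) (simp add: sum_coll_energy_partition[OF finite_Y])
    have "(\<Sum>a\<in>K. G a) = 3 * real volume ^ 3 * (?\<tau> * ((\<Sum>a\<in>K. ?E a) + (\<Sum>a\<in>K. N a)) + (\<Sum>a\<in>K. ?C a))"
      unfolding G_def by (simp only: sum.distrib flip: sum_distrib_left)
    also have "\<dots> \<le> 3 * real volume ^ 3 * (?\<tau> * ((1 + (real n)\<^sup>2) * bond_energy f V M Y) + (\<Sum>q\<in>collisions V. coll_energy f M q Y))"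
      unfolding EK CK using NK by (intro mult_left_mono add_mono) (auto simp: algebra_simps)
    finally have GK: "(\<Sum>a\<in>K. G a) \<le> \<dots>" .
    show ?thesis
      using card_labels_le
      by (intro mult_mono mult_left_mono mult_right_mono GK mult_nonneg_nonneg sum_nonneg)
         (auto simp: K_def G_def intro!: mult_nonneg_nonneg add_nonneg_nonneg E0 N0 C0)
  qed
  finally show ?thesis .
qed

lemma within_cells_le:
  fixes f :: "'d config \<Rightarrow> real"
  shows "(\<Sum>a\<in>label M ` Y. \<Sum>\<eta>\<in>cell a. (f \<eta> - cell_mean f a)\<^sup>2) \<le>
    (real (volume * card V) * (4 * real M * real CARD('d)))\<^sup>2 * bond_energy f V M Y / 2"
proof -
  let ?t = "(real (volume * card V) * (4 * real M * real CARD('d)))\<^sup>2"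
  have "(\<Sum>\<eta>\<in>cell a. (f \<eta> - cell_mean f a)\<^sup>2) \<le> ?t * bond_energy f V M (cell a) / 2" if a: "a \<in> label M ` Y" for a
  proof -
    obtain \<eta> where \<eta>: "\<eta> \<in> Y" "a = label M \<eta>" using a by auto
    have c: "cell a = occupation_class V M (\<lambda>u. occupation M u \<eta>)" using cell_eq_class[OF \<eta>(1)] \<eta>(2) by simp
    have pos: "real (card (cell a)) > 0" using \<eta> finite_Y by (auto simp: card_gt_0_iff)
    have "2 * real (card (cell a)) * (\<Sum>\<eta>\<in>cell a. (f \<eta> - cell_mean f a)\<^sup>2) = (\<Sum>\<eta>\<in>cell a. \<Sum>\<eta>'\<in>cell a. (f \<eta> - f \<eta>')\<^sup>2)"
      unfolding cell_mean_def by (rule sum_sum_diff_square[symmetric]) (simp add: finite_Y)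
    also have "\<dots> \<le> real (card (cell a)) * (?t * bond_energy f V M (cell a))"
      unfolding c volume_def by (rule occupation_class_variance[OF finite_V])
    finally have "real (card (cell a)) * (2 * (\<Sum>\<eta>\<in>cell a. (f \<eta> - cell_mean f a)\<^sup>2)) \<le> real (card (cell a)) * (?t * bond_energy f V M (cell a))"
      by (simp only: mult.assoc mult.left_commute)
    then show ?thesis using pos by simp
  qed
  then have "(\<Sum>a\<in>label M ` Y. \<Sum>\<eta>\<in>cell a. (f \<eta> - cell_mean f a)\<^sup>2) \<le> (\<Sum>a\<in>label M ` Y. ?t * bond_energy f V M (cell a) / 2)"
    by (rule sum_mono)
  also have "\<dots> = ?t * (\<Sum>a\<in>label M ` Y. bond_energy f V M (cell a)) / 2"
    by (simp add: sum_distrib_left sum_divide_distrib)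
  finally show ?thesis unfolding sum_bond_energy_partition[OF finite_Y] .
qed

end

subsection \<open>The spectral gap\<close>

text \<open>3^d bounds 2M + 1 by 3M in each coordinate, and 2^n absorbs the + 1 in the number of
  cells. 384 is 6 times 8^2, from the within-cell cost with 2n velocities. 9 combines the 3 of the
  splitting into cells with the 3 of \<open>class_edge\<close>. 576 is 4 times 12^2; this 4 and the
  final 2 compare bond and collision energies with the Dirichlet form.\<close>

definition gap_const :: "nat \<Rightarrow> nat \<Rightarrow> real" where
  "gap_const n d = (3 ^ d) ^ (n + 3) *
     (384 * (real n)\<^sup>2 * (real d)\<^sup>2 + 9 * 2 ^ n * real n * (576 * (real d)\<^sup>2 * (1 + (real n)\<^sup>2) + 2))"

lemma gap_const_bound:
  fixes n d M L :: nat
  assumes n: "n \<ge> 1" and M: "M \<ge> 1" and L: "L = (2 * M + 1) ^ d"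
  shows "6 * (real (L * (2 * n)) * (4 * real M * real d))\<^sup>2
    + (if n = 1 then 0 else 9 * (real L + 1) ^ (n - 1) * real n * real L ^ 4 * (4 * (12 * real M * real d)\<^sup>2 * (1 + (real n)\<^sup>2) + 2))
    \<le> gap_const n d * real M ^ ((2 * n + 1) * d + 2)"
proof -
  define P q m l where "P = real M ^ d" and "q = (3::real) ^ d" and "m = real M" and "l = real L"
  have m1: "1 \<le> m" and P1: "1 \<le> P" and q1: "1 \<le> q" using M by (simp_all add: P_def q_def m_def)
  have l1: "1 \<le> l" unfolding l_def L by simp
  have "l = (2 * real M + 1) ^ d" by (simp add: l_def L add.commute)
  also have "\<dots> \<le> (3 * real M) ^ d" using M by (intro power_mono) auto
  finally have lq: "l \<le> q * P" by (simp add: power_mult_distrib q_def P_def)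
  \<comment> \<open>Applied with k = 2 and, from n = 2 on, with k = n + 3; in the latter case n = 2
    gives equality with 2n + 1.\<close>
  have pow: "l ^ k \<le> q ^ (n + 3) * P ^ (2 * n + 1)" if "k \<le> n + 3" "k \<le> 2 * n + 1" for k
  proof -
    have "l ^ k \<le> (q * P) ^ k" using lq l1 by (intro power_mono) auto
    also have "\<dots> = q ^ k * P ^ k" by (rule power_mult_distrib)
    also have "\<dots> \<le> q ^ (n + 3) * P ^ (2 * n + 1)"
      using that q1 P1 by (intro mult_mono power_increasing) auto
    finally show ?thesis .
  qed
  let ?X = "q ^ (n + 3) * P ^ (2 * n + 1)"
  have 1: "6 * (real (L * (2 * n)) * (4 * real M * real d))\<^sup>2 \<le> 384 * (real n)\<^sup>2 * (real d)\<^sup>2 * m\<^sup>2 * ?X"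
  proof -
    have "6 * (real (L * (2 * n)) * (4 * real M * real d))\<^sup>2 = 384 * (real n)\<^sup>2 * (real d)\<^sup>2 * m\<^sup>2 * l\<^sup>2"
      by (simp add: power_mult_distrib m_def l_def)
    also have "\<dots> \<le> 384 * (real n)\<^sup>2 * (real d)\<^sup>2 * m\<^sup>2 * ?X"
      by (intro mult_left_mono pow) (use n in auto)
    finally show ?thesis .
  qed
  have 2: "9 * (l + 1) ^ (n - 1) * real n * l ^ 4 * (4 * (12 * real M * real d)\<^sup>2 * (1 + (real n)\<^sup>2) + 2)
      \<le> 9 * 2 ^ n * real n * (576 * (real d)\<^sup>2 * (1 + (real n)\<^sup>2) + 2) * m\<^sup>2 * ?X" if "n \<noteq> 1"
  proof -
    have n2: "n \<ge> 2" using n that by simp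
    have "(l + 1) ^ (n - 1) \<le> (2 * l) ^ (n - 1)" using l1 by (intro power_mono) auto
    also have "\<dots> = 2 ^ (n - 1) * l ^ (n - 1)" by (rule power_mult_distrib)
    also have "\<dots> \<le> 2 ^ n * l ^ (n - 1)" using l1 by (intro mult_right_mono power_increasing) auto
    finally have "(l + 1) ^ (n - 1) * l ^ 4 \<le> 2 ^ n * l ^ (n - 1) * l ^ 4" using l1 by (intro mult_right_mono) auto
    also have "\<dots> = 2 ^ n * l ^ (n + 3)"
    proof -
      have "n + 3 = (n - 1) + 4" using n by simp
      then show ?thesis by (simp only: power_add mult.assoc)
    qed
    also have "\<dots> \<le> 2 ^ n * ?X" by (intro mult_left_mono pow) (use n2 in auto)
    finally have a: "(l + 1) ^ (n - 1) * l ^ 4 \<le> 2 ^ n * ?X" .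
    have b: "4 * (12 * real M * real d)\<^sup>2 * (1 + (real n)\<^sup>2) + 2 \<le> (576 * (real d)\<^sup>2 * (1 + (real n)\<^sup>2) + 2) * m\<^sup>2"
    proof -
      have "1 \<le> m\<^sup>2" using m1 by simp
      then show ?thesis by (simp add: power_mult_distrib m_def algebra_simps)
    qed
    have "(9 * real n) * (((l + 1) ^ (n - 1) * l ^ 4) * (4 * (12 * real M * real d)\<^sup>2 * (1 + (real n)\<^sup>2) + 2))
      \<le> (9 * real n) * ((2 ^ n * ?X) * ((576 * (real d)\<^sup>2 * (1 + (real n)\<^sup>2) + 2) * m\<^sup>2))"
      by (intro mult_left_mono mult_mono a b) (use q1 P1 in auto)
    then show ?thesis by (simp only: mult.assoc mult.commute mult.left_commute)
  qed
  have "real M ^ ((2 * n + 1) * d + 2) = P ^ (2 * n + 1) * m\<^sup>2"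
    by (simp only: P_def m_def power_add power_mult mult.commute[of "2 * n + 1" d])
  then have "gap_const n d * real M ^ ((2 * n + 1) * d + 2) =
      384 * (real n)\<^sup>2 * (real d)\<^sup>2 * m\<^sup>2 * ?X + 9 * 2 ^ n * real n * (576 * (real d)\<^sup>2 * (1 + (real n)\<^sup>2) + 2) * m\<^sup>2 * ?X"
    unfolding gap_const_def q_def[symmetric] by (simp only: distrib_right distrib_left mult.assoc mult.commute mult.left_commute)
  moreover have "0 \<le> 9 * 2 ^ n * real n * (576 * (real d)\<^sup>2 * (1 + (real n)\<^sup>2) + 2) * m\<^sup>2 * ?X"
    using q1 P1 by (intro mult_nonneg_nonneg) auto
  ultimately show ?thesis using 1 2 unfolding l_def by (cases "n = 1") auto
qed

context velocity_level_set
begin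

text \<open>In D = B/4 + C/2 both terms are nonnegative, so each energy alone is bounded by a
  multiple of the full Dirichlet form.\<close>

lemma sum_sum_diff_square_le:
  fixes f :: "'d config \<Rightarrow> real"
  assumes M: "M \<ge> 1"
  shows "(\<Sum>\<eta>\<in>Y. \<Sum>\<eta>'\<in>Y. (f \<eta> - f \<eta>')\<^sup>2) \<le> 2 * real (card Y) *
    (gap_const n CARD('d) * real M ^ ((2 * n + 1) * CARD('d) + 2) * (\<Sum>\<eta>\<in>Y. f \<eta> * - (L_ex V M f \<eta> + L_coll V M f \<eta>)))"
proof -
  define B C where "B = bond_energy f V M Y" and "C = (\<Sum>q\<in>collisions V. coll_energy f M q Y)"
  define D where "D = (\<Sum>\<eta>\<in>Y. f \<eta> * - (L_ex V M f \<eta> + L_coll V M f \<eta>))"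
  define t where "t = (real (volume * (2 * n)) * (4 * real M * real CARD('d)))\<^sup>2"
  let ?\<tau> = "(12 * real M * real CARD('d))\<^sup>2" and ?K = "label M ` Y"
  have "4 * (\<Sum>\<eta>\<in>Y. f \<eta> * - L_ex V M f \<eta>) = B"
    unfolding B_def by (rule exchange_dirichlet_form[OF finite_Y Y_configs]) (simp add: Y_def exchange_mem_level_set)
  moreover have "2 * (\<Sum>\<eta>\<in>Y. f \<eta> * - L_coll V M f \<eta>) = C"
    unfolding C_def by (rule collision_dirichlet_form[OF finite_V finite_Y Y_configs]) (simp add: Y_def collide_mem_level_set)
  moreover have "D = (\<Sum>\<eta>\<in>Y. f \<eta> * - L_ex V M f \<eta>) + (\<Sum>\<eta>\<in>Y. f \<eta> * - L_coll V M f \<eta>)"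
    unfolding D_def by (simp add: sum.distrib[symmetric] algebra_simps)
  ultimately have D: "D = B / 4 + C / 2" by simp
  have B0: "0 \<le> B" by (simp add: B_def bond_energy_nonneg)
  have C0: "0 \<le> C" unfolding C_def by (intro sum_nonneg coll_energy_nonneg[OF Y_configs])
  have BD: "B \<le> 4 * D" and CD: "C \<le> 2 * D" using D B0 C0 by simp_all
  have D0: "0 \<le> D" using D B0 C0 by simp
  let ?bt = "\<Sum>a\<in>?K. \<Sum>b\<in>?K. real (card (cell a)) * real (card (cell b)) * (cell_mean f a - cell_mean f b)\<^sup>2"
  let ?r = "9 * (real volume + 1) ^ (n - 1) * real n * real volume ^ 4 * (4 * ?\<tau> * (1 + (real n)\<^sup>2) + 2)"
  have bt: "3 * ?bt \<le> 2 * real (card Y) * ((if n = 1 then 0 else ?r) * D)"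
  proof (cases "n = 1")
    case True
    \<comment> \<open>With a single label the between-cell sum vanishes, so no fourth power of
      |Lambda| arises.\<close>
    then have "card ?K \<le> Suc 0" using card_labels_le by simp
    then have "\<forall>a\<in>?K. \<forall>b\<in>?K. a = b"
      unfolding card_le_Suc0_iff_eq[OF finite_imageI[OF finite_Y, of "label M"]] .
    then have eq: "a = b" if "a \<in> ?K" "b \<in> ?K" for a b using that by blast
    have bt0: "?bt = 0"
    proof (intro sum.neutral ballI)
      fix a b assume "a \<in> ?K" "b \<in> ?K"
      from eq[OF this] show "real (card (cell a)) * real (card (cell b)) * (cell_mean f a - cell_mean f b)\<^sup>2 = 0" by simp
    qed
    show ?thesis unfolding bt0 using True by simp
  next
    case False
    have *: "3 * (2 * K * y * (N * L * (3 * L ^ 3 * (T * (u * (4 * D)) + 2 * D)))) =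
      2 * y * (9 * K * N * L ^ 4 * (4 * T * u + 2) * D)" for K y N L T u :: real
      by (simp add: algebra_simps power3_eq_cube power4_eq_xxxx)
    have "3 * ?bt \<le> 3 * (2 * (real volume + 1) ^ (n - 1) * real (card Y) * (real (n * volume) *
        (3 * real volume ^ 3 * (?\<tau> * ((1 + (real n)\<^sup>2) * B) + C))))"
      unfolding B_def C_def by (rule mult_left_mono[OF between_cells_le]) simp
    also have "\<dots> \<le> 3 * (2 * (real volume + 1) ^ (n - 1) * real (card Y) * (real (n * volume) *
        (3 * real volume ^ 3 * (?\<tau> * ((1 + (real n)\<^sup>2) * (4 * D)) + 2 * D))))"
      by (intro mult_left_mono add_mono BD CD) auto
    also have "\<dots> = 2 * real (card Y) * (?r * D)"
      unfolding of_nat_mult by (rule *)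
    finally show ?thesis using False by simp
  qed
  have wt: "6 * real (card Y) * (\<Sum>a\<in>?K. \<Sum>\<eta>\<in>cell a. (f \<eta> - cell_mean f a)\<^sup>2) \<le> 2 * real (card Y) * (6 * t * D)"
  proof -
    have "(\<Sum>a\<in>?K. \<Sum>\<eta>\<in>cell a. (f \<eta> - cell_mean f a)\<^sup>2) \<le> t * B / 2"
      using within_cells_le[of f] by (simp only: card_V t_def B_def)
    also have "\<dots> \<le> 2 * t * D"
      using mult_left_mono[OF BD, of t] by (simp add: t_def)
    finally have "6 * real (card Y) * (\<Sum>a\<in>?K. \<Sum>\<eta>\<in>cell a. (f \<eta> - cell_mean f a)\<^sup>2) \<le> 6 * real (card Y) * (2 * t * D)"
      by (rule mult_left_mono) simp
    then show ?thesis by (simp add: mult.assoc)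
  qed
  have "(\<Sum>\<eta>\<in>Y. \<Sum>\<eta>'\<in>Y. (f \<eta> - f \<eta>')\<^sup>2) \<le>
      6 * real (card Y) * (\<Sum>a\<in>?K. \<Sum>\<eta>\<in>cell a. (f \<eta> - cell_mean f a)\<^sup>2) + 3 * ?bt"
    unfolding cell_mean_def by (rule sum_sum_diff_square_partition_le[OF finite_Y])
  also have "\<dots> \<le> 2 * real (card Y) * (6 * t * D) + 2 * real (card Y) * ((if n = 1 then 0 else ?r) * D)"
    by (rule add_mono[OF wt bt])
  also have "\<dots> = 2 * real (card Y) * ((6 * t + (if n = 1 then 0 else ?r)) * D)"
    by (simp only: distrib_left distrib_right)
  also have "\<dots> \<le> 2 * real (card Y) * (gap_const n CARD('d) * real M ^ ((2 * n + 1) * CARD('d) + 2) * D)"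
    unfolding t_def
    by (intro mult_left_mono mult_right_mono gap_const_bound n M D0) (simp_all add: volume_def card_Lam)
  finally show ?thesis unfolding D_def .
qed

lemma spectral_gap:
  fixes f :: "'d config \<Rightarrow> real"
  assumes M: "M \<ge> 1" and ne: "Y \<noteq> {}"
  shows "measure_pmf.expectation (pmf_of_set Y) (\<lambda>\<eta>. (f \<eta> - measure_pmf.expectation (pmf_of_set Y) f)\<^sup>2)
    \<le> gap_const n CARD('d) * real M ^ ((2 * n + 1) * CARD('d) + 2)
      * pmf_inner (pmf_of_set Y) f (\<lambda>\<eta>. - (L_ex V M f \<eta> + L_coll V M f \<eta>))"
proof -
  let ?C = "gap_const n CARD('d) * real M ^ ((2 * n + 1) * CARD('d) + 2)"
  let ?S = "\<Sum>\<eta>\<in>Y. (f \<eta> - (\<Sum>\<zeta>\<in>Y. f \<zeta>) / real (card Y))\<^sup>2"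
  let ?D = "\<Sum>\<eta>\<in>Y. f \<eta> * - (L_ex V M f \<eta> + L_coll V M f \<eta>)"
  have pos: "real (card Y) > 0" using ne finite_Y by (simp add: card_gt_0_iff)
  have "2 * real (card Y) * ?S \<le> 2 * real (card Y) * (?C * ?D)"
    using sum_sum_diff_square_le[OF M, of f] unfolding sum_sum_diff_square[OF finite_Y] .
  then have "?S \<le> ?C * ?D" using pos by simp
  then have "?S / real (card Y) \<le> ?C * ?D / real (card Y)" by (rule divide_right_mono) simp
  then show ?thesis by (simp add: pmf_inner_def integral_pmf_of_set[OF ne finite_Y])
qed

end

section \<open>Invertibility of the moment matrix, and the conclusion\<close>

lemma tensor_mult_vec: "tensor a b *v x = (b \<bullet> x) *\<^sub>R a"
  by (simp add: vec_eq_iff tensor_def matrix_vector_mult_def inner_vec_def sum_distrib_left mult.assoc mult.commute mult.left_commute)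

text \<open>The quadratic form of the matrix is a sum of squares, so a kernel vector is orthogonal
  to every \<open>b u\<close>.\<close>

lemma invertible_sum_tensor:
  fixes b :: "'a \<Rightarrow> real^'m"
  assumes V: "finite V" and x: "\<And>x. (\<And>u. u \<in> V \<Longrightarrow> b u \<bullet> x = 0) \<Longrightarrow> x = 0"
  shows "invertible (\<Sum>u\<in>V. tensor (b u) (b u))"
  unfolding invertible_left_inverse matrix_left_invertible_ker
proof (intro allI impI)
  fix x assume "(\<Sum>u\<in>V. tensor (b u) (b u)) *v x = 0"
  moreover have "(\<Sum>u\<in>V. tensor (b u) (b u)) *v x = (\<Sum>u\<in>V. (b u \<bullet> x) *\<^sub>R b u)"
    using V by (induction V) (simp_all add: matrix_vector_mult_add_rdistrib tensor_mult_vec)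
  ultimately have "(\<Sum>u\<in>V. (b u \<bullet> x) *\<^sub>R b u) \<bullet> x = 0" by simp
  then have "(\<Sum>u\<in>V. (b u \<bullet> x)\<^sup>2) = 0" by (simp add: inner_sum_left power2_eq_square)
  then have "\<forall>u\<in>V. b u \<bullet> x = 0" using V by (simp add: sum_nonneg_eq_0_iff)
  then show "x = 0" using x by blast
qed

lemma inner_bvec: "bvec u \<bullet> x = x $ None + u \<bullet> (\<chi> j. x $ Some j)"
  by (simp add: inner_vec_def bvec_def UNIV_option_conv sum.reindex)

lemma invertible_velocities:
  assumes n: "n \<ge> 1" and span: "span (v ` {1..n}) = (UNIV :: (real^'d) set)"
  shows "invertible (\<Sum>u\<in>velocities n vstar v. tensor (bvec u) (bvec u))"
proof (rule invertible_sum_tensor)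
  show "finite (velocities n vstar v)" by (simp add: velocities_def)
  fix x :: "real^('d option)"
  assume x: "\<And>u. u \<in> velocities n vstar v \<Longrightarrow> bvec u \<bullet> x = 0"
  let ?y = "\<chi> j. x $ Some j"
  have pm: "x $ None + (vstar + v l) \<bullet> ?y = 0" "x $ None + (vstar - v l) \<bullet> ?y = 0" if "l \<in> {1..n}" for l
    using x[of "vstar + v l"] x[of "vstar - v l"] that unfolding inner_bvec velocities_def by blast+
  have "v l \<bullet> ?y = 0" if "l \<in> {1..n}" for l
    using pm[OF that] by (simp add: inner_add_left inner_diff_left)
  then have "orthogonal ?y u" if "u \<in> v ` {1..n}" for u
    using that by (auto simp: orthogonal_def inner_commute)
  then have "orthogonal ?y ?y" by (intro orthogonal_to_span[of ?y "v ` {1..n}"]) (simp_all only: span UNIV_I)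
  then have y: "?y = 0" by (simp add: orthogonal_def)
  then have "x $ None = 0" using pm(1)[of 1] n by simp
  moreover have "x $ Some j = 0" for j using y by (simp add: vec_eq_iff)
  ultimately show "x = 0" by (auto simp: vec_eq_iff split: option.splits) (metis option.exhaust)
qed

theorem proposition2p6:
  fixes V :: "(real^'d) set"
  shows "(\<forall>n vstar v. n \<ge> 1 \<and> V = velocities n vstar v \<and> span (v ` {1..n}) = UNIV \<longrightarrow>
            invertible (\<Sum>u\<in>V. tensor (bvec u) (bvec u)))
       \<and> (\<exists>C :: real. \<forall>n vstar v. n \<ge> 1 \<and> V = velocities n vstar v \<and> int_independent n v \<longrightarrow>
            (\<forall>M\<ge>1. \<forall>i\<in>invariant_values V M. \<forall>f :: 'd config \<Rightarrow> real.
               measure_pmf.expectation (canonical V M i)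
                 (\<lambda>\<eta>. (f \<eta> - measure_pmf.expectation (canonical V M i) f)\<^sup>2)
               \<le> C * real M ^ ((2 * n + 1) * CARD('d) + 2)
                   * pmf_inner (canonical V M i) f (\<lambda>\<eta>. - (L_ex V M f \<eta> + L_coll V M f \<eta>))))"
proof (intro conjI exI[of _ "gap_const (card V div 2) CARD('d)"] allI impI ballI; elim conjE)
  fix n :: nat and vstar :: "real^'d" and v
  assume "n \<ge> 1" "V = velocities n vstar v" "span (v ` {1..n}) = UNIV"
  then show "invertible (\<Sum>u\<in>V. tensor (bvec u) (bvec u))" by (simp add: invertible_velocities)
next
  fix n :: nat and vstar :: "real^'d" and v and M :: nat and i and f :: "'d config \<Rightarrow> real"
  assume a: "n \<ge> 1" "V = velocities n vstar v" "int_independent n v" and M: "1 \<le> M" and i: "i \<in> invariant_values V M"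
  interpret velocity_level_set n vstar v V M i "level_set V M i" "card (Lam M :: (int^'d) set)"
    by unfold_locales (use a in auto)
  have "level_set V M i \<noteq> {}" using i by (auto simp: invariant_values_def level_set_def)
  from spectral_gap[OF M this, of f]
  show "measure_pmf.expectation (canonical V M i) (\<lambda>\<eta>. (f \<eta> - measure_pmf.expectation (canonical V M i) f)\<^sup>2)
      \<le> gap_const (card V div 2) CARD('d) * real M ^ ((2 * n + 1) * CARD('d) + 2)
        * pmf_inner (canonical V M i) f (\<lambda>\<eta>. - (L_ex V M f \<eta> + L_coll V M f \<eta>))"
    \<comment> \<open>By \<open>card_V\<close>, half the cardinality of \<open>V\<close> is n; the
      constant chosen before n thus depends only on \<open>V\<close> and the dimension.\<close>
    by (simp add: card_V canonical_def)
qed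

end
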